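(* Let $k\ge 2$, let $a_1,\dots,a_k$ be non-zero integers, let $A=(a_1\ \cdots\ a_k)$ be the corresponding $1\times k$ integer matrix and let $b$ be an integer, so that $Ax=b$ is the single linear equation $a_1x_1+\dots+a_kx_k=b$. \begin{itemize} \item[(i)] If the pair $(A,b)$ is irredundant and $A$ is irredundant and satisfies $( * )$, then the $(A,b)$-game on $[n]_p$ has a threshold probability of $\Theta(n^{-\frac{k-2}{k-1}})$; that is, there are constants $C,c>0$ such that if $p>Cn^{-\frac{k-2}{k-1}}$ then Maker wins the $(A,b)$-game on $[n]_p$ w.h.p., and if $p<cn^{-\frac{k-2}{k-1}}$ then Breaker wins the $(A,b)$-game on $[n]_p$ w.h.p. \item[(ii)] If the pair $(A,b)$ is irredundant and $A$ is irredundant and does not satisfy $( * )$, then the $(A,b)$-game on $[n]_p$ is Maker's win w.h.p. if $p\gg n^{-1/3}$ and Breaker's win w.h.p. if $p\ll n^{-1/3}$. \item[(iii)] If the pair $(A,b)$ is irredundant and $A$ is not irredundant, then (a) if the coefficients $a_i$ are all positive or all negative, the $(A,b)$-game on $[n]_p$ is Breaker's win w.h.p. for any $p=o(1)$; (b) otherwise, the $(A,b)$-game on $[n]_p$ is Maker's win w.h.p. if $p\gg n^{-1/3}$ and Breaker's win w.h.p. if $p\ll n^{-1/3}$. \item[(iv)] If the pair $(A,b)$ is not irredundant, then the $(A,b)$-game on $[n]$ is Breaker's win. \end{itemize}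
   Context: For an integer matrix $A$ of dimension $\ell\times k$ and integer vector $b$ of dimension $\ell$, a solution $x=(x_1,\dots,x_k)$ to $Ax=b$ is $k$-distinct if the $x_i$ are pairwise distinct. The pair $(A,b)$ is irredundant if $Ax=b$ has a $k$-distinct solution in $\mathbb{N}$; $A$ is irredundant if $(A,0)$ is. $A$ satisfies $( * )$ if under Gaussian elimination $A$ does not have any row which consists of precisely two non-zero rational entries. For a set of integers $X$, the $(A,b)$-game on $X$ is the Maker-Breaker game in which Maker and Breaker alternately claim previously unclaimed elements of $X$ (Maker first); Maker wins if at the end the set of elements she claimed contains all entries of some $k$-distinct solution to $Ax=b$, and Breaker wins otherwise. $[n]=\{1,\dots,n\}$, and $[n]_p$ is the random subset of $[n]$ containing each element independently with probability $p$ ($p=p(n)$). "W.h.p." means with probability tending to $1$ as $n\to\infty$. $p\gg f$ means $p/f\to\infty$ and $p\ll f$ means $p/f\to 0$. *)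

theory Defs
  imports "HOL-Probability.Product_PMF" "Jordan_Normal_Form.Gauss_Jordan_Elimination"
begin

unbundle no vec_syntax

definition distinct_solution :: "int Matrix.mat \<Rightarrow> int Matrix.vec \<Rightarrow> int Matrix.vec \<Rightarrow> bool" where
  "distinct_solution A b x \<longleftrightarrow>
     x \<in> carrier_vec (dim_col A) \<and> A *\<^sub>v x = b \<and>
     (\<forall>i < dim_col A. \<forall>j < dim_col A. i \<noteq> j \<longrightarrow> x $ i \<noteq> x $ j)"

text \<open>Here the natural numbers are the positive integers, in line with \<open>[n] = {1, \<dots>, n}\<close>.\<close>

definition irredundant_pair :: "int Matrix.mat \<Rightarrow> int Matrix.vec \<Rightarrow> bool" where
  "irredundant_pair A b \<longleftrightarrow>
     (\<exists>x. distinct_solution A b x \<and> (\<forall>i < dim_col A. x $ i > 0))"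

definition irredundant :: "int Matrix.mat \<Rightarrow> bool" where
  "irredundant A \<longleftrightarrow> irredundant_pair A (0\<^sub>v (dim_row A))"

text \<open>The matrices that arise from \<open>A\<close> under Gaussian elimination, that is, by elementary row
  operations over the rationals in any order. Following one particular elimination procedure
  would make the property below depend on the order of the columns.\<close>

inductive gauss_reachable :: "rat Matrix.mat \<Rightarrow> rat Matrix.mat \<Rightarrow> bool" for A where
  refl: "gauss_reachable A A"
| swap: "gauss_reachable A (swaprows r s B)"
    if "gauss_reachable A B" "r < dim_row B" "s < dim_row B"
| mult: "gauss_reachable A (multrow r q B)"
    if "gauss_reachable A B" "r < dim_row B" "q \<noteq> 0"
| add: "gauss_reachable A (addrow q r s B)"
    if "gauss_reachable A B" "r < dim_row B" "s < dim_row B" "r \<noteq> s"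

definition satisfies_star :: "int Matrix.mat \<Rightarrow> bool" where
  "satisfies_star A \<longleftrightarrow>
     (\<forall>B. gauss_reachable (map_mat rat_of_int A) B \<longrightarrow>
       \<not> (\<exists>i < dim_row B. card {j. j < dim_col B \<and> B $$ (i, j) \<noteq> 0} = 2))"

text \<open>A play on a finite board \<open>X\<close> is recorded as the list of all elements of \<open>X\<close> in the order
  in which they are claimed. Maker moves first, so the entries at even positions (counted
  from 0) are hers and those at odd positions are Breaker's. A strategy maps the moves made so
  far to an unclaimed element.\<close>

definition is_play :: "'a set \<Rightarrow> 'a list \<Rightarrow> bool" where
  "is_play X xs \<longleftrightarrow> distinct xs \<and> set xs = X"

definition is_strategy :: "'a set \<Rightarrow> ('a list \<Rightarrow> 'a) \<Rightarrow> bool" where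
  "is_strategy X \<sigma> \<longleftrightarrow> (\<forall>h. distinct h \<and> set h \<subset> X \<longrightarrow> \<sigma> h \<in> X - set h)"

definition follows_as_maker :: "('a list \<Rightarrow> 'a) \<Rightarrow> 'a list \<Rightarrow> bool" where
  "follows_as_maker \<sigma> xs \<longleftrightarrow> (\<forall>i < length xs. even i \<longrightarrow> xs ! i = \<sigma> (take i xs))"

definition follows_as_breaker :: "('a list \<Rightarrow> 'a) \<Rightarrow> 'a list \<Rightarrow> bool" where
  "follows_as_breaker \<sigma> xs \<longleftrightarrow> (\<forall>i < length xs. odd i \<longrightarrow> xs ! i = \<sigma> (take i xs))"

definition maker_set :: "'a list \<Rightarrow> 'a set" where
  "maker_set xs = {xs ! i | i. i < length xs \<and> even i}"

definition won_by_maker :: "int Matrix.mat \<Rightarrow> int Matrix.vec \<Rightarrow> int list \<Rightarrow> bool" where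
  "won_by_maker A b xs \<longleftrightarrow>
     (\<exists>x. distinct_solution A b x \<and> (\<forall>i < dim_col A. x $ i \<in> maker_set xs))"

definition makers_win :: "int Matrix.mat \<Rightarrow> int Matrix.vec \<Rightarrow> int set \<Rightarrow> bool" where
  "makers_win A b X \<longleftrightarrow> finite X \<and>
     (\<exists>\<sigma>. is_strategy X \<sigma> \<and>
       (\<forall>xs. is_play X xs \<and> follows_as_maker \<sigma> xs \<longrightarrow> won_by_maker A b xs))"

definition breakers_win :: "int Matrix.mat \<Rightarrow> int Matrix.vec \<Rightarrow> int set \<Rightarrow> bool" where
  "breakers_win A b X \<longleftrightarrow> finite X \<and>
     (\<exists>\<sigma>. is_strategy X \<sigma> \<and>
       (\<forall>xs. is_play X xs \<and> follows_as_breaker \<sigma> xs \<longrightarrow> \<not> won_by_maker A b xs))"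

definition interval :: "nat \<Rightarrow> int set" where
  "interval n = {1..int n}"

text \<open>The random set \<open>[n]\<^sub>p\<close>; meaningful for \<open>0 \<le> p \<le> 1\<close>, since \<^const>\<open>bernoulli_pmf\<close> clamps its
  parameter.\<close>

definition random_interval :: "nat \<Rightarrow> real \<Rightarrow> int set pmf" where
  "random_interval n p =
     map_pmf (\<lambda>f. {x \<in> interval n. f x}) (Pi_pmf (interval n) False (\<lambda>_. bernoulli_pmf p))"

definition whp :: "(nat \<Rightarrow> real) \<Rightarrow> (int set \<Rightarrow> bool) \<Rightarrow> bool" where
  "whp p Q \<longleftrightarrow>
     (\<lambda>n. measure_pmf.prob (random_interval n (p n)) {X. Q X}) \<longlonglongrightarrow> 1"

definition prob_function :: "(nat \<Rightarrow> real) \<Rightarrow> bool" where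
  "prob_function p \<longleftrightarrow> (\<forall>n. 0 \<le> p n \<and> p n \<le> 1)"

definition much_greater :: "(nat \<Rightarrow> real) \<Rightarrow> (nat \<Rightarrow> real) \<Rightarrow> bool" (infix \<open>\<ggreater>\<close> 50) where
  "p \<ggreater> f \<longleftrightarrow> filterlim (\<lambda>n. p n / f n) at_top sequentially"

definition much_less :: "(nat \<Rightarrow> real) \<Rightarrow> (nat \<Rightarrow> real) \<Rightarrow> bool" (infix \<open>\<lless>\<close> 50) where
  "p \<lless> f \<longleftrightarrow> (\<lambda>n. p n / f n) \<longlonglongrightarrow> 0"

text \<open>The coefficients are indexed from 1 to \<open>k\<close>, matrix columns from 0.\<close>

definition row_matrix :: "nat \<Rightarrow> (nat \<Rightarrow> int) \<Rightarrow> int Matrix.mat" where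
  "row_matrix k a = Matrix.mat 1 k (\<lambda>(i, j). a (Suc j))"

definition single_vec :: "int \<Rightarrow> int Matrix.vec" where
  "single_vec b = Matrix.vec 1 (\<lambda>i. b)"

end

theory Submission
  imports Defs
begin

text \<open>For the Maker sides the solutions inside the random set are viewed as a hypergraph. At the
  threshold \<open>p = C n\<^bsup>-(k-2)/(k-1)\<^esup>\<close> it has about \<open>C\<^bsup>k-1\<^esup> n p\<close> edges on about \<open>n p\<close> vertices
  (second moment), while the expected number of pairs of edges sharing at least two vertices is of
  smaller order (first moment). Deleting these pairs leaves a linear hypergraph to which Beck's
  potential argument applies when \<open>C\<close> is large; larger \<open>p\<close> follow by coupling.

  For the Breaker side with \<open>k \<ge> 3\<close>, a component is explored from a vertex \<open>m\<close> by adding edges one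
  at a time, always preferring an edge that meets the current vertex set \<open>U\<close> in at least two but
  not all of its vertices. An edge meeting \<open>U\<close> in \<open>j\<close> vertices has excess \<open>j - 1\<close>. A first moment
  computation shows that below the threshold no exploration reaches total excess two, with high
  probability. Breaker then answers Maker's first move \<open>m\<close> in a component by a new vertex of the
  unique edge of positive excess. Every other added edge \<open>e\<close> met \<open>U\<close> in one vertex, and by the rule
  of preference every further edge inside \<open>U \<union> e\<close> contains all of \<open>e - U\<close>, so that a pair in
  \<open>e - U\<close> blocks them all.

  For \<open>k = 2\<close> the hypergraph is a graph of maximal degree two, and Maker wins exactly when it
  contains a path with two edges; this happens around \<open>n p\<^sup>3 = 1\<close>.\<close>

section \<open>Strategies from invariants\<close>

text \<open>Orders of magnitude are read in the unit \<delta> = n^(-1/(k-1)). The threshold is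
  \<delta>^(k-2), so n p is about 1/\<delta>, and attaching an edge that meets the explored set in j
  vertices costs about \<delta>^(j-1). For excess one the expected number of explorations is thus
  only bounded by a constant and cannot be excluded this way; excess two leaves \<delta>. Hence
  Breaker spends his one immediate reply on the irregular edge, and all other edges must be met by
  pairs, which can wait until Maker touches them. Components have no a priori bound on their size,
  so the union bound runs over explorations of every length; it converges because each branch costs
  a small constant and branches control the length. The four cases of the statement collapse: a
  single row can only be rescaled, so the star condition says k \<noteq> 2, and mixed signs with k
  \<ge> 3 already make \<open>A\<close> irredundant. What remains is k \<ge> 3, k = 2 with opposite
  signs, coefficients of one sign, and no positive solution.\<close>

definition breaker_set :: "'a list \<Rightarrow> 'a set" where
  "breaker_set xs = {xs ! i | i. i < length xs \<and> odd i}"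

lemma maker_set_Nil [simp]: "maker_set [] = {}"
  and breaker_set_Nil [simp]: "breaker_set [] = {}"
  by (auto simp: maker_set_def breaker_set_def)

lemma maker_set_snoc:
  "maker_set (xs @ [x]) = (if even (length xs) then insert x (maker_set xs) else maker_set xs)"
proof -
  have "maker_set (xs @ [x]) = (\<lambda>i. (xs @ [x]) ! i) ` {i. i < Suc (length xs) \<and> even i}"
    by (auto simp: maker_set_def)
  also have "{i. i < Suc (length xs) \<and> even i} = {i. i < length xs \<and> even i} \<union>
      (if even (length xs) then {length xs} else {})"
    by (auto simp: less_Suc_eq)
  also have "(\<lambda>i. (xs @ [x]) ! i) ` \<dots> = (\<lambda>i. xs ! i) ` {i. i < length xs \<and> even i} \<union>
      (if even (length xs) then {x} else {})"
    unfolding image_Un by (intro arg_cong2[where f = "(\<union>)"] image_cong) (auto simp: nth_append)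
  finally show ?thesis by (auto simp: maker_set_def)
qed

lemma breaker_set_snoc:
  "breaker_set (xs @ [x]) = (if odd (length xs) then insert x (breaker_set xs) else breaker_set xs)"
proof -
  have "breaker_set (xs @ [x]) = (\<lambda>i. (xs @ [x]) ! i) ` {i. i < Suc (length xs) \<and> odd i}"
    by (auto simp: breaker_set_def)
  also have "{i. i < Suc (length xs) \<and> odd i} = {i. i < length xs \<and> odd i} \<union>
      (if odd (length xs) then {length xs} else {})"
    by (auto simp: less_Suc_eq)
  also have "(\<lambda>i. (xs @ [x]) ! i) ` \<dots> = (\<lambda>i. xs ! i) ` {i. i < length xs \<and> odd i} \<union>
      (if odd (length xs) then {x} else {})"
    unfolding image_Un by (intro arg_cong2[where f = "(\<union>)"] image_cong) (auto simp: nth_append)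
  finally show ?thesis by (auto simp: breaker_set_def)
qed

lemma maker_set_Un_breaker_set: "maker_set xs \<union> breaker_set xs = set xs"
  by (auto simp: maker_set_def breaker_set_def in_set_conv_nth) blast

lemma maker_set_Int_breaker_set: "distinct xs \<Longrightarrow> maker_set xs \<inter> breaker_set xs = {}"
  by (auto simp: maker_set_def breaker_set_def distinct_conv_nth)

text \<open>\<open>is_strategy\<close> demands a free element after every proper history, also where
  no move satisfies \<open>P\<close>; the second \<open>SOME\<close> supplies one there.\<close>

definition completed_strategy :: "'a set \<Rightarrow> ('a list \<Rightarrow> 'a \<Rightarrow> bool) \<Rightarrow> 'a list \<Rightarrow> 'a" where
  "completed_strategy X P h =
     (if \<exists>x. x \<in> X - set h \<and> P h x then SOME x. x \<in> X - set h \<and> P h x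
      else SOME x. x \<in> X - set h)"

lemma is_strategy_completed: "is_strategy X (completed_strategy X P)"
  unfolding is_strategy_def
proof (intro allI impI)
  fix h :: "'a list" assume h: "distinct h \<and> set h \<subset> X"
  show "completed_strategy X P h \<in> X - set h"
  proof (cases "\<exists>x. x \<in> X - set h \<and> P h x")
    case True
    then show ?thesis unfolding completed_strategy_def
      by (smt (verit, best) someI_ex)
  next
    case False
    from h have "\<exists>x. x \<in> X - set h" by auto
    then show ?thesis using False unfolding completed_strategy_def by (metis someI_ex)
  qed
qed

lemma completed_strategy_sat:
  "\<exists>x. x \<in> X - set h \<and> P h x \<Longrightarrow> P h (completed_strategy X P h)"
  unfolding completed_strategy_def by (smt (verit, best) someI_ex)

text \<open>The invariant speaks of positions after whole rounds. Since further elements of Breaker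
  never hurt (\<open>mono\<close>), the witness \<open>b\<close> may already be his, and
  \<open>Inv (insert m M) B\<close> covers both a final move of Maker and a move that calls for no
  answer: he then claims anything.\<close>

lemma breaker_strategy_from_invariant:
  fixes Inv :: "'a set \<Rightarrow> 'a set \<Rightarrow> bool"
  assumes init: "Inv {} {}"
    and mono: "\<And>M B B'. Inv M B \<Longrightarrow> B \<subseteq> B' \<Longrightarrow> B' \<inter> M = {} \<Longrightarrow> B' \<subseteq> X \<Longrightarrow> Inv M B'"
    and reply: "\<And>M B m. Inv M B \<Longrightarrow> M \<inter> B = {} \<Longrightarrow> M \<union> B \<subseteq> X \<Longrightarrow> m \<in> X - M - B \<Longrightarrow>
        Inv (insert m M) B \<or> (\<exists>b\<in>X - insert m M. Inv (insert m M) (insert b B))"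
  shows "\<exists>\<sigma>. is_strategy X \<sigma> \<and>
    (\<forall>xs. is_play X xs \<and> follows_as_breaker \<sigma> xs \<longrightarrow> Inv (maker_set xs) (breaker_set xs))"
proof -
  define \<sigma> where "\<sigma> = completed_strategy X (\<lambda>h b. Inv (maker_set h) (insert b (breaker_set h)))"
  have "Inv (maker_set xs) (breaker_set xs)"
    if play: "is_play X xs" and fol: "follows_as_breaker \<sigma> xs" for xs
  proof -
    have dist: "distinct xs" and setxs: "set xs = X" using play by (auto simp: is_play_def)
    \<comment> \<open>With Breaker to move (\<open>i\<close> odd, play unfinished) the invariant may
      fail for the moment; what is carried is the existence of an answer that restores it.\<close>
    have step: "i \<le> length xs \<Longrightarrow>
        (if even i \<or> i = length xs then Inv (maker_set (take i xs)) (breaker_set (take i xs))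
         else \<exists>b. b \<in> X - set (take i xs) \<and>
              Inv (maker_set (take i xs)) (insert b (breaker_set (take i xs))))" for i
    proof (induction i)
      case 0
      show ?case using init by simp
    next
      case (Suc i)
      define h where "h = take i xs"
      define x where "x = xs ! i"
      have i: "i < length xs" using Suc.prems by simp
      have th: "take (Suc i) xs = h @ [x]" using i by (simp add: h_def x_def take_Suc_conv_app_nth)
      have lh: "length h = i" using i by (simp add: h_def)
      have dh: "distinct (h @ [x])" using dist th by (metis distinct_take)
      have sh: "set (h @ [x]) \<subseteq> X" using setxs th by (metis set_take_subset)
      show ?case
      proof (cases "even i")
        case True
        then have inv: "Inv (maker_set h) (breaker_set h)" using Suc i by (simp add: h_def)
        have xin: "x \<in> X - maker_set h - breaker_set h"
          using dh sh maker_set_Un_breaker_set[of h] by auto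
        have ms: "maker_set (h @ [x]) = insert x (maker_set h)" "breaker_set (h @ [x]) = breaker_set h"
          using True lh by (auto simp: maker_set_snoc breaker_set_snoc)
        have un: "maker_set (h @ [x]) \<union> breaker_set (h @ [x]) = set (h @ [x])"
          by (rule maker_set_Un_breaker_set)
        have int: "maker_set (h @ [x]) \<inter> breaker_set (h @ [x]) = {}"
          using dh by (rule maker_set_Int_breaker_set)
        have "Inv (insert x (maker_set h)) (breaker_set h) \<or>
            (\<exists>b\<in>X - insert x (maker_set h). Inv (insert x (maker_set h)) (insert b (breaker_set h)))"
        proof (rule reply[OF inv _ _ xin])
          show "maker_set h \<inter> breaker_set h = {}" using int ms by auto
          show "maker_set h \<union> breaker_set h \<subseteq> X" using un ms sh by auto
        qed
        then consider (now) "Inv (insert x (maker_set h)) (breaker_set h)"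
          | (later) b where "b \<in> X - set (h @ [x])" "Inv (insert x (maker_set h)) (insert b (breaker_set h))"
          using un ms by (metis DiffD1 DiffD2 DiffI UnE insert_absorb)
        then show ?thesis
        proof cases
          case now
          show ?thesis
          proof (cases "Suc i = length xs")
            case True
            then show ?thesis using now ms th by simp
          next
            case False
            then have si: "Suc i < length xs" using Suc.prems by simp
            \<comment> \<open>Any free element serves as an answer here by \<open>mono\<close>; the
              element that the play claims next is one.\<close>
            define b where "b = xs ! Suc i"
            have "b \<in> X" using si setxs by (auto simp: b_def)
            moreover have "b \<notin> set (h @ [x])"
              unfolding b_def th[symmetric] using si dist
              by (auto simp: in_set_conv_nth distinct_conv_nth)
            ultimately have b: "b \<in> X - set (h @ [x])" by simp
            have "Inv (insert x (maker_set h)) (insert b (breaker_set h))"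
            proof (rule mono[OF now])
              show "insert b (breaker_set h) \<inter> insert x (maker_set h) = {}"
                using b int ms un by auto
              show "insert b (breaker_set h) \<subseteq> X" using b un ms sh by auto
            qed auto
            with b show ?thesis using True False th ms by auto
          qed
        next
          case later
          have "Suc i \<noteq> length xs"
          proof
            assume "Suc i = length xs"
            then have "set (h @ [x]) = X" using th setxs by simp
            then show False using later(1) by simp
          qed
          then show ?thesis using later True th ms by auto
        qed
      next
        case False
        then obtain b where "b \<in> X - set h" "Inv (maker_set h) (insert b (breaker_set h))"
          using Suc i by (auto simp: h_def)
        then have "Inv (maker_set h) (insert (\<sigma> h) (breaker_set h))"
          unfolding \<sigma>_def
          by (intro completed_strategy_sat[where P = "\<lambda>h b. Inv (maker_set h) (insert b (breaker_set h))"]) blast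
        moreover have "x = \<sigma> h" using fol False i by (auto simp: follows_as_breaker_def x_def h_def)
        ultimately show ?thesis using False th lh by (simp add: maker_set_snoc breaker_set_snoc)
      qed
    qed
    from step[of "length xs"] show ?thesis by simp
  qed
  moreover have "is_strategy X \<sigma>" unfolding \<sigma>_def by (rule is_strategy_completed)
  ultimately show ?thesis by blast
qed

text \<open>A round is Maker's move together with an arbitrary answer, so the invariant is only
  asked to survive the pair. The clause for \<open>{m}\<close> is the last half round on a board of
  odd size.\<close>

lemma maker_strategy_from_invariant:
  fixes Inv :: "'a set \<Rightarrow> 'a set \<Rightarrow> bool"
  assumes init: "Inv {} {}"
    and move: "\<And>M B. Inv M B \<Longrightarrow> M \<inter> B = {} \<Longrightarrow> M \<union> B \<subset> X \<Longrightarrow>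
        \<exists>m\<in>X - M - B. (\<forall>b\<in>X - M - B - {m}. Inv (insert m M) (insert b B)) \<and>
                        (X - M - B = {m} \<longrightarrow> Inv (insert m M) B)"
  shows "\<exists>\<sigma>. is_strategy X \<sigma> \<and>
    (\<forall>xs. is_play X xs \<and> follows_as_maker \<sigma> xs \<longrightarrow> Inv (maker_set xs) (breaker_set xs))"
proof -
  define P where "P = (\<lambda>h m. (\<forall>b\<in>X - maker_set h - breaker_set h - {m}.
      Inv (insert m (maker_set h)) (insert b (breaker_set h))) \<and>
      (X - maker_set h - breaker_set h = {m} \<longrightarrow> Inv (insert m (maker_set h)) (breaker_set h)))"
  define \<sigma> where "\<sigma> = completed_strategy X P"
  have "Inv (maker_set xs) (breaker_set xs)"
    if play: "is_play X xs" and fol: "follows_as_maker \<sigma> xs" for xs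
  proof -
    have dist: "distinct xs" and setxs: "set xs = X" using play by (auto simp: is_play_def)
    have step: "i \<le> length xs \<Longrightarrow>
        (if even i \<or> i = length xs then Inv (maker_set (take i xs)) (breaker_set (take i xs))
         else \<forall>b\<in>X - set (take i xs). Inv (maker_set (take i xs)) (insert b (breaker_set (take i xs))))" for i
    proof (induction i)
      case 0
      show ?case using init by simp
    next
      case (Suc i)
      define h where "h = take i xs"
      define x where "x = xs ! i"
      have i: "i < length xs" using Suc.prems by simp
      have th: "take (Suc i) xs = h @ [x]" using i by (simp add: h_def x_def take_Suc_conv_app_nth)
      have lh: "length h = i" using i by (simp add: h_def)
      have dh: "distinct (h @ [x])" using dist th by (metis distinct_take)
      have sh: "set (h @ [x]) \<subseteq> X" using setxs th by (metis set_take_subset)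
      have un: "maker_set h \<union> breaker_set h = set h" by (rule maker_set_Un_breaker_set)
      show ?case
      proof (cases "even i")
        case True
        then have inv: "Inv (maker_set h) (breaker_set h)" using Suc i by (simp add: h_def)
        have ms: "maker_set (h @ [x]) = insert x (maker_set h)" "breaker_set (h @ [x]) = breaker_set h"
          using True lh by (auto simp: maker_set_snoc breaker_set_snoc)
        have eq: "X - maker_set h - breaker_set h = X - set h" using un by blast
        have "\<exists>m. m \<in> X - set h \<and> P h m"
        proof -
          have "maker_set h \<inter> breaker_set h = {}" using dh by (intro maker_set_Int_breaker_set) auto
          moreover have "maker_set h \<union> breaker_set h \<subset> X" using un dh sh by auto
          ultimately show ?thesis using move[OF inv] eq unfolding P_def by blast
        qed
        then have "P h (\<sigma> h)" unfolding \<sigma>_def by (rule completed_strategy_sat)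
        moreover have "x = \<sigma> h" using fol True i by (auto simp: follows_as_maker_def x_def h_def)
        ultimately have P: "P h x" by simp
        show ?thesis
        proof (cases "Suc i = length xs")
          case True
          then have "set (h @ [x]) = X" using th setxs by simp
          then have "X - set h = {x}" using dh by auto
          then show ?thesis using P ms th True eq unfolding P_def by auto
        next
          case False
          have "\<forall>b\<in>X - set (h @ [x]). Inv (insert x (maker_set h)) (insert b (breaker_set h))"
            using P eq unfolding P_def by auto
          then show ?thesis using False True th ms by simp
        qed
      next
        case False
        then have "\<forall>b\<in>X - set h. Inv (maker_set h) (insert b (breaker_set h))"
          using Suc i by (auto simp: h_def)
        moreover have "x \<in> X - set h" using dh sh by auto
        ultimately show ?thesis using False th lh by (simp add: maker_set_snoc breaker_set_snoc)
      qed
    qed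
    from step[of "length xs"] show ?thesis by simp
  qed
  moreover have "is_strategy X \<sigma>" unfolding \<sigma>_def by (rule is_strategy_completed)
  ultimately show ?thesis by blast
qed

section \<open>Solutions of one equation and the criterion of Beck\<close>

text \<open>Ordered tuples are kept; the winning set belonging to one is \<open>set xs\<close>, and
  several tuples may have the same winning set.\<close>

definition solutions :: "nat \<Rightarrow> (nat \<Rightarrow> int) \<Rightarrow> int \<Rightarrow> int list set" where
  "solutions k a b = {xs. length xs = k \<and> distinct xs \<and> (\<Sum>j<k. a (Suc j) * xs ! j) = b}"

lemma dim_col_row_matrix [simp]: "dim_col (row_matrix k a) = k"
  by (simp add: row_matrix_def)

lemma distinct_solution_iff:
  "distinct_solution (row_matrix k a) (single_vec b) x \<longleftrightarrow>
     dim_vec x = k \<and> list_of_vec x \<in> solutions k a b"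
proof -
  have eq: "row_matrix k a *\<^sub>v x = single_vec b \<longleftrightarrow> (\<Sum>j<k. a (Suc j) * list_of_vec x ! j) = b"
    if "dim_vec x = k"
  proof -
    have "row_matrix k a *\<^sub>v x = single_vec (\<Sum>j<k. a (Suc j) * list_of_vec x ! j)"
      using that unfolding list_of_vec_index
      by (auto simp: row_matrix_def single_vec_def scalar_prod_def lessThan_atLeast0
          intro!: sum.cong)
    moreover have "single_vec c = single_vec b \<longleftrightarrow> c = b" for c
      by (auto simp: single_vec_def dest: arg_cong[where f = "\<lambda>v. v $ 0"])
    ultimately show ?thesis by simp
  qed
  have dist: "distinct (list_of_vec x) \<longleftrightarrow> (\<forall>i<k. \<forall>j<k. i \<noteq> j \<longrightarrow> x $ i \<noteq> x $ j)"
    if "dim_vec x = k"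
    using that unfolding distinct_conv_nth list_of_vec_index by simp
  show ?thesis
    unfolding distinct_solution_def solutions_def dim_col_row_matrix mem_Collect_eq
      carrier_dim_vec length_list_of_vec using eq dist by blast
qed

lemma ex_distinct_solution_iff:
  "(\<exists>x. distinct_solution (row_matrix k a) (single_vec b) x \<and>
      (\<forall>i < dim_col (row_matrix k a). P (x $ i))) \<longleftrightarrow>
   (\<exists>xs\<in>solutions k a b. \<forall>y\<in>set xs. P y)" (is "?L \<longleftrightarrow> ?R")
proof
  assume ?L
  then obtain x where x: "dim_vec x = k" "list_of_vec x \<in> solutions k a b" "\<forall>i<k. P (x $ i)"
    by (auto simp: distinct_solution_iff)
  then have "\<forall>y\<in>set (list_of_vec x). P y"
    unfolding Ball_def in_set_conv_nth list_of_vec_index length_list_of_vec by blast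
  then show ?R using x by blast
next
  assume ?R
  then obtain xs where xs: "xs \<in> solutions k a b" "\<forall>y\<in>set xs. P y" by blast
  then have "length xs = k" by (simp add: solutions_def)
  then show ?L using xs
    by (intro exI[of _ "vec_of_list xs"], unfold distinct_solution_iff list_vec vec_of_list_index) auto
qed

lemma irredundant_pair_iff:
  "irredundant_pair (row_matrix k a) (single_vec b) \<longleftrightarrow> (\<exists>xs\<in>solutions k a b. \<forall>y\<in>set xs. y > 0)"
  unfolding irredundant_pair_def by (rule ex_distinct_solution_iff)

lemma irredundant_iff:
  "irredundant (row_matrix k a) \<longleftrightarrow> (\<exists>xs\<in>solutions k a 0. \<forall>y\<in>set xs. y > 0)"
proof -
  have "0\<^sub>v (dim_row (row_matrix k a)) = single_vec 0"
    by (auto simp: row_matrix_def single_vec_def)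
  then show ?thesis unfolding irredundant_def by (simp add: irredundant_pair_iff)
qed

lemma won_by_maker_iff:
  "won_by_maker (row_matrix k a) (single_vec b) xs \<longleftrightarrow>
     (\<exists>ys\<in>solutions k a b. set ys \<subseteq> maker_set xs)"
  unfolding won_by_maker_def
  using ex_distinct_solution_iff[of k a b "\<lambda>y. y \<in> maker_set xs"] by (simp add: subset_iff Ball_def)

text \<open>With one row a swap does nothing and there is no second row to add, so elimination can
  only rescale.\<close>

lemma gauss_reachable_row:
  assumes "gauss_reachable A B" "dim_row A = 1"
  shows "dim_row B = 1 \<and> dim_col B = dim_col A \<and>
    (\<exists>q. q \<noteq> 0 \<and> (\<forall>j<dim_col A. B $$ (0, j) = q * A $$ (0, j)))"
  using assms
proof (induction rule: gauss_reachable.induct)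
  case refl
  then show ?case by (auto intro!: exI[of _ 1])
next
  case (swap B r s)
  then show ?case by auto
next
  case (mult B r q)
  then obtain q' where "q' \<noteq> 0" "\<forall>j<dim_col A. B $$ (0, j) = q' * A $$ (0, j)" "r = 0"
    by auto
  then show ?case using mult by (auto intro!: exI[of _ "q * q'"])
next
  case (add B r s q)
  then show ?case by auto
qed

lemma satisfies_star_row_matrix:
  assumes "\<forall>i\<in>{1..k}. a i \<noteq> 0"
  shows "satisfies_star (row_matrix k a) \<longleftrightarrow> k \<noteq> 2"
proof -
  let ?A = "map_mat rat_of_int (row_matrix k a)"
  have *: "{j. j < dim_col B \<and> B $$ (i, j) \<noteq> 0} = {..<k}"
    if B: "gauss_reachable ?A B" and i: "i < dim_row B" for B i
  proof -
    from gauss_reachable_row[OF B] obtain q where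
      "dim_row B = 1" "dim_col B = k" "q \<noteq> 0" "\<forall>j<k. B $$ (0, j) = q * rat_of_int (a (Suc j))"
      by (auto simp: row_matrix_def)
    then show ?thesis using i assms by auto
  qed
  show ?thesis
  proof
    assume s: "satisfies_star (row_matrix k a)"
    have "gauss_reachable ?A ?A" by (rule gauss_reachable.refl)
    moreover have "0 < dim_row ?A" by (simp add: row_matrix_def)
    ultimately have "card {j. j < dim_col ?A \<and> ?A $$ (0, j) \<noteq> 0} \<noteq> 2"
      using s unfolding satisfies_star_def by blast
    then show "k \<noteq> 2" using *[of ?A 0, OF gauss_reachable.refl] by (simp add: row_matrix_def)
  next
    assume k: "k \<noteq> 2"
    show "satisfies_star (row_matrix k a)"
      unfolding satisfies_star_def
    proof (intro allI impI notI, elim exE conjE)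
      fix B i assume "gauss_reachable ?A B" "i < dim_row B"
        "card {j. j < dim_col B \<and> B $$ (i, j) \<noteq> 0} = 2"
      then show False using *[of B i] k by simp
    qed
  qed
qed

text \<open>Beck's weak-win criterion for linear hypergraphs. Maker always takes a vertex of maximal
  weight, where a surviving edge with \<open>r\<close> unclaimed vertices weighs \<open>2\<^sup>-\<^sup>r\<close>. A round then costs
  at most the weight of the edge through both claimed vertices, that is, at most \<open>1/4\<close>.\<close>

lemma maker_claims_edge:
  fixes E :: "'a set set"
  assumes finX: "finite X" and EX: "\<And>e. e \<in> E \<Longrightarrow> e \<subseteq> X \<and> card e = k"
    and linear: "\<And>e f. e \<in> E \<Longrightarrow> f \<in> E \<Longrightarrow> e \<noteq> f \<Longrightarrow> card (e \<inter> f) \<le> 1"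
    and big: "real (card E) / 2 ^ k > real (card (\<Union>E)) / 8"
  shows "\<exists>\<sigma>. is_strategy X \<sigma> \<and>
    (\<forall>xs. is_play X xs \<and> follows_as_maker \<sigma> xs \<longrightarrow> (\<exists>e\<in>E. e \<subseteq> maker_set xs))"
proof -
  have finE: "finite E" using finX EX by (meson Pow_iff finite_Pow_iff finite_subset subsetI)
  have fine: "finite e" if "e \<in> E" for e using EX[OF that] finX finite_subset by blast
  have finV: "finite (\<Union>E)" using finE fine by blast
  define g :: "'a set \<Rightarrow> 'a set \<Rightarrow> real" where "g M e = (1/2) ^ card (e - M)" for M e
  define alive where "alive B = {e \<in> E. e \<inter> B = {}}" for B
  define T where "T M B = (\<Sum>e\<in>alive B. g M e)" for M B
  \<comment> \<open>A round loses weight only if an edge contains both claimed vertices. Then at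
    most 1/4 is lost and two vertices leave \<open>\<Union>E - M - B\<close>, so a reserve of 1/8
    per unclaimed vertex of the hypergraph pays for all future losses.\<close>
  define Inv where "Inv M B \<longleftrightarrow> T M B - real (card (\<Union>E - M - B)) / 8 > 0" for M B
  have finA: "finite (alive B)" for B using finE by (simp add: alive_def)
  have gpos: "g M e > 0" for M e by (simp add: g_def)
  have gins: "g (insert m M) e = (if m \<in> e then 2 * g M e else g M e)"
    if "m \<notin> M" "e \<in> E" for m M e
  proof (cases "m \<in> e")
    case True
    then have "e - M = insert m (e - insert m M)" using that by auto
    then have "card (e - M) = Suc (card (e - insert m M))"
      using fine[OF that(2)] by (metis Diff_iff card_insert_disjoint finite_Diff insertI1)
    then show ?thesis using True by (simp add: g_def)
  next
    case False
    then have "e - insert m M = e - M" by auto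
    then show ?thesis using False by (simp add: g_def)
  qed
  have "\<exists>\<sigma>. is_strategy X \<sigma> \<and>
    (\<forall>xs. is_play X xs \<and> follows_as_maker \<sigma> xs \<longrightarrow> Inv (maker_set xs) (breaker_set xs))"
  proof (rule maker_strategy_from_invariant)
    have "T {} {} = (\<Sum>e\<in>E. (1/2) ^ k)"
      unfolding T_def alive_def g_def by (intro sum.cong) (auto simp: EX)
    then show "Inv {} {}" using big by (simp add: Inv_def power_one_over)
  next
    fix M B assume inv: "Inv M B" and MB: "M \<inter> B = {}" "M \<union> B \<subset> X"
    define F where "F = X - M - B"
    define w where "w v = (\<Sum>e\<in>alive B. if v \<in> e then g M e else 0)" for v
    have "finite F" "F \<noteq> {}" using MB finX by (auto simp: F_def)
    then have "Max (w ` F) \<in> w ` F" by (intro Max_in) auto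
    then obtain m where m: "m \<in> F" "w m = Max (w ` F)" by auto
    have wmax: "w b \<le> w m" if "b \<in> F" for b using that m \<open>finite F\<close> by simp
    have "Inv (insert m M) (insert b B)" if b: "b \<in> F - {m}" for b
    proof -
      define w2 where "w2 = (\<Sum>e\<in>alive B. if m \<in> e \<and> b \<in> e then g M e else 0)"
      have "T (insert m M) (insert b B) = (\<Sum>e\<in>alive B. if b \<in> e then 0 else g (insert m M) e)"
        unfolding T_def by (intro sum.mono_neutral_cong_left finA) (auto simp: alive_def)
      \<comment> \<open>Maker doubles the edges through \<open>m\<close>, Breaker kills those
        through \<open>b\<close>. For an edge through both, the credited doubling has to be taken
        back, which is the last term.\<close>
      also have "\<dots> = (\<Sum>e\<in>alive B. g M e + (if m \<in> e then g M e else 0) -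
          (if b \<in> e then g M e else 0) - (if m \<in> e \<and> b \<in> e then g M e else 0))"
        using m by (intro sum.cong) (auto simp: gins F_def alive_def)
      also have "\<dots> = T M B + w m - w b - w2"
        by (simp add: sum.distrib sum_subtractf T_def w_def w2_def)
      finally have T': "T (insert m M) (insert b B) \<ge> T M B - w2" using wmax b by auto
      have sub: "\<Union>E - insert m M - insert b B \<subseteq> \<Union>E - M - B" by auto
      show ?thesis
      proof (cases "\<exists>e\<in>alive B. m \<in> e \<and> b \<in> e")
        case False
        then have "w2 = 0" unfolding w2_def by (intro sum.neutral) auto
        moreover have "card (\<Union>E - insert m M - insert b B) \<le> card (\<Union>E - M - B)"
          using sub finV by (intro card_mono) auto
        ultimately show ?thesis using inv T' unfolding Inv_def by simp
      next
        case True
        then obtain e where e: "e \<in> alive B" "m \<in> e" "b \<in> e" by blast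
        have uniq: "f = e" if f: "f \<in> alive B" "m \<in> f" "b \<in> f" for f
        proof (rule ccontr)
          assume "f \<noteq> e"
          then have "card (f \<inter> e) \<le> 1" using linear f e by (auto simp: alive_def)
          moreover have "card {m, b} \<le> card (f \<inter> e)"
            using f e fine by (intro card_mono) (auto simp: alive_def)
          ultimately show False using b by auto
        qed
        have iff: "m \<in> f \<and> b \<in> f \<longleftrightarrow> f = e" if "f \<in> alive B" for f
          using that uniq e by blast
        have "w2 = (\<Sum>f\<in>alive B. if f = e then g M f else 0)"
          unfolding w2_def by (intro sum.cong if_cong iff) auto
        also have "\<dots> = (1/2) ^ card (e - M)" using e(1) finA by (simp add: g_def)
        also have "\<dots> \<le> (1/2) ^ 2"
        proof (rule power_decreasing)
          have "card {m, b} \<le> card (e - M)"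
            using e m b fine by (intro card_mono) (auto simp: alive_def F_def)
          then show "2 \<le> card (e - M)" using b by auto
        qed auto
        finally have "w2 \<le> 1/4" by (simp add: power2_eq_square)
        moreover have "card (\<Union>E - M - B) = card (\<Union>E - insert m M - insert b B) + 2"
        proof -
          define R where "R = \<Union>E - insert m M - insert b B"
          have "card ({m, b} \<union> R) = card {m, b} + card R"
            using finV by (intro card_Un_disjoint) (auto simp: R_def)
          moreover have "{m, b} \<union> R = \<Union>E - M - B"
            using e m b by (auto simp: alive_def F_def R_def)
          moreover have "m \<noteq> b" using b by auto
          then have "card {m, b} = 2" by simp
          ultimately show ?thesis unfolding R_def by simp
        qed
        ultimately show ?thesis using inv T' unfolding Inv_def by (simp add: field_simps)
      qed
    qed
    moreover have "Inv (insert m M) B"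
    proof -
      have "T M B \<le> T (insert m M) B"
        unfolding T_def using m gpos
        by (intro sum_mono) (auto simp: gins F_def alive_def less_imp_le)
      moreover have "card (\<Union>E - insert m M - B) \<le> card (\<Union>E - M - B)"
        using finV by (intro card_mono) auto
      ultimately show ?thesis using inv unfolding Inv_def by simp
    qed
    ultimately show "\<exists>m\<in>X - M - B. (\<forall>b\<in>X - M - B - {m}. Inv (insert m M) (insert b B)) \<and>
                        (X - M - B = {m} \<longrightarrow> Inv (insert m M) B)"
      using m unfolding F_def by blast
  qed
  moreover have "\<exists>e\<in>E. e \<subseteq> maker_set xs"
    if "is_play X xs" "Inv (maker_set xs) (breaker_set xs)" for xs
  proof -
    have un: "maker_set xs \<union> breaker_set xs = X"
      using that(1) by (simp add: maker_set_Un_breaker_set is_play_def)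
    have "T (maker_set xs) (breaker_set xs) > 0" using that(2) unfolding Inv_def
      by (smt (verit, best) divide_nonneg_nonneg of_nat_0_le_iff)
    then have "alive (breaker_set xs) \<noteq> {}" unfolding T_def by (metis less_irrefl sum.empty)
    then obtain e where "e \<in> E" "e \<inter> breaker_set xs = {}" by (auto simp: alive_def)
    then show ?thesis using EX un by blast
  qed
  ultimately show ?thesis by blast
qed

text \<open>Two orderings of one vertex set would overlap in \<open>k \<ge> 2\<close> elements, so
  \<open>linear\<close> makes \<open>set\<close> injective on \<open>I\<close>, and counting tuples
  is counting edges.\<close>

lemma makers_win_if_many_solutions:
  assumes finX: "finite X" and IX: "\<And>xs. xs \<in> I \<Longrightarrow> xs \<in> solutions k a b \<and> set xs \<subseteq> X"
    and linear: "\<And>xs ys. xs \<in> I \<Longrightarrow> ys \<in> I \<Longrightarrow> xs \<noteq> ys \<Longrightarrow> card (set xs \<inter> set ys) \<le> 1"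
    and k: "k \<ge> 2"
    and big: "real (card I) / 2 ^ k > real (card (\<Union>(set ` I))) / 8"
  shows "makers_win (row_matrix k a) (single_vec b) X"
proof -
  have card: "card (set xs) = k" if "xs \<in> I" for xs
    using IX[OF that] by (auto simp: solutions_def distinct_card)
  have inj: "inj_on set I"
  proof (rule inj_onI, rule ccontr)
    fix xs ys assume xy: "xs \<in> I" "ys \<in> I" "set xs = set ys" "xs \<noteq> ys"
    then have "card (set xs) \<le> 1" using linear by force
    then show False using card[OF xy(1)] k by simp
  qed
  have "\<exists>\<sigma>. is_strategy X \<sigma> \<and>
    (\<forall>xs. is_play X xs \<and> follows_as_maker \<sigma> xs \<longrightarrow> (\<exists>e\<in>set ` I. e \<subseteq> maker_set xs))"
  proof (rule maker_claims_edge[OF finX])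
    show "real (card (\<Union>(set ` I))) / 8 < real (card (set ` I)) / 2 ^ k"
      using big inj by (simp add: card_image)
    show "e \<subseteq> X \<and> card e = k" if "e \<in> set ` I" for e using that IX card by auto
    show "card (e \<inter> f) \<le> 1" if "e \<in> set ` I" "f \<in> set ` I" "e \<noteq> f" for e f
      using that linear by auto
  qed
  then obtain \<sigma> where "is_strategy X \<sigma>"
    and \<sigma>: "\<And>xs. is_play X xs \<Longrightarrow> follows_as_maker \<sigma> xs \<Longrightarrow> \<exists>ys\<in>I. set ys \<subseteq> maker_set xs"
    by auto
  moreover have "\<exists>ys\<in>solutions k a b. set ys \<subseteq> maker_set xs"
    if "is_play X xs" "follows_as_maker \<sigma> xs" for xs using \<sigma>[OF that] IX by blast
  ultimately show ?thesis
    unfolding makers_win_def won_by_maker_iff using finX by blast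
qed

lemma breakers_win_from_invariant:
  fixes Inv :: "int set \<Rightarrow> int set \<Rightarrow> bool"
  assumes finX: "finite X" and init: "Inv {} {}"
    and mono: "\<And>M B B'. Inv M B \<Longrightarrow> B \<subseteq> B' \<Longrightarrow> B' \<inter> M = {} \<Longrightarrow> B' \<subseteq> X \<Longrightarrow> Inv M B'"
    and reply: "\<And>M B m. Inv M B \<Longrightarrow> M \<inter> B = {} \<Longrightarrow> M \<union> B \<subseteq> X \<Longrightarrow> m \<in> X - M - B \<Longrightarrow>
        Inv (insert m M) B \<or> (\<exists>b\<in>X - insert m M. Inv (insert m M) (insert b B))"
    and safe: "\<And>M B xs. Inv M B \<Longrightarrow> M \<inter> B = {} \<Longrightarrow> M \<union> B = X \<Longrightarrow> xs \<in> solutions k a b \<Longrightarrow>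
        set xs \<subseteq> M \<Longrightarrow> False"
  shows "breakers_win (row_matrix k a) (single_vec b) X"
proof -
  have "\<exists>\<sigma>. is_strategy X \<sigma> \<and>
    (\<forall>xs. is_play X xs \<and> follows_as_breaker \<sigma> xs \<longrightarrow> Inv (maker_set xs) (breaker_set xs))"
  proof (rule breaker_strategy_from_invariant)
    show "Inv {} {}" by (rule init)
    show "Inv M B'" if "Inv M B" "B \<subseteq> B'" "B' \<inter> M = {}" "B' \<subseteq> X" for M B B'
      using that by (rule mono)
    show "Inv (insert m M) B \<or> (\<exists>b\<in>X - insert m M. Inv (insert m M) (insert b B))"
      if "Inv M B" "M \<inter> B = {}" "M \<union> B \<subseteq> X" "m \<in> X - M - B" for M B m
      using that by (rule reply)
  qed
  then obtain \<sigma> where \<sigma>: "is_strategy X \<sigma>"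
    "\<And>xs. is_play X xs \<Longrightarrow> follows_as_breaker \<sigma> xs \<Longrightarrow> Inv (maker_set xs) (breaker_set xs)"
    by blast
  have "\<not> won_by_maker (row_matrix k a) (single_vec b) xs"
    if "is_play X xs" "follows_as_breaker \<sigma> xs" for xs
  proof
    assume "won_by_maker (row_matrix k a) (single_vec b) xs"
    then obtain ys where "ys \<in> solutions k a b" "set ys \<subseteq> maker_set xs"
      by (auto simp: won_by_maker_iff)
    then show False
      using safe[OF \<sigma>(2)[OF that]] that(1) maker_set_Un_breaker_set[of xs]
        maker_set_Int_breaker_set[of xs] by (auto simp: is_play_def)
  qed
  then show ?thesis unfolding breakers_win_def using finX \<sigma>(1) by blast
qed

lemma breakers_win_if_no_solution:
  assumes "finite X" "\<And>xs. xs \<in> solutions k a b \<Longrightarrow> \<not> set xs \<subseteq> X"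
  shows "breakers_win (row_matrix k a) (single_vec b) X"
  using assms(1)
proof (rule breakers_win_from_invariant[where Inv = "\<lambda>_ _. True"])
  fix M B :: "int set" and xs
  assume "M \<union> B = X" "xs \<in> solutions k a b" "set xs \<subseteq> M"
  then show False using assms(2)[of xs] by blast
qed auto

section \<open>The random set\<close>

lemma finite_interval [simp]: "finite (interval n)" and card_interval [simp]: "card (interval n) = n"
  by (auto simp: interval_def)

lemma set_pmf_random_interval: "X \<in> set_pmf (random_interval n p) \<Longrightarrow> X \<subseteq> interval n"
  by (auto simp: random_interval_def)

lemma finite_set_pmf_random_interval [simp]: "finite (set_pmf (random_interval n p))"
  by (rule finite_subset[of _ "Pow (interval n)"]) (auto dest: set_pmf_random_interval)

lemma prob_random_interval_mono:
  assumes "\<And>X. X \<subseteq> interval n \<Longrightarrow> P X \<Longrightarrow> Q X"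
  shows "measure_pmf.prob (random_interval n p) {X. P X} \<le> measure_pmf.prob (random_interval n p) {X. Q X}"
proof -
  let ?S = "set_pmf (random_interval n p)"
  have "measure_pmf.prob (random_interval n p) {X. P X} =
      measure_pmf.prob (random_interval n p) ({X. P X} \<inter> ?S)"
    by (simp add: measure_Int_set_pmf)
  also have "\<dots> \<le> measure_pmf.prob (random_interval n p) {X. Q X}"
    by (rule measure_pmf.finite_measure_mono) (auto intro: assms dest: set_pmf_random_interval)
  finally show ?thesis .
qed

lemma prob_random_interval_disj:
  "measure_pmf.prob (random_interval n p) {X. P X \<or> Q X} \<le>
     measure_pmf.prob (random_interval n p) {X. P X} + measure_pmf.prob (random_interval n p) {X. Q X}"
proof -
  have "{X. P X \<or> Q X} = {X. P X} \<union> {X. Q X}" by auto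
  then show ?thesis by (simp add: measure_Un_le)
qed

lemma whpI:
  assumes "\<forall>\<^sub>F n in sequentially.
      measure_pmf.prob (random_interval n (p n)) {X. \<not> Q X} \<le> g n"
    and "g \<longlonglongrightarrow> 0"
  shows "whp p Q"
proof -
  have compl: "measure_pmf.prob (random_interval n (p n)) {X. Q X} =
      1 - measure_pmf.prob (random_interval n (p n)) {X. \<not> Q X}" for n
    using measure_pmf.prob_compl[of "{X. \<not> Q X}" "random_interval n (p n)"]
    by (simp add: Compl_eq_Diff_UNIV[symmetric] Collect_neg_eq[symmetric])
  have "(\<lambda>n. measure_pmf.prob (random_interval n (p n)) {X. \<not> Q X}) \<longlonglongrightarrow> 0"
    by (rule tendsto_sandwich[OF _ assms(1) tendsto_const assms(2)]) auto
  then have "(\<lambda>n. 1 - measure_pmf.prob (random_interval n (p n)) {X. \<not> Q X}) \<longlonglongrightarrow> 1 - 0"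
    by (intro tendsto_intros)
  then show ?thesis unfolding whp_def compl by simp
qed

lemma prob_subset_random_interval:
  assumes "S \<subseteq> interval n" "0 \<le> p" "p \<le> 1"
  shows "measure_pmf.prob (random_interval n p) {X. S \<subseteq> X} = p ^ card S"
proof -
  have "(\<lambda>f. {x \<in> interval n. f x}) -` {X. S \<subseteq> X} =
      Pi (interval n) (\<lambda>x. if x \<in> S then {True} else UNIV)"
    using assms(1) by (auto simp: Pi_def)
  then have "measure_pmf.prob (random_interval n p) {X. S \<subseteq> X} =
      (\<Prod>x\<in>interval n. measure_pmf.prob (bernoulli_pmf p) (if x \<in> S then {True} else UNIV))"
    unfolding random_interval_def by (simp add: measure_Pi_pmf_Pi)
  also have "\<dots> = (\<Prod>x\<in>interval n. if x \<in> S then p else 1)"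
    using assms(2,3) by (intro prod.cong) (auto simp: measure_pmf_single)
  also have "\<dots> = (\<Prod>x\<in>S. p)"
    using assms(1) by (intro prod.mono_neutral_cong_right) auto
  finally show ?thesis by simp
qed

lemma prob_ex_subset_random_interval:
  assumes "finite I" "\<And>s. s \<in> I \<Longrightarrow> f s \<subseteq> interval n" "0 \<le> p" "p \<le> 1"
  shows "measure_pmf.prob (random_interval n p) {X. \<exists>s\<in>I. f s \<subseteq> X} \<le> (\<Sum>s\<in>I. p ^ card (f s))"
proof -
  have "{X. \<exists>s\<in>I. f s \<subseteq> X} = (\<Union>s\<in>I. {X. f s \<subseteq> X})" by auto
  then have "measure_pmf.prob (random_interval n p) {X. \<exists>s\<in>I. f s \<subseteq> X} \<le>
      (\<Sum>s\<in>I. measure_pmf.prob (random_interval n p) {X. f s \<subseteq> X})"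
    using assms(1) by (auto intro!: measure_UNION_le)
  also have "\<dots> = (\<Sum>s\<in>I. p ^ card (f s))"
    using assms by (intro sum.cong) (auto simp: prob_subset_random_interval)
  finally show ?thesis .
qed

lemma expectation_count_subsets:
  assumes "finite I" "\<And>s. s \<in> I \<Longrightarrow> f s \<subseteq> interval n" "0 \<le> p" "p \<le> 1"
  shows "measure_pmf.expectation (random_interval n p) (\<lambda>X. real (card {s \<in> I. f s \<subseteq> X})) =
    (\<Sum>s\<in>I. p ^ card (f s))"
proof -
  have "real (card {s \<in> I. f s \<subseteq> X}) = (\<Sum>s\<in>I. indicator {X. f s \<subseteq> X} X)" for X
    using assms(1) by (simp add: indicator_def sum.If_cases Int_def)
  then have "measure_pmf.expectation (random_interval n p) (\<lambda>X. real (card {s \<in> I. f s \<subseteq> X})) =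
      (\<Sum>s\<in>I. measure_pmf.expectation (random_interval n p) (indicator {X. f s \<subseteq> X}))"
    by (simp add: Bochner_Integration.integral_sum integrable_measure_pmf_finite)
  also have "\<dots> = (\<Sum>s\<in>I. p ^ card (f s))"
    using assms by (intro sum.cong) (auto simp: prob_subset_random_interval)
  finally show ?thesis .
qed

text \<open>Chebyshev's inequality. Pairs with disjoint sets are independent and cancel in the
  variance; for the remaining ones, the diagonal among them when the sets are non-empty, the
  subtracted product is dropped and \<open>D\<close> bounds the joint probabilities.\<close>

lemma prob_count_deviation:
  assumes "finite I" "\<And>s. s \<in> I \<Longrightarrow> f s \<subseteq> interval n" "0 \<le> p" "p \<le> 1"
    and \<mu>: "\<mu> = (\<Sum>s\<in>I. p ^ card (f s))" "\<mu> > 0"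
    and D: "(\<Sum>st\<in>{st \<in> I \<times> I. f (fst st) \<inter> f (snd st) \<noteq> {}}. p ^ card (f (fst st) \<union> f (snd st))) \<le> D"
  shows "measure_pmf.prob (random_interval n p)
      {X. \<bar>real (card {s \<in> I. f s \<subseteq> X}) - \<mu>\<bar> \<ge> \<mu> / 2} \<le> 4 * D / \<mu>\<^sup>2"
proof -
  let ?M = "random_interval n p"
  define N where "N = (\<lambda>X. real (card {s \<in> I. f s \<subseteq> X}))"
  have int: "integrable ?M h" for h :: "int set \<Rightarrow> real"
    by (rule integrable_measure_pmf_finite) simp
  have EN: "measure_pmf.expectation ?M N = \<mu>"
    using expectation_count_subsets[of I f n p, OF assms(1-4)] \<mu>(1) unfolding N_def by simp
  have fin: "finite (f s)" if "s \<in> I" for s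
    using assms(2)[OF that] by (rule finite_subset) simp
  have "N X ^ 2 = real (card {st \<in> I \<times> I. f (fst st) \<union> f (snd st) \<subseteq> X})" for X
  proof -
    have "{st \<in> I \<times> I. f (fst st) \<union> f (snd st) \<subseteq> X} = {s \<in> I. f s \<subseteq> X} \<times> {s \<in> I. f s \<subseteq> X}"
      by auto
    then show ?thesis by (simp add: N_def card_cartesian_product power2_eq_square)
  qed
  then have "measure_pmf.expectation ?M (\<lambda>X. N X ^ 2) =
      measure_pmf.expectation ?M (\<lambda>X. real (card {st \<in> I \<times> I. f (fst st) \<union> f (snd st) \<subseteq> X}))"
    by simp
  also have "\<dots> = (\<Sum>st\<in>I \<times> I. p ^ card (f (fst st) \<union> f (snd st)))"
  proof (rule expectation_count_subsets)
    show "f (fst st) \<union> f (snd st) \<subseteq> interval n" if "st \<in> I \<times> I" for st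
      using that assms(2)[of "fst st"] assms(2)[of "snd st"] by (simp add: mem_Times_iff)
  qed (use assms(1,3,4) in auto)
  also have "\<dots> - \<mu>\<^sup>2 = (\<Sum>st\<in>I \<times> I. p ^ card (f (fst st) \<union> f (snd st)) - p ^ card (f (fst st)) * p ^ card (f (snd st)))"
    unfolding \<mu>(1) power2_eq_square sum_product sum.cartesian_product sum_subtractf
    by (simp add: case_prod_beta)
  also have "\<dots> \<le> (\<Sum>st\<in>I \<times> I. if f (fst st) \<inter> f (snd st) \<noteq> {} then p ^ card (f (fst st) \<union> f (snd st)) else 0)"
    using assms(3) fin by (intro sum_mono) (auto simp: card_Un_disjoint power_add)
  also have "\<dots> = (\<Sum>st\<in>{st \<in> I \<times> I. f (fst st) \<inter> f (snd st) \<noteq> {}}. p ^ card (f (fst st) \<union> f (snd st)))"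
    using assms(1) by (intro sum.inter_filter[symmetric]) auto
  also have "\<dots> \<le> D"
    by (rule D)
  finally have var: "measure_pmf.expectation ?M (\<lambda>X. N X ^ 2) - \<mu>\<^sup>2 \<le> D" .
  have "measure_pmf.prob ?M {X \<in> space (measure_pmf ?M). \<bar>N X - measure_pmf.expectation ?M N\<bar> \<ge> \<mu> / 2} \<le>
      measure_pmf.variance ?M N / (\<mu> / 2)\<^sup>2"
    by (rule measure_pmf.Chebyshev_inequality) (use \<mu>(2) int in auto)
  also have "measure_pmf.variance ?M N = measure_pmf.expectation ?M (\<lambda>X. N X ^ 2) - \<mu>\<^sup>2"
    by (subst measure_pmf.variance_eq) (simp_all only: int EN)
  also have "(measure_pmf.expectation ?M (\<lambda>X. N X ^ 2) - \<mu>\<^sup>2) / (\<mu> / 2)\<^sup>2 \<le> D / (\<mu> / 2)\<^sup>2"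
    using var by (intro divide_right_mono) auto
  also have "\<dots> = 4 * D / \<mu>\<^sup>2" by (simp add: power2_eq_square)
  finally show ?thesis unfolding EN by (simp add: N_def)
qed

text \<open>Thinning: both sets are built from one sample in which each element carries two
  independent coins with success probabilities \<open>p\<close> and \<open>r = q / p\<close>. The
  sparser set needs both coins and is thus contained in the denser one.\<close>

lemma prob_random_interval_le:
  assumes "0 \<le> q" "q \<le> p" "p \<le> 1"
    and up: "\<And>X Y. X \<subseteq> Y \<Longrightarrow> Y \<subseteq> interval n \<Longrightarrow> Q X \<Longrightarrow> Q Y"
  shows "measure_pmf.prob (random_interval n q) {X. Q X} \<le> measure_pmf.prob (random_interval n p) {X. Q X}"
proof -
  define r where "r = (if p = 0 then 0 else q / p)"
  have r: "0 \<le> r" "r \<le> 1" "p * r = q" using assms by (auto simp: r_def divide_le_eq_1)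
  define W where "W = pair_pmf (bernoulli_pmf p) (bernoulli_pmf r)"
  define H where "H = Pi_pmf (interval n) (False, False) (\<lambda>_. W)"
  have q: "bernoulli_pmf q = map_pmf (\<lambda>h. fst h \<and> snd h) W"
  proof (rule pmf_eqI)
    fix i
    have vim: "(\<lambda>h. fst h \<and> snd h) -` {True} = {(True, True)}"
      by (rule Set.set_eqI) (simp add: prod_eq_iff)
    have "pmf (map_pmf (\<lambda>h. fst h \<and> snd h) W) True = p * r"
      using assms r unfolding pmf_map vim W_def by (simp add: measure_pmf_single pmf_pair)
    moreover have "pmf (bernoulli_pmf q) True = q" using assms by simp
    ultimately show "pmf (bernoulli_pmf q) i = pmf (map_pmf (\<lambda>h. fst h \<and> snd h) W) i"
      using r by (cases i) (simp_all only: pmf_False_conv_True)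
  qed
  have p: "bernoulli_pmf p = map_pmf fst W" by (simp add: W_def map_fst_pair_pmf)
  have Q: "random_interval n q = map_pmf (\<lambda>h. {x \<in> interval n. fst (h x) \<and> snd (h x)}) H"
    unfolding random_interval_def q H_def
    by (subst Pi_pmf_map[where dflt = "(False, False)"]) (auto simp: map_pmf_comp)
  have P: "random_interval n p = map_pmf (\<lambda>h. {x \<in> interval n. fst (h x)}) H"
    unfolding random_interval_def p H_def
    by (subst Pi_pmf_map[where dflt = "(False, False)"]) (auto simp: map_pmf_comp)
  show ?thesis unfolding P Q measure_map_pmf
  proof (rule measure_pmf.finite_measure_mono, rule subsetI)
    fix h assume "h \<in> (\<lambda>h. {x \<in> interval n. fst (h x) \<and> snd (h x)}) -` {X. Q X}"
    then have "Q {x \<in> interval n. fst (h x) \<and> snd (h x)}" by simp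
    then have "Q {x \<in> interval n. fst (h x)}" by (rule up[rotated 2]) auto
    then show "h \<in> (\<lambda>h. {x \<in> interval n. fst (h x)}) -` {X. Q X}" by simp
  qed simp
qed

section \<open>Exploration and replies of Breaker\<close>

definition edge_closed :: "'a list set \<Rightarrow> 'a set \<Rightarrow> bool" where
  "edge_closed S R \<longleftrightarrow> (\<forall>xs\<in>S. set xs \<inter> R \<noteq> {} \<longrightarrow> set xs \<subseteq> R)"

definition pairing :: "'a set set \<Rightarrow> bool" where
  "pairing \<P> \<longleftrightarrow> (\<forall>P\<in>\<P>. \<exists>y z. y \<noteq> z \<and> P = {y, z}) \<and> disjoint \<P>"

lemma pairing_partner:
  assumes "pairing \<P>" "P \<in> \<P>" "m \<in> P"
  obtains z where "P = {m, z}" "z \<noteq> m"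
proof -
  obtain x y where "x \<noteq> y" "P = {x, y}" using assms(1,2) unfolding pairing_def by meson
  then show thesis using that assms(3) by (cases "m = x") (auto simp: insert_commute)
qed

lemma pairing_disjointD: "pairing \<P> \<Longrightarrow> p \<in> \<P> \<Longrightarrow> q \<in> \<P> \<Longrightarrow> p \<noteq> q \<Longrightarrow> p \<inter> q = {}"
  by (simp add: pairing_def disjoint_def)

lemma pairing_subset: "pairing \<P> \<Longrightarrow> \<Q> \<subseteq> \<P> \<Longrightarrow> pairing \<Q>"
  unfolding pairing_def disjoint_def by (meson subsetD)

lemma pairing_Un:
  assumes "pairing \<P>" "pairing \<Q>" "\<And>p q. p \<in> \<P> \<Longrightarrow> q \<in> \<Q> \<Longrightarrow> p \<inter> q = {}"
  shows "pairing (\<P> \<union> \<Q>)"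
  unfolding pairing_def
proof (intro conjI)
  show "\<forall>P\<in>\<P> \<union> \<Q>. \<exists>y z. y \<noteq> z \<and> P = {y, z}"
    using assms(1,2) unfolding pairing_def by blast
  have "p \<inter> q = {}" if "p \<in> \<P> \<union> \<Q>" "q \<in> \<P> \<union> \<Q>" "p \<noteq> q" for p q
    using that assms unfolding pairing_def disjoint_def by (metis Un_iff Int_commute)
  then show "disjoint (\<P> \<union> \<Q>)" unfolding disjoint_def by simp
qed

text \<open>\<open>C\<close> is the component of Maker's move \<open>m\<close>: after the reply \<open>D\<close> (at most one vertex), the
  pairs in \<open>\<P>\<close> block every edge of \<open>C\<close>.\<close>

definition reply_certificate :: "'a list set \<Rightarrow> 'a \<Rightarrow> 'a set \<Rightarrow> 'a set \<Rightarrow> 'a set set \<Rightarrow> bool" where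
  "reply_certificate S m C D \<P> \<longleftrightarrow>
     m \<in> C \<and> edge_closed S C \<and> (\<forall>R. edge_closed S R \<and> m \<in> R \<longrightarrow> C \<subseteq> R) \<and>
     (D = {} \<or> (\<exists>y\<in>C - {m}. D = {y})) \<and>
     pairing \<P> \<and> \<Union>\<P> \<subseteq> C - {m} \<and>
     (\<forall>xs\<in>S. set xs \<subseteq> C \<longrightarrow> set xs \<inter> D \<noteq> {} \<or> (\<exists>P\<in>\<P>. P \<subseteq> set xs))"

text \<open>Certificates are local to a component and combine because components are disjoint.
  Maker's first move in a fresh component is answered by the vertex in \<open>D\<close>, if any, and
  activates the pairs of that component; a move in an active pair is answered by the partner; other
  moves need no answer.\<close>

lemma breakers_win_if_certified:
  assumes finX: "finite X" and k: "k \<ge> 1"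
    and S: "S = {xs \<in> solutions k a b. set xs \<subseteq> X}"
    and cert: "\<And>m. m \<in> X \<Longrightarrow> \<exists>C D \<P>. reply_certificate S m C D \<P>"
  shows "breakers_win (row_matrix k a) (single_vec b) X"
proof -
  \<comment> \<open>\<open>R\<close> is the part that Maker has not entered, a union of components,
    and \<open>\<P>\<close> holds the active pairs still free of Maker. Breaker may already own
    elements of both.\<close>
  define J where "J R \<P> M B \<longleftrightarrow> R \<subseteq> X - M \<and> edge_closed S R \<and> pairing \<P> \<and>
      \<Union>\<P> \<subseteq> X - M - R \<and>
      (\<forall>xs\<in>S. set xs \<inter> B \<noteq> {} \<or> set xs \<subseteq> R \<or> (\<exists>P\<in>\<P>. P \<subseteq> set xs))" for R \<P> M B
  define Inv where "Inv M B \<longleftrightarrow> (\<exists>R \<P>. J R \<P> M B)" for M B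
  have ne: "set xs \<noteq> {}" if "xs \<in> S" for xs
    using that k unfolding S by (auto simp: solutions_def)
  show ?thesis
    using finX
  proof (rule breakers_win_from_invariant[where Inv = Inv])
    have "J X {} {} {}" by (auto simp: J_def edge_closed_def pairing_def S)
    then show "Inv {} {}" unfolding Inv_def by blast
  next
    fix M B B' :: "int set" assume "Inv M B" and B': "B \<subseteq> B'"
    then obtain R \<P> where J: "J R \<P> M B" unfolding Inv_def by blast
    have "set xs \<inter> B' \<noteq> {}" if "set xs \<inter> B \<noteq> {}" for xs using that B' by blast
    then have "J R \<P> M B'" using J unfolding J_def by blast
    then show "Inv M B'" unfolding Inv_def by blast
  next
    fix M B m assume inv: "Inv M B" and MB: "M \<inter> B = {}" "M \<union> B \<subseteq> X" and m: "m \<in> X - M - B"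
    obtain R \<P> where R: "R \<subseteq> X - M" "edge_closed S R" and P: "pairing \<P>" "\<Union>\<P> \<subseteq> X - M - R"
      and cov: "\<And>xs. xs \<in> S \<Longrightarrow> set xs \<inter> B \<noteq> {} \<or> set xs \<subseteq> R \<or> (\<exists>P\<in>\<P>. P \<subseteq> set xs)"
    proof -
      obtain R \<P> where J: "J R \<P> M B" using inv unfolding Inv_def by blast
      show thesis by (rule that[of R \<P>]) (use J in \<open>simp_all add: J_def\<close>)
    qed
    consider (new) "m \<in> R" | (pair) P0 where "m \<notin> R" "P0 \<in> \<P>" "m \<in> P0" | (free) "m \<notin> R" "m \<notin> \<Union>\<P>"
      by blast
    then show "Inv (insert m M) B \<or> (\<exists>b\<in>X - insert m M. Inv (insert m M) (insert b B))"
    proof cases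
      case new
      obtain C D \<Q> where "reply_certificate S m C D \<Q>" using cert m by blast
      then have C: "m \<in> C" "edge_closed S C" "C \<subseteq> R" and D: "D = {} \<or> (\<exists>y\<in>C - {m}. D = {y})"
        and Q: "pairing \<Q>" "\<Union>\<Q> \<subseteq> C - {m}"
        and covC: "\<And>xs. xs \<in> S \<Longrightarrow> set xs \<subseteq> C \<Longrightarrow> set xs \<inter> D \<noteq> {} \<or> (\<exists>P\<in>\<Q>. P \<subseteq> set xs)"
        using new R(2) unfolding reply_certificate_def by blast+
      have "J (R - C) (\<P> \<union> \<Q>) (insert m M) (D \<union> B)"
        unfolding J_def
      proof (intro conjI ballI)
        show "R - C \<subseteq> X - insert m M" using R C by auto
        show "edge_closed S (R - C)" using R(2) C(2) unfolding edge_closed_def by blast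
        have "p \<inter> q = {}" if "p \<in> \<P>" "q \<in> \<Q>" for p q
          using that P(2) Q(2) C(3) by blast
        then show "pairing (\<P> \<union> \<Q>)" using P(1) Q(1) by (intro pairing_Un)
        show "\<Union>(\<P> \<union> \<Q>) \<subseteq> X - insert m M - (R - C)"
          using P(2) Q(2) C(1,3) R(1) by blast
      next
        fix xs assume xs: "xs \<in> S"
        show "set xs \<inter> (D \<union> B) \<noteq> {} \<or> set xs \<subseteq> R - C \<or> (\<exists>P\<in>\<P> \<union> \<Q>. P \<subseteq> set xs)"
        proof (cases "set xs \<inter> C = {}")
          case True
          then show ?thesis using cov[OF xs] by blast
        next
          case False
          then have "set xs \<subseteq> C" using C(2) xs unfolding edge_closed_def by blast
          then show ?thesis using covC[OF xs] by blast
        qed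
      qed
      then have inv': "Inv (insert m M) (D \<union> B)" unfolding Inv_def by blast
      show ?thesis
      proof (cases "D = {}")
        case True
        then show ?thesis using inv' by simp
      next
        case False
        then obtain y where y: "y \<in> C - {m}" "D = {y}" using D by blast
        then have "y \<in> X - insert m M" using C R by auto
        moreover have "Inv (insert m M) (insert y B)" using inv' y by simp
        ultimately show ?thesis by blast
      qed
    next
      case pair
      obtain z where z: "P0 = {m, z}" "z \<noteq> m"
        using pairing_partner[OF P(1) pair(2,3)] by blast
      have other: "m \<notin> p" if "p \<in> \<P>" "p \<noteq> P0" for p
        using pairing_disjointD[OF P(1) that(1) pair(2) that(2)] pair(3) by blast
      have "J R (\<P> - {P0}) (insert m M) (insert z B)"
        unfolding J_def
      proof (intro conjI ballI)
        show "R \<subseteq> X - insert m M" using R pair by auto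
        show "pairing (\<P> - {P0})" using P(1) by (rule pairing_subset) auto
        show "\<Union>(\<P> - {P0}) \<subseteq> X - insert m M - R" using P(2) other by blast
        fix xs assume xs: "xs \<in> S"
        show "set xs \<inter> insert z B \<noteq> {} \<or> set xs \<subseteq> R \<or> (\<exists>P\<in>\<P> - {P0}. P \<subseteq> set xs)"
          using cov[OF xs] z by blast
      qed (rule R)
      then have "Inv (insert m M) (insert z B)" unfolding Inv_def by blast
      moreover have "z \<in> X - insert m M" using P(2) pair(2) z by blast
      ultimately show ?thesis by blast
    next
      case free
      have "J R \<P> (insert m M) B"
        unfolding J_def
      proof (intro conjI ballI)
        show "R \<subseteq> X - insert m M" using R free by auto
        show "\<Union>\<P> \<subseteq> X - insert m M - R" using P(2) free by auto
      qed (use R P cov in auto)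
      then show ?thesis unfolding Inv_def by blast
    qed
  next
    fix M B xs assume inv: "Inv M B" "M \<inter> B = {}" "M \<union> B = X" and xs: "xs \<in> solutions k a b" "set xs \<subseteq> M"
    then have xsS: "xs \<in> S" unfolding S by blast
    obtain R \<P> where J: "J R \<P> M B" using inv(1) unfolding Inv_def by blast
    then have R: "R \<inter> M = {}" and P: "pairing \<P>" "\<Union>\<P> \<inter> M = {}"
      and cov: "set xs \<inter> B \<noteq> {} \<or> set xs \<subseteq> R \<or> (\<exists>P\<in>\<P>. P \<subseteq> set xs)"
      using xsS unfolding J_def by auto
    have "P \<noteq> {}" if "P \<in> \<P>" for P using that P(1) unfolding pairing_def by auto
    then have "\<not> P \<subseteq> M" if "P \<in> \<P>" for P using that P(2) by (metis Int_greatest Sup_upper subset_empty)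
    then have "\<not> (\<exists>P\<in>\<P>. P \<subseteq> set xs)" using xs(2) by (meson order_trans)
    moreover have "\<not> set xs \<subseteq> R" using ne[OF xsS] R xs(2) by (metis Int_greatest subset_empty)
    moreover have "set xs \<inter> B = {}" using inv(2) xs(2) by auto
    ultimately show False using cov by simp
  qed
qed

section \<open>Explorations of a component, encoded by words\<close>

datatype move = Advance | Branch | Close nat

text \<open>Words of moves describe an exploration of the hypergraph (last move first). The list
  contains the vertices found so far, and the number of letters \<open>Advance\<close> is the position of the
  vertex under inspection. A branch adds an edge that meets the list only in that vertex, and
  \<open>Close j\<close> adds an edge that meets the list in \<open>j\<close> vertices.\<close>

fun explored :: "nat \<Rightarrow> 'a set \<Rightarrow> 'a list set \<Rightarrow> move list \<Rightarrow> 'a list set" where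
  "explored k V S [] = (\<lambda>x. [x]) ` V"
| "explored k V S (Advance # w) = {us \<in> explored k V S w. count_list w Advance < length us}"
| "explored k V S (Branch # w) = {us @ filter (\<lambda>y. y \<notin> set us) xs | us xs.
     us \<in> explored k V S w \<and> xs \<in> S \<and> count_list w Advance < length us \<and>
     set xs \<inter> set us = {us ! count_list w Advance}}"
| "explored k V S (Close j # w) = {us @ filter (\<lambda>y. y \<notin> set us) xs | us xs.
     us \<in> explored k V S w \<and> xs \<in> S \<and> card (set xs \<inter> set us) = j \<and> 2 \<le> j \<and> j < k}"

fun excess :: "move list \<Rightarrow> nat" where
  "excess [] = 0"
| "excess (Close j # w) = excess w + (j - 1)"
| "excess (_ # w) = excess w"

text \<open>Kept apart from \<open>excess\<close> because each closing edge costs a factor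
  polynomial in the size explored so far, which is affordable only for boundedly many of
  them.\<close>

fun closures :: "move list \<Rightarrow> nat" where
  "closures [] = 0"
| "closures (Close j # w) = Suc (closures w)"
| "closures (_ # w) = closures w"

lemma explored_mono:
  assumes "V \<subseteq> V'" "S \<subseteq> S'"
  shows "explored k V S w \<subseteq> explored k V' S' w"
proof (induction w)
  case (Cons l w)
  then show ?case using assms by (cases l) fastforce+
qed (use assms in auto)

lemma length_filter_notin:
  assumes "distinct xs"
  shows "length (filter (\<lambda>y. y \<notin> U) xs) = length xs - card (set xs \<inter> U)"
proof -
  have "length (filter (\<lambda>y. y \<notin> U) xs) = card (set xs - U)"
    using distinct_card[of "filter (\<lambda>y. y \<notin> U) xs"] assms by (simp add: set_diff_eq)
  also have "\<dots> = card (set xs) - card (set xs \<inter> U)" by (simp add: card_Diff_subset_Int)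
  finally show ?thesis using assms by (simp add: distinct_card)
qed

text \<open>A branch adds exactly \<open>k - 1\<close> vertices, a closing edge fewer than
  \<open>k\<close>, and an advance needs a vertex to inspect. Hence branches and closures bound both
  the vertex list and the number of advances, and so the length of the word.\<close>

lemma explored_props:
  assumes S: "\<And>xs. xs \<in> S \<Longrightarrow> length xs = k \<and> distinct xs \<and> set xs \<subseteq> V"
    and "us \<in> explored k V S w"
  shows "distinct us \<and> set us \<subseteq> V \<and> us \<noteq> [] \<and> count_list w Advance \<le> length us \<and>
    length us \<le> 1 + (k - 1) * count_list w Branch + k * closures w"
  using assms(2)
proof (induction w arbitrary: us)
  case (Cons l w)
  show ?case
  proof (cases l)
    case Advance
    then show ?thesis using Cons by auto
  next
    case Branch
    then obtain vs xs where v: "us = vs @ filter (\<lambda>y. y \<notin> set vs) xs" "vs \<in> explored k V S w" "xs \<in> S"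
      "count_list w Advance < length vs" "set xs \<inter> set vs = {vs ! count_list w Advance}"
      using Cons.prems by auto
    have "length (filter (\<lambda>y. y \<notin> set vs) xs) = k - 1"
      using length_filter_notin[of xs "set vs"] S[OF v(3)] v(5) by simp
    then show ?thesis using Cons.IH[OF v(2)] S[OF v(3)] Branch v(1) by auto
  next
    case (Close j)
    then obtain vs xs where v: "us = vs @ filter (\<lambda>y. y \<notin> set vs) xs" "vs \<in> explored k V S w" "xs \<in> S"
      using Cons.prems by auto
    have "length (filter (\<lambda>y. y \<notin> set vs) xs) \<le> k" using S[OF v(3)] by auto
    then show ?thesis using Cons.IH[OF v(2)] S[OF v(3)] Close v(1) by auto
  qed
qed auto

text \<open>A state consists of a word, its vertex list, pairs and Breaker's reply, and has every
  property of a certificate except closedness. A state of maximal size is taken: were it not closed,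
  a closing edge, a branch or an advance would enlarge it. Closing edges are ruled out first, and
  this realises the rule of preference.\<close>

lemma reply_certificate_exists:
  assumes finX: "finite X" and k: "k \<ge> 3"
    and S: "\<And>xs. xs \<in> S \<Longrightarrow> length xs = k \<and> distinct xs \<and> set xs \<subseteq> X"
    and nobad: "\<And>w us. us \<in> explored k X S w \<Longrightarrow> excess w \<ge> 2 \<Longrightarrow> closures w \<le> 2 \<Longrightarrow> False"
    and m: "m \<in> X"
  shows "\<exists>C D \<P>. reply_certificate S m C D \<P>"
proof -
  \<comment> \<open>Vertices before the inspected one have all their edges inside \<open>us\<close>,
    and \<open>D\<close> is reserved for the single closing edge that may occur.\<close>
  define good where "good = (\<lambda>(w, us, \<P>, D).
     us \<in> explored k X S w \<and> us ! 0 = m \<and> closures w \<le> 1 \<and>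
     (closures w = 0 \<longrightarrow> D = {} \<and> excess w = 0) \<and>
     (D = {} \<or> (\<exists>y\<in>set us - {m}. D = {y})) \<and>
     (\<forall>i<count_list w Advance. \<forall>xs\<in>S. us ! i \<in> set xs \<longrightarrow> set xs \<subseteq> set us) \<and>
     pairing \<P> \<and> \<Union>\<P> \<subseteq> set us - {m} \<and>
     (\<forall>xs\<in>S. set xs \<subseteq> set us \<longrightarrow> set xs \<inter> D \<noteq> {} \<or> (\<exists>P\<in>\<P>. P \<subseteq> set xs)) \<and>
     (\<forall>R. edge_closed S R \<and> m \<in> R \<longrightarrow> set us \<subseteq> R))"
  define size where "size = (\<lambda>(w :: move list, us :: 'a list, \<P> :: 'a set set, D :: 'a set).
     length us + count_list w Advance)"
  have cardS: "card (set xs) = k" if "xs \<in> S" for xs using S[OF that] distinct_card by blast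
  have "good ([], [m], {}, {})"
    using m k cardS unfolding good_def
    by (auto simp: pairing_def dest: card_mono[rotated])
  moreover have "\<forall>t. good t \<longrightarrow> size t < 2 * card X + 1"
  proof (intro allI impI, clarify)
    fix w us \<P> D assume "good (w, us, \<P>, D)"
    then have "us \<in> explored k X S w" by (simp add: good_def)
    then have p: "distinct us" "set us \<subseteq> X" "count_list w Advance \<le> length us"
      using explored_props[of S k X us w] S by auto
    have "length us \<le> card X" using p finX by (metis card_mono distinct_card)
    then show "size (w, us, \<P>, D) < 2 * card X + 1" using p(3) by (simp add: size_def)
  qed
  ultimately obtain t where t: "good t" "\<And>t'. good t' \<Longrightarrow> size t' \<le> size t"
    using ex_has_greatest_nat[of good "([], [m], {}, {})" size "2 * card X + 1"] by blast
  obtain w us \<P> D where teq: "t = (w, us, \<P>, D)" by (cases t) auto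
  have us: "us \<in> explored k X S w" "us ! 0 = m" and cl: "closures w \<le> 1"
    and cl0': "closures w = 0 \<longrightarrow> D = {} \<and> excess w = 0"
    and D: "D = {} \<or> (\<exists>y\<in>set us - {m}. D = {y})"
    and sat': "\<forall>i<count_list w Advance. \<forall>xs\<in>S. us ! i \<in> set xs \<longrightarrow> set xs \<subseteq> set us"
    and P: "pairing \<P>" "\<Union>\<P> \<subseteq> set us - {m}"
    and cov': "\<forall>xs\<in>S. set xs \<subseteq> set us \<longrightarrow> set xs \<inter> D \<noteq> {} \<or> (\<exists>P\<in>\<P>. P \<subseteq> set xs)"
    and least': "\<forall>R. edge_closed S R \<and> m \<in> R \<longrightarrow> set us \<subseteq> R"
    using t(1) unfolding teq good_def prod.case by - (elim conjE, assumption)+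
  note cl0 = cl0'[rule_format] and sat = sat'[rule_format] and cov = cov'[rule_format]
    and least = least'[rule_format, OF conjI]
  have p: "distinct us" "set us \<subseteq> X" "us \<noteq> []" "count_list w Advance \<le> length us"
    using explored_props[of S k X us w] S us by auto
  have m_us: "m \<in> set us" using us(2) p(3) by (metis length_greater_0_conv nth_mem)
  define ext where "ext xs = filter (\<lambda>y. y \<notin> set us) xs" for xs
  have set_ext: "set (us @ ext xs) = set us \<union> set xs" for xs by (auto simp: ext_def)
  have card_ext: "card (set (ext xs)) = k - card (set xs \<inter> set us)" if "xs \<in> S" for xs
    using length_filter_notin[of xs "set us"] S[OF that] distinct_card[of "ext xs"]
    by (simp add: ext_def)
  have sat_ext: "set ys \<subseteq> set (us @ ext xs)"
    if "i < count_list w Advance" "ys \<in> S" "(us @ ext xs) ! i \<in> set ys" for i xs ys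
  proof -
    have "(us @ ext xs) ! i = us ! i" using that(1) p(4) by (simp add: nth_append)
    then show ?thesis using sat[OF that(1,2)] that(3) by auto
  qed
  have least_ext: "set (us @ ext xs) \<subseteq> R"
    if "xs \<in> S" "set xs \<inter> set us \<noteq> {}" "edge_closed S R" "m \<in> R" for xs R
    using that least[OF that(3,4)] unfolding set_ext edge_closed_def by blast
  have us0: "(us @ ext xs) ! 0 = m" for xs using us(2) p(3) by (simp add: nth_append)
  \<comment> \<open>Each closing edge has excess at least one, so \<open>nobad\<close>, applied to
    \<open>w\<close> with one more closing edge, leaves room only for a first one, and only with
    exactly two common vertices.\<close>
  have close2: "closures w = 0 \<and> card (set xs \<inter> set us) = 2"
    if xs: "xs \<in> S" "2 \<le> card (set xs \<inter> set us)" "card (set xs \<inter> set us) < k" for xs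
  proof -
    define j where "j = card (set xs \<inter> set us)"
    have "us @ ext xs \<in> explored k X S (Close j # w)"
      using xs us(1) unfolding ext_def j_def by auto
    from nobad[OF this] have "excess w + (j - 1) < 2" using cl by force
    moreover have "excess w \<ge> closures w"
    proof -
      have "excess w' \<ge> closures w'" if "us' \<in> explored k X S w'" for us' w'
        using that
      proof (induction w' arbitrary: us')
        case (Cons l w')
        then show ?case by (cases l) force+
      qed auto
      then show ?thesis using us(1) by blast
    qed
    ultimately show ?thesis using xs(2) unfolding j_def by auto
  qed
  have noclose: "\<not> (2 \<le> card (set xs \<inter> set us) \<and> card (set xs \<inter> set us) < k)" if xs: "xs \<in> S" for xs
  proof
    assume "2 \<le> card (set xs \<inter> set us) \<and> card (set xs \<inter> set us) < k"
    then have c: "closures w = 0" "card (set xs \<inter> set us) = 2" using close2 xs by auto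
    have ce: "card (set (ext xs)) = k - 2" using card_ext[OF xs] c by simp
    then have "set (ext xs) \<noteq> {}" using k by force
    then obtain y where y: "y \<in> set (ext xs)" by (metis ex_in_conv)
    have "good (Close 2 # w, us @ ext xs, \<P>, {y})"
      unfolding good_def prod.case
    proof (intro conjI)
      show "us @ ext xs \<in> explored k X S (Close 2 # w)"
        using xs us(1) c k unfolding ext_def by auto
      show "\<forall>i<count_list (Close 2 # w) Advance. \<forall>ys\<in>S. (us @ ext xs) ! i \<in> set ys \<longrightarrow> set ys \<subseteq> set (us @ ext xs)"
        using sat_ext by simp
      show "\<forall>R. edge_closed S R \<and> m \<in> R \<longrightarrow> set (us @ ext xs) \<subseteq> R"
        using least_ext[OF xs] c(2) by force
      show "{y} = {} \<or> (\<exists>y'\<in>set (us @ ext xs) - {m}. {y} = {y'})"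
        using y m_us unfolding ext_def by auto
      show "\<forall>ys\<in>S. set ys \<subseteq> set (us @ ext xs) \<longrightarrow> set ys \<inter> {y} \<noteq> {} \<or> (\<exists>P\<in>\<P>. P \<subseteq> set ys)"
      proof (intro ballI impI, rule ccontr)
        fix ys assume ys: "ys \<in> S" "set ys \<subseteq> set (us @ ext xs)"
          and neg: "\<not> (set ys \<inter> {y} \<noteq> {} \<or> (\<exists>P\<in>\<P>. P \<subseteq> set ys))"
        have notin: "\<not> set ys \<subseteq> set us" using cov[OF ys(1)] cl0[OF c(1)] neg by auto
        \<comment> \<open>An edge that avoids \<open>y\<close> and is not inside \<open>us\<close>
          has at most \<open>k - 3\<close> vertices outside, hence at least three inside, against
          \<open>close2\<close>.\<close>
        have "set ys - set us \<subseteq> set (ext xs) - {y}" using ys(2) neg by auto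
        then have "card (set ys - set us) \<le> k - 3"
          using ce y card_mono[of "set (ext xs) - {y}" "set ys - set us"] by simp
        moreover have "card (set ys - set us) = k - card (set ys \<inter> set us)"
          using cardS[OF ys(1)] by (simp add: card_Diff_subset_Int)
        moreover have "card (set ys \<inter> set us) < k"
        proof -
          have "set ys \<inter> set us \<subset> set ys" using notin by auto
          then show ?thesis using cardS[OF ys(1)] psubset_card_mono by (metis List.finite_set)
        qed
        ultimately have "3 \<le> card (set ys \<inter> set us)" "card (set ys \<inter> set us) < k" using k by auto
        then show False using close2[OF ys(1)] by simp
      qed
    qed (use us0 c P in auto)
    from t(2)[OF this] have "length (ext xs) = 0" unfolding teq size_def by simp
    then show False using y by simp
  qed
  have nobranch: "set xs \<subseteq> set us" if xs: "xs \<in> S" and adv: "count_list w Advance < length us"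
      "us ! count_list w Advance \<in> set xs" for xs
  proof (rule ccontr)
    assume n: "\<not> set xs \<subseteq> set us"
    have small: "card (set ys \<inter> set us) \<le> 1" if "ys \<in> S" "\<not> set ys \<subseteq> set us" for ys
    proof -
      have "set ys \<inter> set us \<subset> set ys" using that by auto
      then have "card (set ys \<inter> set us) < k"
        using cardS[OF that(1)] psubset_card_mono by (metis List.finite_set)
      then show ?thesis using noclose[OF that(1)] by simp
    qed
    have "us ! count_list w Advance \<in> set xs \<inter> set us" using adv by simp
    then have int: "set xs \<inter> set us = {us ! count_list w Advance}"
      using small[OF xs n] by (metis List.finite_set One_nat_def card_le_Suc0_iff_eq finite_Int is_singletonI' is_singleton_the_elem empty_iff singletonD)
    have ce: "card (set (ext xs)) = k - 1" using card_ext[OF xs] int by simp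
    then have "card (set (ext xs)) \<ge> 2" using k by simp
    then obtain y z where yz: "y \<in> set (ext xs)" "z \<in> set (ext xs)" "y \<noteq> z"
      by (meson card_2_iff' obtain_subset_with_card_n subset_iff)
    then have yz_us: "y \<notin> set us" "z \<notin> set us" by (auto simp: ext_def)
    have "good (Branch # w, us @ ext xs, insert {y, z} \<P>, D)"
      unfolding good_def prod.case
    proof (intro conjI)
      show "us @ ext xs \<in> explored k X S (Branch # w)"
        using xs us(1) adv int unfolding ext_def by auto
      show "\<forall>i<count_list (Branch # w) Advance. \<forall>ys\<in>S. (us @ ext xs) ! i \<in> set ys \<longrightarrow> set ys \<subseteq> set (us @ ext xs)"
        using sat_ext by simp
      show "\<forall>R. edge_closed S R \<and> m \<in> R \<longrightarrow> set (us @ ext xs) \<subseteq> R"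
        using least_ext[OF xs] int by force
      show "D = {} \<or> (\<exists>y\<in>set (us @ ext xs) - {m}. D = {y})" using D by auto
      have "{y, z} \<inter> P = {}" if "P \<in> \<P>" for P using that P(2) yz_us by blast
      moreover have "pairing {{y, z}}" using yz(3) unfolding pairing_def by (auto simp: disjoint_def)
      ultimately have "pairing ({{y, z}} \<union> \<P>)" using P(1) by (intro pairing_Un) auto
      then show "pairing (insert {y, z} \<P>)" by simp
      show "\<Union>(insert {y, z} \<P>) \<subseteq> set (us @ ext xs) - {m}"
        using P(2) yz yz_us m_us by auto
      show "\<forall>ys\<in>S. set ys \<subseteq> set (us @ ext xs) \<longrightarrow>
          set ys \<inter> D \<noteq> {} \<or> (\<exists>P\<in>insert {y, z} \<P>. P \<subseteq> set ys)"
      proof (intro ballI impI)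
        fix ys assume ys: "ys \<in> S" "set ys \<subseteq> set (us @ ext xs)"
        show "set ys \<inter> D \<noteq> {} \<or> (\<exists>P\<in>insert {y, z} \<P>. P \<subseteq> set ys)"
        proof (cases "set ys \<subseteq> set us")
          case True
          then show ?thesis using cov[OF ys(1)] by simp
        next
          case False
          have sub: "set ys - set us \<subseteq> set (ext xs)" using ys(2) by auto
          have "card (set ys - set us) = k - card (set ys \<inter> set us)"
            using cardS[OF ys(1)] by (simp add: card_Diff_subset_Int)
          then have "card (set (ext xs)) \<le> card (set ys - set us)"
            using small[OF ys(1) False] ce by simp
          then have "set ys - set us = set (ext xs)" using sub by (simp add: card_seteq)
          then have "{y, z} \<subseteq> set ys" using yz by auto
          then show ?thesis by simp
        qed
      qed
    qed (use us0 cl cl0 in auto)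
    from t(2)[OF this] have "length (ext xs) = 0" unfolding teq size_def by simp
    then show False using yz by simp
  qed
  have full: "count_list w Advance = length us"
  proof (rule ccontr)
    assume "count_list w Advance \<noteq> length us"
    then have lt: "count_list w Advance < length us" using p(4) by simp
    have "good (Advance # w, us, \<P>, D)"
      unfolding good_def prod.case
    proof (intro conjI)
      show "us \<in> explored k X S (Advance # w)" using us(1) lt by simp
      show "\<forall>i<count_list (Advance # w) Advance. \<forall>xs\<in>S. us ! i \<in> set xs \<longrightarrow> set xs \<subseteq> set us"
        using sat nobranch[OF _ lt] by (auto simp: less_Suc_eq)
      show "\<forall>xs\<in>S. set xs \<subseteq> set us \<longrightarrow> set xs \<inter> D \<noteq> {} \<or> (\<exists>P\<in>\<P>. P \<subseteq> set xs)"
        by (rule cov')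
      show "\<forall>R. edge_closed S R \<and> m \<in> R \<longrightarrow> set us \<subseteq> R" by (rule least')
    qed (use us cl cl0 D P in auto)
    from t(2)[OF this] show False unfolding teq size_def by simp
  qed
  have "edge_closed S (set us)"
    unfolding edge_closed_def
  proof (intro ballI impI)
    fix xs assume "xs \<in> S" "set xs \<inter> set us \<noteq> {}"
    then obtain v where "v \<in> set xs" "v \<in> set us" by auto
    then obtain i where "i < length us" "us ! i \<in> set xs" by (metis in_set_conv_nth)
    then show "set xs \<subseteq> set us" using sat[of i xs] full \<open>xs \<in> S\<close> by simp
  qed
  then have "reply_certificate S m (set us) D \<P>"
    unfolding reply_certificate_def
    by (intro conjI m_us least' D P cov')
  then show ?thesis by blast
qed

section \<open>The Breaker side below the threshold\<close>

lemma finite_solutions_in: "finite X \<Longrightarrow> finite {xs \<in> solutions k a b. set xs \<subseteq> X}"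
  by (rule finite_subset[OF _ finite_lists_length_eq[of X k]]) (auto simp: solutions_def)

text \<open>The factor \<open>2 ^ k\<close> chooses the positions whose entries lie in
  \<open>V\<close>. Since \<open>j < k\<close>, some position \<open>q\<close> is outside, and its
  entry is determined by the others because its coefficient is non-zero. This leaves
  \<open>j\<close> entries from \<open>V\<close> and \<open>k - 1 - j\<close> from the
  interval.\<close>

lemma card_solutions_meeting:
  assumes a: "\<forall>i\<in>{1..k}. a i \<noteq> 0" and V: "finite V" "card V \<le> L" and j: "j < k"
  shows "card {xs \<in> solutions k a b. set xs \<subseteq> interval n \<and> card (set xs \<inter> V) = j}
    \<le> 2 ^ k * (L ^ j * n ^ (k - 1 - j))"
proof -
  define pos where "pos xs = {i. i < k \<and> xs ! i \<in> V}" for xs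
  define Z where "Z P = {xs \<in> solutions k a b. set xs \<subseteq> interval n \<and> pos xs = P}" for P
  have finZ: "finite (Z P)" for P
    by (rule finite_subset[OF _ finite_solutions_in[of "interval n"]]) (auto simp: Z_def)
  have card_pos: "card (pos xs) = card (set xs \<inter> V)" if "xs \<in> solutions k a b" for xs
  proof -
    have "bij_betw (\<lambda>i. xs ! i) (pos xs) (set xs \<inter> V)"
      using that unfolding bij_betw_def
      by (auto simp: pos_def solutions_def inj_on_def nth_eq_iff_index_eq in_set_conv_nth image_iff)
    then show ?thesis by (rule bij_betw_same_card)
  qed
  have Zcard: "card (Z P) \<le> L ^ j * n ^ (k - 1 - j)" if P: "P \<subseteq> {..<k}" "card P = j" for P
  proof -
    have "P \<noteq> {..<k}" using P j by auto
    then obtain q where q: "q < k" "q \<notin> P" using P(1) by auto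
    define T where "T = {..<k} - {q}"
    define \<phi> where "\<phi> xs = restrict (\<lambda>i. xs ! i) T" for xs :: "int list"
    have inj: "inj_on \<phi> (Z P)"
    proof (rule inj_onI)
      fix xs ys assume xs: "xs \<in> Z P" and ys: "ys \<in> Z P" and eq: "\<phi> xs = \<phi> ys"
      have agree: "xs ! i = ys ! i" if "i \<in> T" for i
        using fun_cong[OF eq, of i] that by (simp add: \<phi>_def)
      have len: "length xs = k" "length ys = k"
        and s: "(\<Sum>j<k. a (Suc j) * xs ! j) = b" "(\<Sum>j<k. a (Suc j) * ys ! j) = b"
        using xs ys by (auto simp: Z_def solutions_def)
      have split: "(\<Sum>j<k. a (Suc j) * zs ! j) = a (Suc q) * zs ! q + (\<Sum>j\<in>T. a (Suc j) * zs ! j)"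
        for zs unfolding T_def using q(1) by (subst sum.remove[of _ q]) auto
      have "(\<Sum>j\<in>T. a (Suc j) * xs ! j) = (\<Sum>j\<in>T. a (Suc j) * ys ! j)"
        using agree by (intro sum.cong) auto
      then have "a (Suc q) * xs ! q = a (Suc q) * ys ! q"
        using s split[of xs] split[of ys] by linarith
      then have "xs ! q = ys ! q" using a q(1) by auto
      then have "xs ! i = ys ! i" if "i < k" for i
        using agree[of i] that by (cases "i = q") (auto simp: T_def)
      then show "xs = ys" using len by (intro nth_equalityI) auto
    qed
    have sub: "\<phi> ` Z P \<subseteq> (\<Pi>\<^sub>E i\<in>T. if i \<in> P then V else interval n)"
    proof (rule image_subsetI)
      fix xs assume xs: "xs \<in> Z P"
      then have "xs ! i \<in> interval n" if "i < k" for i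
        using that nth_mem[of i xs] by (auto simp: Z_def solutions_def)
      moreover have "xs ! i \<in> V" if "i \<in> P" for i
        using xs that unfolding Z_def pos_def by auto
      ultimately show "\<phi> xs \<in> (\<Pi>\<^sub>E i\<in>T. if i \<in> P then V else interval n)"
        by (auto simp: \<phi>_def T_def)
    qed
    have finT: "finite T" by (simp add: T_def)
    have TP: "T \<inter> P = P" "T - P = {..<k} - insert q P" using P q by (auto simp: T_def)
    have "finite P" using P(1) finite_subset by auto
    then have "card ({..<k} - insert q P) = k - Suc j"
      using P q by (subst card_Diff_subset) auto
    then have cardT: "card (T - P) = k - 1 - j" using TP by simp
    have "card (Z P) \<le> card (\<Pi>\<^sub>E i\<in>T. if i \<in> P then V else interval n)"
      using sub inj finT V(1) by (intro card_inj_on_le finite_PiE) auto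
    also have "\<dots> = (\<Prod>i\<in>T. if i \<in> P then card V else n)"
      using finT by (subst card_PiE) (auto intro!: prod.cong)
    also have "\<dots> = card V ^ card (T \<inter> P) * n ^ card (T - P)"
      using finT by (subst prod.If_cases) (auto simp: Diff_eq)
    also have "\<dots> \<le> L ^ j * n ^ (k - 1 - j)"
      unfolding cardT using TP(1) P(2) V(2) by (simp add: power_mono)
    finally show ?thesis .
  qed
  define \<A> where "\<A> = {P. P \<subseteq> {..<k} \<and> card P = j}"
  have "\<A> \<subseteq> Pow {..<k}" by (auto simp: \<A>_def)
  then have \<A>: "finite \<A>" "card \<A> \<le> 2 ^ k"
    using finite_subset card_mono[of "Pow {..<k}" \<A>] by (auto simp: card_Pow)
  have "{xs \<in> solutions k a b. set xs \<subseteq> interval n \<and> card (set xs \<inter> V) = j} \<subseteq> (\<Union>P\<in>\<A>. Z P)"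
    using card_pos by (auto simp: Z_def \<A>_def pos_def)
  then have "card {xs \<in> solutions k a b. set xs \<subseteq> interval n \<and> card (set xs \<inter> V) = j}
      \<le> card (\<Union>P\<in>\<A>. Z P)"
    using \<A>(1) finZ by (intro card_mono) auto
  also have "\<dots> \<le> (\<Sum>P\<in>\<A>. card (Z P))" using \<A>(1) by (rule card_UN_le)
  also have "\<dots> \<le> (\<Sum>P\<in>\<A>. L ^ j * n ^ (k - 1 - j))"
    using Zcard by (intro sum_mono) (auto simp: \<A>_def)
  also have "\<dots> = card \<A> * (L ^ j * n ^ (k - 1 - j))" by simp
  also have "\<dots> \<le> 2 ^ k * (L ^ j * n ^ (k - 1 - j))" using \<A>(2) by (rule mult_le_mono1)
  finally show ?thesis .
qed

text \<open>With \<open>x = n\<close> and \<open>d = \<delta>\<close>, the left side is, up to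
  constants, the expected number of ways to attach an edge with \<open>j\<close> prescribed vertices
  at the threshold density. In the exponents the identity reads
  \<open>(k - 2) * (k - j) = (k - 1) * (k - 1 - j) + (j - 1)\<close>.\<close>

lemma scaled_power_identity:
  fixes x d :: real
  assumes "x * d ^ (k - 1) = 1" and j: "1 \<le> j" "j < k"
  shows "x ^ (k - 1 - j) * (d ^ (k - 2)) ^ (k - j) = d ^ (j - 1)"
proof -
  obtain i where i: "k = j + 1 + i" using j(2) by (metis Suc_eq_plus1 Suc_leI le_Suc_ex)
  obtain e where e: "j = e + 1" using j(1) by (metis add.commute le_Suc_ex)
  have exps: "k - 1 - j = i" "k - j = Suc i" "(k - 2) * Suc i = (k - 1) * i + (j - 1)"
    unfolding i e by (simp_all add: algebra_simps)
  have "x ^ i * (d ^ (k - 2)) ^ Suc i = x ^ i * d ^ ((k - 1) * i + (j - 1))"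
    by (simp only: power_mult[symmetric] exps(3))
  also have "\<dots> = (x * d ^ (k - 1)) ^ i * d ^ (j - 1)"
    by (simp add: power_add power_mult power_mult_distrib)
  finally show ?thesis unfolding exps(1,2) by (simp only: assms(1) power_one mult_1_left)
qed

text \<open>The threshold becomes an integer power of \<delta>, so that estimates can be made with
  \<open>^\<close> in place of \<open>powr\<close>.\<close>

lemma threshold_scale:
  assumes "n \<ge> 1" "k \<ge> 3"
  defines "\<delta> \<equiv> real n powr (- (1 / (real k - 1)))"
  shows "0 < \<delta>" "\<delta> \<le> 1" "real n * \<delta> ^ (k - 1) = 1"
    "real n powr (- ((real k - 2) / (real k - 1))) = \<delta> ^ (k - 2)"
proof -
  show "0 < \<delta>" "\<delta> \<le> 1"
    using assms by (auto simp: \<delta>_def powr_le_one_le ge_one_powr_ge_zero powr_minus field_simps)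
  have pow: "\<delta> ^ m = real n powr (- (real m / (real k - 1)))" for m
    unfolding \<delta>_def using assms(1) by (subst powr_power) auto
  have "\<delta> ^ (k - 1) = real n powr (- 1)" unfolding pow using assms(2) by simp
  then show "real n * \<delta> ^ (k - 1) = 1" using assms(1) by (simp add: powr_minus)
  show "real n powr (- ((real k - 2) / (real k - 1))) = \<delta> ^ (k - 2)" unfolding pow using assms(2) by simp
qed

lemma finite_explored:
  assumes "finite V" "\<And>xs. xs \<in> S \<Longrightarrow> length xs = k \<and> distinct xs \<and> set xs \<subseteq> V"
  shows "finite (explored k V S w)"
proof (rule finite_subset)
  show "explored k V S w \<subseteq> {us. set us \<subseteq> V \<and> length us \<le> card V}"
  proof
    fix us assume "us \<in> explored k V S w"
    then have "distinct us" "set us \<subseteq> V" using explored_props[of S k V us w] assms(2) by auto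
    then show "us \<in> {us. set us \<subseteq> V \<and> length us \<le> card V}"
      using assms(1) by (simp add: card_mono flip: distinct_card)
  qed
  show "finite {us. set us \<subseteq> V \<and> length us \<le> card V}"
    using assms(1) by (rule finite_lists_length_le)
qed

text \<open>First moment of one exploration step: for a distinct list, \<open>p ^ length us\<close>
  is the probability that all vertices found so far survive, and each list has at most
  \<open>K\<close> extensions by \<open>d\<close> new vertices.\<close>

lemma sum_power_length_append:
  fixes p :: real
  assumes fin: "finite Us" "\<And>us. us \<in> Us \<Longrightarrow> finite (T us)" and p: "0 \<le> p"
    and T: "\<And>us xs. us \<in> Us \<Longrightarrow> xs \<in> T us \<Longrightarrow> length (g us xs) = d"
    and K: "\<And>us. us \<in> Us \<Longrightarrow> real (card (T us)) \<le> K"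
  shows "(\<Sum>v\<in>{us @ g us xs | us xs. us \<in> Us \<and> xs \<in> T us}. p ^ length v)
    \<le> K * p ^ d * (\<Sum>us\<in>Us. p ^ length us)"
proof -
  let ?h = "\<lambda>(us, xs). us @ g us xs"
  have "{us @ g us xs | us xs. us \<in> Us \<and> xs \<in> T us} = ?h ` Sigma Us T" by auto
  then have "(\<Sum>v\<in>{us @ g us xs | us xs. us \<in> Us \<and> xs \<in> T us}. p ^ length v)
      \<le> (\<Sum>z\<in>Sigma Us T. p ^ length (?h z))"
    using fin p sum_image_le[of "Sigma Us T" "\<lambda>v. p ^ length v" ?h] by (simp add: o_def)
  also have "\<dots> = (\<Sum>us\<in>Us. \<Sum>xs\<in>T us. p ^ length (us @ g us xs))"
    using fin by (subst sum.Sigma) (auto simp: case_prod_beta)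
  also have "\<dots> = (\<Sum>us\<in>Us. real (card (T us)) * (p ^ d * p ^ length us))"
    using T by (intro sum.cong) (simp_all add: power_add mult_ac)
  also have "\<dots> \<le> (\<Sum>us\<in>Us. K * (p ^ d * p ^ length us))"
    using K p by (intro sum_mono mult_right_mono) auto
  also have "\<dots> = K * p ^ d * (\<Sum>us\<in>Us. p ^ length us)"
    by (simp add: sum_distrib_left mult_ac)
  finally show ?thesis .
qed

section \<open>First moment of the explorations\<close>

context
  fixes k n :: nat and a :: "nat \<Rightarrow> int" and b :: int and S :: "int list set"
    and p \<delta> \<epsilon> :: real
  assumes k: "k \<ge> 3" and a: "\<forall>i\<in>{1..k}. a i \<noteq> 0"
    and S: "S = {xs \<in> solutions k a b. set xs \<subseteq> interval n}"
    and p: "0 \<le> p" "p \<le> 1" and \<delta>: "0 < \<delta>" "\<delta> \<le> 1" and \<epsilon>: "0 \<le> \<epsilon>"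
    and np: "real n * p \<le> 1 / \<delta>"
    and branch: "2 ^ k * real n ^ (k - 2) * p ^ (k - 1) \<le> \<epsilon>"
    and close: "\<And>j. 2 \<le> j \<Longrightarrow> j < k \<Longrightarrow> real n ^ (k - 1 - j) * p ^ (k - j) \<le> \<delta> ^ (j - 1)"
begin

lemma S_props: "xs \<in> S \<Longrightarrow> length xs = k \<and> distinct xs \<and> set xs \<subseteq> interval n"
  by (auto simp: S solutions_def)

lemma finS: "finite S" unfolding S by (rule finite_solutions_in) simp

lemma finite_expl: "finite (explored k (interval n) S w)"
  using finite_explored[of "interval n" S k w] S_props by auto

text \<open>The start contributes \<open>n * p \<le> 1 / \<delta>\<close>. A branch attaches at the
  vertex that the word dictates, so its factor \<open>\<epsilon>\<close> does not grow with the
  list. A closing edge takes its \<open>j\<close> common vertices from at most \<open>L\<close>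
  known ones, hence \<open>2 ^ k * L ^ k\<close>, and gains
  \<open>\<delta> ^ (j - 1)\<close>.\<close>

lemma weight_explored:
  assumes "1 + k * length w \<le> L"
  shows "(\<Sum>us\<in>explored k (interval n) S w. p ^ length us) \<le>
    1 / \<delta> * \<epsilon> ^ count_list w Branch * (2 ^ k * real L ^ k) ^ closures w * \<delta> ^ excess w"
  using assms
proof (induction w)
  case Nil
  have "(\<Sum>us\<in>explored k (interval n) S []. p ^ length us) = real n * p"
    by (simp add: sum.reindex inj_on_def)
  then show ?case using np by simp
next
  case (Cons l w)
  define W where "W = (\<Sum>us\<in>explored k (interval n) S w. p ^ length us)"
  define R where "R = 1 / \<delta> * \<epsilon> ^ count_list w Branch * (2 ^ k * real L ^ k) ^ closures w * \<delta> ^ excess w"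
  have IH: "W \<le> R" using Cons unfolding W_def R_def by simp
  have W0: "0 \<le> W" unfolding W_def using p by (intro sum_nonneg) auto
  have R0: "0 \<le> R" using IH W0 by simp
  have L: "1 \<le> L" using Cons.prems by simp
  show ?case
  proof (cases l)
    case Advance
    have "(\<Sum>us\<in>explored k (interval n) S (l # w). p ^ length us) \<le> W"
      unfolding W_def Advance using p finite_expl by (intro sum_mono2) auto
    then show ?thesis using IH unfolding R_def Advance by simp
  next
    case Branch
    define T where "T us = {xs \<in> S. count_list w Advance < length us \<and>
      set xs \<inter> set us = {us ! count_list w Advance}}" for us
    have "explored k (interval n) S (l # w) =
        {us @ filter (\<lambda>y. y \<notin> set us) xs | us xs. us \<in> explored k (interval n) S w \<and> xs \<in> T us}"
      unfolding T_def Branch by auto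
    then have "(\<Sum>us\<in>explored k (interval n) S (l # w). p ^ length us) \<le>
        (2 ^ k * real n ^ (k - 2)) * p ^ (k - 1) * W"
      unfolding W_def
    proof (elim ssubst, intro sum_power_length_append finite_expl p(1))
      fix us assume us: "us \<in> explored k (interval n) S w"
      show "finite (T us)" using finS by (simp add: T_def)
      show "length (filter (\<lambda>y. y \<notin> set us) xs) = k - 1" if "xs \<in> T us" for xs
        using that S_props[of xs] length_filter_notin[of xs "set us"] by (simp add: T_def)
      define u where "u = us ! count_list w Advance"
      have "T us \<subseteq> {xs \<in> solutions k a b. set xs \<subseteq> interval n \<and> card (set xs \<inter> {u}) = 1}"
        unfolding T_def S u_def
      proof (intro subsetI, elim CollectE conjE, intro CollectI conjI)
        fix xs assume "set xs \<inter> set us = {us ! count_list w Advance}"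
        then have "set xs \<inter> {us ! count_list w Advance} = {us ! count_list w Advance}" by auto
        then show "card (set xs \<inter> {us ! count_list w Advance}) = 1" by simp
      qed auto
      then have "card (T us) \<le> card {xs \<in> solutions k a b. set xs \<subseteq> interval n \<and> card (set xs \<inter> {u}) = 1}"
        by (rule card_mono[rotated])
          (rule finite_subset[OF _ finite_solutions_in[of "interval n" k a b]], auto)
      also have "\<dots> \<le> 2 ^ k * (1 ^ 1 * n ^ (k - 1 - 1))"
        using k by (intro card_solutions_meeting[OF a]) auto
      finally have "card (T us) \<le> 2 ^ k * n ^ (k - 2)" using k by (simp add: numeral_2_eq_2)
      then have "real (card (T us)) \<le> real (2 ^ k * n ^ (k - 2))" by (rule of_nat_mono)
      then show "real (card (T us)) \<le> 2 ^ k * real n ^ (k - 2)" by simp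
    qed
    also have "\<dots> \<le> \<epsilon> * R" using branch IH W0 \<epsilon> by (intro mult_mono) auto
    finally show ?thesis unfolding R_def Branch by (simp add: mult_ac)
  next
    case (Close j)
    show ?thesis
    proof (cases "2 \<le> j \<and> j < k")
      case False
      then have "explored k (interval n) S (l # w) = {}" unfolding Close by auto
      then show ?thesis using \<delta> \<epsilon> by simp
    next
      case True
      define T where "T us = {xs \<in> S. card (set xs \<inter> set us) = j}" for us
      have "explored k (interval n) S (l # w) =
          {us @ filter (\<lambda>y. y \<notin> set us) xs | us xs. us \<in> explored k (interval n) S w \<and> xs \<in> T us}"
        unfolding T_def Close using True by auto
      then have "(\<Sum>us\<in>explored k (interval n) S (l # w). p ^ length us) \<le>
          (2 ^ k * (real L ^ j * real n ^ (k - 1 - j))) * p ^ (k - j) * W"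
        unfolding W_def
      proof (elim ssubst, intro sum_power_length_append finite_expl p(1))
        fix us assume us: "us \<in> explored k (interval n) S w"
        show "finite (T us)" using finS by (simp add: T_def)
        show "length (filter (\<lambda>y. y \<notin> set us) xs) = k - j" if "xs \<in> T us" for xs
          using that S_props[of xs] length_filter_notin[of xs "set us"] by (simp add: T_def)
        have "length us \<le> 1 + (k - 1) * count_list w Branch + k * closures w"
          using explored_props[of S k "interval n" us w] S_props us by auto
        also have "\<dots> \<le> 1 + k * (count_list w Branch + closures w)" by (simp add: algebra_simps)
        also have "count_list w Branch + closures w \<le> length w"
          by (induction w rule: closures.induct) auto
        finally have "length us \<le> L" using Cons.prems by simp
        then have cardus: "card (set us) \<le> L" using card_length le_trans by blast
        have "T us = {xs \<in> solutions k a b. set xs \<subseteq> interval n \<and> card (set xs \<inter> set us) = j}"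
          unfolding T_def S by auto
        then have "card (T us) \<le> 2 ^ k * (L ^ j * n ^ (k - 1 - j))"
          using True cardus card_solutions_meeting[OF a, of "set us" L j] by simp
        then have "real (card (T us)) \<le> real (2 ^ k * (L ^ j * n ^ (k - 1 - j)))" by (rule of_nat_mono)
        then show "real (card (T us)) \<le> 2 ^ k * (real L ^ j * real n ^ (k - 1 - j))" by simp
      qed
      also have "\<dots> = (2 ^ k * real L ^ j) * (real n ^ (k - 1 - j) * p ^ (k - j)) * W"
        by (simp add: mult_ac)
      also have "\<dots> \<le> (2 ^ k * real L ^ k) * \<delta> ^ (j - 1) * R"
      proof (intro mult_mono)
        show "real L ^ j \<le> real L ^ k" using L True by (intro power_increasing) auto
      qed (use close True IH W0 \<delta> p in auto)
      finally show ?thesis unfolding R_def Close by (simp add: power_add mult_ac)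
    qed
  qed
qed

text \<open>Excess two turns the factor 1/\<delta> into \<delta>; it remains to sum over words. By
  \<open>length_w\<close> a word has at most \<open>k\<close> letters per branch, up to an additive
  constant, so \<open>\<epsilon> = \<eta> ^ k\<close> yields a factor \<open>\<eta>\<close> per
  letter. There are at most \<open>k\<close> letters to choose from, and the closing edges cost up
  to \<open>(1 + k) ^ (2 * k)\<close> per letter; the value of \<open>\<eta>\<close> makes the ratio
  of the resulting geometric series 1/2.\<close>

lemma prob_bad_exploration:
  assumes \<eta>: "\<eta> = 1 / (2 * real k * (1 + real k) ^ (2 * k))" and \<epsilon>\<eta>: "\<epsilon> = \<eta> ^ k"
  shows "measure_pmf.prob (random_interval n p)
     {X. \<exists>w us. us \<in> explored k (interval n) S w \<and> excess w \<ge> 2 \<and> closures w \<le> 2 \<and> set us \<subseteq> X}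
     \<le> 2 * (4 ^ k / \<eta> ^ (2 * k + 3)) * \<delta>"
proof -
  define letters where "letters = {Advance, Branch} \<union> Close ` {2..<k}"
  \<comment> \<open>A cutoff that only makes the union finite: a word with a non-empty set of
    explorations has fewer than \<open>n\<close> branches.\<close>
  define N where "N = k * n + 2 * k + 3"
  define Wd where "Wd = {w. set w \<subseteq> letters \<and> length w \<le> N \<and> excess w \<ge> 2 \<and> closures w \<le> 2 \<and>
    explored k (interval n) S w \<noteq> {}}"
  define K where "K = 4 ^ k / \<eta> ^ (2 * k + 3)"
  have k1: "real k \<ge> 1" using k by simp
  have "1 * 1 \<le> 2 * real k * (1 + real k) ^ (2 * k)"
    using k1 by (intro mult_mono one_le_power) auto
  then have \<eta>01: "0 < \<eta>" "\<eta> \<le> 1" unfolding \<eta> by (auto simp: divide_le_eq_1)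
  have K0: "0 \<le> K" using \<eta>01 by (simp add: K_def)
  have fin_letters: "finite letters" and card_letters: "card letters \<le> k"
  proof -
    show "finite letters" by (simp add: letters_def)
    have "card letters \<le> card {Advance, Branch} + card (Close ` {2..<k})"
      unfolding letters_def by (rule card_Un_le)
    also have "\<dots> \<le> 2 + (k - 2)" using card_image_le[of "{2..<k}" Close] by simp
    finally show "card letters \<le> k" using k by simp
  qed
  have in_letters: "set w \<subseteq> letters" if "us \<in> explored k (interval n) S w" for us w
    using that
  proof (induction w arbitrary: us)
    case (Cons l w)
    then show ?case by (cases l) (auto simp: letters_def)
  qed simp
  have branch_le: "count_list w Branch < length us" if "us \<in> explored k (interval n) S w" for us w
    using that
  proof (induction w arbitrary: us)
    case (Cons l w)
    show ?case
    proof (cases l)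
      case Branch
      then obtain vs xs where v: "us = vs @ filter (\<lambda>y. y \<notin> set vs) xs"
        "vs \<in> explored k (interval n) S w" "xs \<in> S" "set xs \<inter> set vs = {vs ! count_list w Advance}"
        using Cons.prems by auto
      have "length (filter (\<lambda>y. y \<notin> set vs) xs) = k - 1"
        using length_filter_notin[of xs "set vs"] S_props[OF v(3)] v(4) by simp
      then show ?thesis using Cons.IH[OF v(2)] Branch v(1) k by simp
    next
      case (Close j)
      then obtain vs xs where "us = vs @ filter (\<lambda>y. y \<notin> set vs) xs"
        "vs \<in> explored k (interval n) S w" using Cons.prems by auto
      then show ?thesis using Cons.IH[of vs] Close by simp
    qed (use Cons in auto)
  qed auto
  have length_split: "length w = count_list w Advance + count_list w Branch + closures w" for w
    by (induction w rule: closures.induct) auto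
  have length_w: "length w \<le> k * count_list w Branch + (2 * k + 3)"
    if us: "us \<in> explored k (interval n) S w" and cl: "closures w \<le> 2" for us w
  proof -
    have "count_list w Advance \<le> 1 + (k - 1) * count_list w Branch + k * closures w"
      using explored_props[of S k "interval n" us w] S_props us by auto
    moreover have "(k - 1) * count_list w Branch + count_list w Branch = k * count_list w Branch"
      using k by (simp add: algebra_simps)
    moreover have "k * closures w \<le> k * 2" using cl by (rule mult_le_mono2)
    ultimately show ?thesis using length_split[of w] cl by linarith
  qed
  have length_us: "length us \<le> n" if "us \<in> explored k (interval n) S w" for us w
  proof -
    have "distinct us" "set us \<subseteq> interval n"
      using explored_props[of S k "interval n" us w] S_props that by auto
    then show ?thesis using card_mono[of "interval n" "set us"] by (simp add: distinct_card)
  qed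
  have inWd: "w \<in> Wd" if us: "us \<in> explored k (interval n) S w" and "excess w \<ge> 2" "closures w \<le> 2" for us w
  proof -
    have "k * count_list w Branch \<le> k * n"
      using branch_le[OF us] length_us[OF us] by (intro mult_le_mono2) simp
    then have "length w \<le> N" using length_w[OF us that(3)] unfolding N_def by linarith
    then show ?thesis using that in_letters[OF us] by (auto simp: Wd_def)
  qed
  have weight: "(\<Sum>us\<in>explored k (interval n) S w. p ^ length us) \<le>
      K * \<delta> * (\<eta> * (1 + real k) ^ (2 * k)) ^ length w" if w: "w \<in> Wd" for w
  proof -
    define L where "L = 1 + k * length w"
    obtain us where us: "us \<in> explored k (interval n) S w" using w by (auto simp: Wd_def)
    have cl: "closures w \<le> 2" and ex: "2 \<le> excess w" using w by (auto simp: Wd_def)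
    \<comment> \<open>Two closing edges cost a power of the linear bound \<open>L\<close>;
      Bernoulli's inequality replaces \<open>L\<close> by an exponential in the length of the word,
      to be absorbed by \<open>\<eta>\<close>.\<close>
    have "1 + real (length w) * real k \<le> (1 + real k) ^ length w"
      using k1 by (intro Bernoulli_inequality) simp
    then have L1: "1 \<le> real L" "real L \<le> (1 + real k) ^ length w" by (auto simp: L_def mult.commute)
    have LL: "(2 ^ k * real L ^ k) ^ closures w \<le> 4 ^ k * ((1 + real k) ^ (2 * k)) ^ length w"
    proof -
      have "(2 ^ k * real L ^ k) ^ closures w \<le> (2 ^ k * real L ^ k) ^ 2"
        using cl L1(1) mult_mono[of 1 "2 ^ k" 1 "real L ^ k"] by (intro power_increasing) auto
      also have "\<dots> = 4 ^ k * real L ^ (2 * k)"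
      proof -
        have "((2::real) ^ k)\<^sup>2 = (2\<^sup>2) ^ k" by (simp only: power_mult[symmetric] mult.commute)
        moreover have "(real L ^ k)\<^sup>2 = real L ^ (2 * k)" by (simp add: power_mult[symmetric] mult.commute)
        ultimately show ?thesis by (simp add: power_mult_distrib)
      qed
      also have "\<dots> \<le> 4 ^ k * ((1 + real k) ^ length w) ^ (2 * k)"
        using L1 by (intro mult_left_mono power_mono) auto
      also have "((1 + real k) ^ length w) ^ (2 * k) = ((1 + real k) ^ (2 * k)) ^ length w"
        by (simp only: power_mult[symmetric] mult.commute)
      finally show ?thesis .
    qed
    have eps: "\<epsilon> ^ count_list w Branch \<le> \<eta> ^ length w / \<eta> ^ (2 * k + 3)"
    proof -
      have "\<eta> ^ (k * count_list w Branch + (2 * k + 3)) \<le> \<eta> ^ length w"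
        using \<eta>01 length_w[OF us cl] by (intro power_decreasing) auto
      then show ?thesis using \<eta>01
        unfolding \<epsilon>\<eta> by (simp add: power_add power_mult le_divide_eq)
    qed
    have "(\<Sum>us\<in>explored k (interval n) S w. p ^ length us) \<le>
        1 / \<delta> * \<epsilon> ^ count_list w Branch * (2 ^ k * real L ^ k) ^ closures w * \<delta> ^ excess w"
      by (rule weight_explored) (simp add: L_def)
    also have "\<dots> \<le> 1 / \<delta> * (\<eta> ^ length w / \<eta> ^ (2 * k + 3)) *
        (4 ^ k * ((1 + real k) ^ (2 * k)) ^ length w) * \<delta> ^ 2"
      using eps LL \<delta> \<epsilon> \<eta>01 ex by (intro mult_mono power_decreasing) auto
    also have "\<dots> = K * \<delta> * (\<eta> * (1 + real k) ^ (2 * k)) ^ length w"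
      using \<delta> by (simp add: K_def power2_eq_square field_simps)
    finally show ?thesis .
  qed
  have "Wd \<subseteq> {w. set w \<subseteq> letters \<and> length w \<le> N}" by (auto simp: Wd_def)
  then have finWd: "finite Wd" using finite_lists_length_le[OF fin_letters, of N] finite_subset by auto
  define I where "I = Sigma Wd (explored k (interval n) S)"
  have finI: "finite I" unfolding I_def using finWd finite_expl by auto
  have "measure_pmf.prob (random_interval n p)
     {X. \<exists>w us. us \<in> explored k (interval n) S w \<and> excess w \<ge> 2 \<and> closures w \<le> 2 \<and> set us \<subseteq> X}
     \<le> measure_pmf.prob (random_interval n p) {X. \<exists>s\<in>I. set (snd s) \<subseteq> X}"
    by (rule prob_random_interval_mono) (use inWd in \<open>force simp: I_def\<close>)
  also have "\<dots> \<le> (\<Sum>s\<in>I. p ^ card (set (snd s)))"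
  proof (intro prob_ex_subset_random_interval finI p)
    fix s assume "s \<in> I"
    then have "snd s \<in> explored k (interval n) S (fst s)" by (auto simp: I_def)
    then show "set (snd s) \<subseteq> interval n"
      using explored_props[of S k "interval n" "snd s" "fst s"] S_props by simp
  qed
  also have "\<dots> = (\<Sum>w\<in>Wd. \<Sum>us\<in>explored k (interval n) S w. p ^ length us)"
  proof -
    have "distinct us" if "us \<in> explored k (interval n) S w" for us w
      using explored_props[of S k "interval n" us w] S_props that by simp
    then show ?thesis
      unfolding I_def using finWd finite_expl
      by (subst sum.Sigma) (auto intro!: sum.cong simp: distinct_card case_prod_beta)
  qed
  also have "\<dots> \<le> (\<Sum>w\<in>Wd. K * \<delta> * (\<eta> * (1 + real k) ^ (2 * k)) ^ length w)"
    using weight by (intro sum_mono) auto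
  also have "\<dots> \<le> (\<Sum>w\<in>{w. set w \<subseteq> letters \<and> length w \<le> N}. K * \<delta> * (\<eta> * (1 + real k) ^ (2 * k)) ^ length w)"
    using finite_lists_length_le[OF fin_letters, of N] K0 \<delta> \<eta>01
    by (intro sum_mono2) (auto simp: Wd_def)
  also have "{w. set w \<subseteq> letters \<and> length w \<le> N} = (\<Union>T\<in>{..N}. {w. set w \<subseteq> letters \<and> length w = T})"
    by auto
  also have "(\<Sum>w\<in>\<dots>. K * \<delta> * (\<eta> * (1 + real k) ^ (2 * k)) ^ length w) =
      (\<Sum>T\<in>{..N}. \<Sum>w\<in>{w. set w \<subseteq> letters \<and> length w = T}. K * \<delta> * (\<eta> * (1 + real k) ^ (2 * k)) ^ length w)"
    using finite_lists_length_eq[OF fin_letters] by (intro sum.UNION_disjoint) auto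
  also have "\<dots> = (\<Sum>T\<in>{..N}. real (card letters ^ T) * (K * \<delta> * (\<eta> * (1 + real k) ^ (2 * k)) ^ T))"
    using card_lists_length_eq[OF fin_letters] by (intro sum.cong) auto
  also have "\<dots> \<le> (\<Sum>T\<in>{..N}. K * \<delta> * (1 / 2) ^ T)"
  proof (rule sum_mono)
    fix T
    have "real (card letters ^ T) * (K * \<delta> * (\<eta> * (1 + real k) ^ (2 * k)) ^ T) \<le>
        real k ^ T * (K * \<delta> * (\<eta> * (1 + real k) ^ (2 * k)) ^ T)"
      using card_letters K0 \<delta> \<eta>01 by (intro mult_right_mono) (auto intro!: power_mono)
    also have "\<dots> = K * \<delta> * (real k * \<eta> * (1 + real k) ^ (2 * k)) ^ T"
      by (simp add: power_mult_distrib mult_ac)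
    also have "real k * \<eta> * (1 + real k) ^ (2 * k) = 1 / 2"
      using k1 unfolding \<eta> by (simp add: field_simps)
    finally show "real (card letters ^ T) * (K * \<delta> * (\<eta> * (1 + real k) ^ (2 * k)) ^ T) \<le> K * \<delta> * (1 / 2) ^ T" .
  qed
  also have "\<dots> = K * \<delta> * (\<Sum>T\<in>{..N}. (1 / 2) ^ T)" by (simp add: sum_distrib_left)
  also have "\<dots> \<le> K * \<delta> * 2"
  proof (rule mult_left_mono)
    have "(\<Sum>T\<in>{..N}. (1 / 2 :: real) ^ T) \<le> (\<Sum>T. (1 / 2) ^ T)"
      by (intro sum_le_suminf summable_geometric) auto
    also have "\<dots> = 2" using suminf_geometric[of "1/2 :: real"] by simp
    finally show "(\<Sum>T\<in>{..N}. (1 / 2 :: real) ^ T) \<le> 2" .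
    show "0 \<le> K * \<delta>" using K0 \<delta> by simp
  qed
  finally show ?thesis unfolding K_def by (simp add: mult_ac)
qed

end

section \<open>Breaker's win below the threshold for three or more variables\<close>

lemma breaker_wins_sparse:
  assumes k: "k \<ge> 3" and a: "\<forall>i\<in>{1..k}. a i \<noteq> 0"
  shows "\<exists>c>0. \<forall>p. prob_function p \<longrightarrow>
    (\<forall>\<^sub>F n in sequentially. p n < c * real n powr (- ((real k - 2) / (real k - 1)))) \<longrightarrow>
    whp p (breakers_win (row_matrix k a) (single_vec b))"
proof -
  define \<eta> where "\<eta> = 1 / (2 * real k * (1 + real k) ^ (2 * k))"
  \<comment> \<open>Chosen so that \<open>2 ^ k * c = \<eta> ^ k\<close>, the branching factor
    \<open>\<epsilon>\<close> for which the sum over words converges.\<close>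
  define c where "c = (\<eta> / 2) ^ k"
  have k1: "real k \<ge> 1" using k by simp
  have "1 * 1 \<le> 2 * real k * (1 + real k) ^ (2 * k)"
    using k1 by (intro mult_mono one_le_power) auto
  then have \<eta>: "0 < \<eta>" "\<eta> \<le> 1" unfolding \<eta>_def by (auto simp: divide_le_eq_1)
  have c: "0 < c" "c \<le> 1" using \<eta> unfolding c_def by (auto intro!: power_le_one)
  have "whp p (breakers_win (row_matrix k a) (single_vec b))"
    if p: "prob_function p"
      and small: "\<forall>\<^sub>F n in sequentially. p n < c * real n powr (- ((real k - 2) / (real k - 1)))" for p
  proof (rule whpI)
    define \<delta> where "\<delta> n = real n powr (- (1 / (real k - 1)))" for n
    define K where "K = 2 * (4 ^ k / \<eta> ^ (2 * k + 3))"
    show "(\<lambda>n. K * \<delta> n) \<longlonglongrightarrow> 0"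
    proof -
      have "\<delta> \<longlonglongrightarrow> 0" unfolding \<delta>_def
        using k by (intro tendsto_neg_powr filterlim_real_sequentially) auto
      then show ?thesis by (rule tendsto_mult_right_zero)
    qed
    show "\<forall>\<^sub>F n in sequentially. measure_pmf.prob (random_interval n (p n))
        {X. \<not> breakers_win (row_matrix k a) (single_vec b) X} \<le> K * \<delta> n"
      using small eventually_ge_at_top[of 1]
    proof eventually_elim
      case (elim n)
      have p01: "0 \<le> p n" "p n \<le> 1" using p by (auto simp: prob_function_def)
      note scale = threshold_scale[OF elim(2) k, folded \<delta>_def]
      note \<delta>n = scale(1,2) and n\<delta> = scale(3)
      have pn: "p n \<le> c * \<delta> n ^ (k - 2)" using elim(1) scale(4) by simp
      then have pn1: "p n \<le> \<delta> n ^ (k - 2)"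
        using c \<delta>n by (elim order_trans) (auto intro!: mult_left_le_one_le)
      define S where "S = {xs \<in> solutions k a b. set xs \<subseteq> interval n}"
      have "measure_pmf.prob (random_interval n (p n))
          {X. \<not> breakers_win (row_matrix k a) (single_vec b) X} \<le>
        measure_pmf.prob (random_interval n (p n)) {X. \<exists>w us. us \<in> explored k (interval n) S w \<and>
          excess w \<ge> 2 \<and> closures w \<le> 2 \<and> set us \<subseteq> X}"
      proof (rule prob_random_interval_mono, rule ccontr)
        fix X assume X: "X \<subseteq> interval n" and nb: "\<not> breakers_win (row_matrix k a) (single_vec b) X"
          and nobad: "\<not> (\<exists>w us. us \<in> explored k (interval n) S w \<and> 2 \<le> excess w \<and> closures w \<le> 2 \<and> set us \<subseteq> X)"
        define SX where "SX = {xs \<in> solutions k a b. set xs \<subseteq> X}"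
        have SX: "length xs = k \<and> distinct xs \<and> set xs \<subseteq> X" if "xs \<in> SX" for xs
          using that by (auto simp: SX_def solutions_def)
        have finX: "finite X" using X by (rule finite_subset) simp
        \<comment> \<open>An exploration inside the random set is one of the whole interval whose
          vertices all survive, so the union bound can range over a fixed family.\<close>
        have "SX \<subseteq> S" using X by (auto simp: SX_def S_def)
        then have mono: "explored k X SX w \<subseteq> explored k (interval n) S w" for w
          using X by (intro explored_mono)
        have "\<exists>C D \<P>. reply_certificate SX m C D \<P>" if "m \<in> X" for m
        proof (rule reply_certificate_exists[OF finX k SX _ that])
          fix w us assume "us \<in> explored k X SX w" "2 \<le> excess w" "closures w \<le> 2"
          moreover from this have "set us \<subseteq> X" using explored_props[of SX k X us w] SX by auto
          ultimately show False using nobad mono by blast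
        qed
        then have "breakers_win (row_matrix k a) (single_vec b) X"
          using k by (intro breakers_win_if_certified[OF finX _ SX_def]) auto
        then show False using nb by contradiction
      qed
      also have "\<dots> \<le> 2 * (4 ^ k / \<eta> ^ (2 * k + 3)) * \<delta> n"
      proof (rule prob_bad_exploration[OF k a S_def p01 \<delta>n _ _ _ _ \<eta>_def HOL.refl])
        show "0 \<le> \<eta> ^ k" using \<eta> by simp
        have k1': "\<delta> n ^ (k - 1) = \<delta> n * \<delta> n ^ (k - 2)"
        proof -
          have "k - 1 = Suc (k - 2)" using k by simp
          then show ?thesis by (simp only: power_Suc)
        qed
        have "real n * p n \<le> real n * \<delta> n ^ (k - 2)" using pn1 by (intro mult_left_mono) auto
        also have "\<dots> = 1 / \<delta> n" using n\<delta> k1' \<delta>n by (simp add: field_simps)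
        finally show "real n * p n \<le> 1 / \<delta> n" .
        have "2 ^ k * real n ^ (k - 2) * p n ^ (k - 1) \<le> 2 ^ k * real n ^ (k - 2) * (c * \<delta> n ^ (k - 2)) ^ (k - 1)"
          using pn p01 by (intro mult_left_mono power_mono) auto
        also have "\<dots> = 2 ^ k * c ^ (k - 1) * (real n ^ (k - 1 - 1) * (\<delta> n ^ (k - 2)) ^ (k - 1))"
          by (simp add: power_mult_distrib mult_ac numeral_2_eq_2)
        also have "\<dots> = 2 ^ k * c ^ (k - 1)" using scaled_power_identity[OF n\<delta>, of 1] k by simp
        also have "\<dots> \<le> 2 ^ k * c ^ 1" using c k by (intro mult_left_mono power_decreasing) auto
        also have "\<dots> = \<eta> ^ k" by (simp add: c_def power_divide)
        finally show "2 ^ k * real n ^ (k - 2) * p n ^ (k - 1) \<le> \<eta> ^ k" .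
        fix j assume j: "2 \<le> j" "j < k"
        have "real n ^ (k - 1 - j) * p n ^ (k - j) \<le> real n ^ (k - 1 - j) * (\<delta> n ^ (k - 2)) ^ (k - j)"
          using pn1 p01 by (intro mult_left_mono power_mono) auto
        then show "real n ^ (k - 1 - j) * p n ^ (k - j) \<le> \<delta> n ^ (j - 1)"
          using scaled_power_identity[OF n\<delta>, of j] j by simp
      qed
      finally show ?case by (simp add: K_def)
    qed
  qed
  then show ?thesis using c(1) by blast
qed

section \<open>Small cases and two variables\<close>

text \<open>With one sign nothing cancels, so a solution in positive integers has all entries at
  most \<open>\<bar>b\<bar>\<close>. The random set misses these boundedly many numbers with
  probability tending to 1, and then contains no solution.\<close>

lemma breaker_wins_one_sign:
  assumes k: "k \<ge> 1" and sgn: "(\<forall>i\<in>{1..k}. a i > 0) \<or> (\<forall>i\<in>{1..k}. a i < 0)"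
    and p: "prob_function p" "p \<longlonglongrightarrow> 0"
  shows "whp p (breakers_win (row_matrix k a) (single_vec b))"
proof (rule whpI)
  have bound: "x \<le> \<bar>b\<bar>" if xs: "xs \<in> solutions k a b" "\<forall>y\<in>set xs. 0 < y" "x \<in> set xs" for xs x
  proof -
    have len: "length xs = k" and s: "(\<Sum>j<k. a (Suc j) * xs ! j) = b"
      using xs(1) by (auto simp: solutions_def)
    obtain i where i: "i < k" "xs ! i = x" using xs(3) len by (auto simp: in_set_conv_nth)
    have pos: "0 < xs ! j" if "j < k" for j using that xs(2) len by simp
    have "Suc i \<in> {1..k}" using i(1) by simp
    then have "a (Suc i) \<noteq> 0" using sgn by (metis less_irrefl)
    then have "1 \<le> \<bar>a (Suc i)\<bar>" by simp
    then have "x \<le> \<bar>a (Suc i)\<bar> * x"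
      using pos[OF i(1)] i(2) mult_right_mono[of 1 "\<bar>a (Suc i)\<bar>" x] by simp
    also have "\<dots> \<le> (\<Sum>j<k. \<bar>a (Suc j)\<bar> * xs ! j)"
      using i pos member_le_sum[of i "{..<k}" "\<lambda>j. \<bar>a (Suc j)\<bar> * xs ! j"] by (auto simp: less_imp_le)
    also have "\<dots> = \<bar>b\<bar>"
      using sgn
    proof
      assume "\<forall>i\<in>{1..k}. a i > 0"
      then have pa: "0 < a (Suc j)" if "j < k" for j using that by simp
      then have "(\<Sum>j<k. \<bar>a (Suc j)\<bar> * xs ! j) = (\<Sum>j<k. a (Suc j) * xs ! j)"
        by (intro sum.cong) (simp_all add: less_imp_le)
      moreover have "0 \<le> (\<Sum>j<k. a (Suc j) * xs ! j)"
        using pos pa by (intro sum_nonneg) (simp add: less_imp_le)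
      ultimately show ?thesis using s by simp
    next
      assume "\<forall>i\<in>{1..k}. a i < 0"
      then have na: "a (Suc j) < 0" if "j < k" for j using that by simp
      then have "(\<Sum>j<k. \<bar>a (Suc j)\<bar> * xs ! j) = (\<Sum>j<k. - (a (Suc j) * xs ! j))"
        by (intro sum.cong) (simp_all add: abs_of_neg)
      moreover have "(\<Sum>j<k. a (Suc j) * xs ! j) \<le> 0"
        using pos na by (intro sum_nonpos) (simp add: mult_nonpos_nonneg less_imp_le)
      ultimately show ?thesis using s by (simp add: sum_negf)
    qed
    finally show ?thesis .
  qed
  show "(\<lambda>n. real (nat \<bar>b\<bar>) * p n) \<longlonglongrightarrow> 0"
    using p(2) by (rule tendsto_mult_right_zero)
  show "\<forall>\<^sub>F n in sequentially. measure_pmf.prob (random_interval n (p n))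
      {X. \<not> breakers_win (row_matrix k a) (single_vec b) X} \<le> real (nat \<bar>b\<bar>) * p n"
  proof (rule always_eventually, rule allI)
    fix n
    have p01: "0 \<le> p n" "p n \<le> 1" using p(1) by (auto simp: prob_function_def)
    define I where "I = {1..\<bar>b\<bar>} \<inter> interval n"
    have "measure_pmf.prob (random_interval n (p n))
        {X. \<not> breakers_win (row_matrix k a) (single_vec b) X} \<le>
      measure_pmf.prob (random_interval n (p n)) {X. \<exists>s\<in>I. {s} \<subseteq> X}"
    proof (rule prob_random_interval_mono, rule ccontr)
      fix X assume X: "X \<subseteq> interval n" "\<not> breakers_win (row_matrix k a) (single_vec b) X"
        "\<not> (\<exists>s\<in>I. {s} \<subseteq> X)"
      have "breakers_win (row_matrix k a) (single_vec b) X"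
      proof (rule breakers_win_if_no_solution)
        show "finite X" using X(1) by (rule finite_subset) simp
        show "\<not> set xs \<subseteq> X" if xs: "xs \<in> solutions k a b" for xs
        proof
          assume sub: "set xs \<subseteq> X"
          have "xs \<noteq> []" using xs k by (auto simp: solutions_def)
          then have h: "hd xs \<in> set xs" by simp
          have pos: "\<forall>y\<in>set xs. 0 < y" using sub X(1) by (auto simp: interval_def)
          then have "hd xs \<in> I"
            using bound[OF xs pos h] h sub X(1) by (force simp: I_def interval_def)
          then show False using X(3) h sub by auto
        qed
      qed
      then show False using X(2) by contradiction
    qed
    also have "\<dots> \<le> (\<Sum>s\<in>I. p n ^ card {s})"
      using p01 by (intro prob_ex_subset_random_interval) (auto simp: I_def)
    also have "\<dots> = real (card I) * p n" by simp
    also have "\<dots> \<le> real (nat \<bar>b\<bar>) * p n"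
    proof (rule mult_right_mono)
      have "card I \<le> card {1..\<bar>b\<bar>}" unfolding I_def by (intro card_mono) auto
      then show "real (card I) \<le> real (nat \<bar>b\<bar>)" by simp
    qed (rule p01)
    finally show "measure_pmf.prob (random_interval n (p n))
        {X. \<not> breakers_win (row_matrix k a) (single_vec b) X} \<le> real (nat \<bar>b\<bar>) * p n" .
  qed
qed

text \<open>Mixed signs give a positive kernel vector \<open>y\<close>, but with only two values.
  Adding a large multiple of it to a kernel vector \<open>w\<close> with distinct entries makes all
  entries positive and distinct. So under mixed signs a matrix that is not irredundant must have
  \<open>k = 2\<close>.\<close>

lemma irredundant_if_mixed_signs:
  assumes k: "k \<ge> 3" and a: "\<forall>i\<in>{1..k}. a i \<noteq> 0"
    and mixed: "\<exists>i\<in>{1..k}. a i > 0" "\<exists>i\<in>{1..k}. a i < 0"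
  shows "irredundant (row_matrix k a)"
proof -
  define c where "c j = a (Suc j)" for j
  have c0: "c j \<noteq> 0" if "j < k" for j using a that by (simp add: c_def)
  have "\<exists>j<k. c j > 0" "\<exists>j<k. c j < 0"
    using mixed unfolding c_def
    by (metis Suc_le_D Suc_le_lessD One_nat_def atLeastAtMost_iff)+
  then obtain jp jn where j: "jp < k" "c jp > 0" "jn < k" "c jn < 0" by blast
  define SP where "SP = (\<Sum>j\<in>{j\<in>{..<k}. c j > 0}. c j)"
  define SN where "SN = (\<Sum>j\<in>{j\<in>{..<k}. \<not> c j > 0}. - c j)"
  have SP: "SP > 0" unfolding SP_def using j by (intro sum_pos) auto
  have SN: "SN > 0" unfolding SN_def
  proof (rule sum_pos)
    show "{j \<in> {..<k}. \<not> 0 < c j} \<noteq> {}" using j(3,4) by auto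
    show "0 < - c i" if "i \<in> {j \<in> {..<k}. \<not> 0 < c j}" for i
      using that c0[of i] by auto
  qed simp
  define y where "y j = (if c j > 0 then SN else SP)" for j
  have y1: "y j \<ge> 1" for j using SP SN by (auto simp: y_def)
  have y_sum: "(\<Sum>j<k. c j * y j) = 0"
  proof -
    have "{..<k} = {j\<in>{..<k}. c j > 0} \<union> {j\<in>{..<k}. \<not> c j > 0}" by auto
    then have "(\<Sum>j<k. c j * y j) =
        (\<Sum>j\<in>{j\<in>{..<k}. c j > 0} \<union> {j\<in>{..<k}. \<not> c j > 0}. c j * y j)"
      by (rule arg_cong[where f = "sum (\<lambda>j. c j * y j)"])
    also have "\<dots> = (\<Sum>j\<in>{j\<in>{..<k}. c j > 0}. c j * y j) + (\<Sum>j\<in>{j\<in>{..<k}. \<not> c j > 0}. c j * y j)"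
      by (rule sum.union_disjoint) auto
    also have "(\<Sum>j\<in>{j\<in>{..<k}. c j > 0}. c j * y j) = SP * SN"
      unfolding SP_def sum_distrib_right by (intro sum.cong) (auto simp: y_def)
    also have "(\<Sum>j\<in>{j\<in>{..<k}. \<not> c j > 0}. c j * y j) = - (SN * SP)"
      unfolding SN_def sum_distrib_right sum_negf[symmetric] by (intro sum.cong) (auto simp: y_def)
    finally show ?thesis by simp
  qed
  \<comment> \<open>For \<open>i < k - 1\<close> the zeros of the polynomial \<open>q i\<close> are
    the values of \<open>s\<close> at which entries \<open>i\<close> and \<open>k - 1\<close> of the
    vector \<open>w\<close> below coincide; all but finitely many \<open>s\<close> avoid
    them.\<close>
  define d where "d i l = c l + (if l = i then c (k - 1) else 0)" for i l
  define q where "q i = (\<Sum>l<k - 1. monom (d i l) l)" for i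
  have q_coeff: "coeff (q i) l = (if l < k - 1 then d i l else 0)" for i l
    unfolding q_def coeff_sum coeff_monom by simp
  have q0: "q i \<noteq> 0" for i
  proof -
    \<comment> \<open>\<open>k \<ge> 3\<close> provides an exponent \<open>l \<noteq> i\<close>
      below \<open>k - 1\<close>, whose coefficient is \<open>c l \<noteq> 0\<close>.\<close>
    define l where "l = (if i = 0 then 1 else 0 :: nat)"
    have "coeff (q i) l \<noteq> 0" using k c0[of l] by (auto simp: q_coeff l_def d_def)
    then show ?thesis by auto
  qed
  have "finite (\<Union>i<k. {s. poly (q i) s = 0})" using q0 by (auto intro!: poly_roots_finite)
  moreover have "infinite {2 :: int..}" by (rule infinite_Ici)
  ultimately have "infinite ({2..} - (\<Union>i<k. {s. poly (q i) s = 0}))" by (rule Diff_infinite_finite)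
  then have "{2..} - (\<Union>i<k. {s. poly (q i) s = 0}) \<noteq> {}" by (metis finite.emptyI)
  then obtain s where s: "s \<ge> 2" "\<And>i. i < k \<Longrightarrow> poly (q i) s \<noteq> 0" by auto
  have poly_q: "poly (q i) s = (\<Sum>l<k - 1. c l * s ^ l) + c (k - 1) * s ^ i" if "i < k - 1" for i
  proof -
    have "poly (q i) s = (\<Sum>l<k - 1. c l * s ^ l + (if l = i then c (k - 1) * s ^ i else 0))"
      unfolding q_def poly_sum poly_monom by (intro sum.cong) (auto simp: d_def algebra_simps)
    then show ?thesis using that by (simp add: sum.distrib)
  qed
  \<comment> \<open>Multiples of distinct powers of \<open>s\<close>, with the last entry dictated
    by the homogeneous equation; the factor \<open>c (k - 1)\<close> keeps that entry
    integral.\<close>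
  define w where "w j = (if j < k - 1 then c (k - 1) * s ^ j else - (\<Sum>l<k - 1. c l * s ^ l))" for j
  have kk: "{..<k} = insert (k - 1) {..<k - 1}" using k by auto
  have w_sum: "(\<Sum>j<k. c j * w j) = 0"
    unfolding kk by (simp add: w_def sum_distrib_left mult_ac)
  have w_inj: "w i \<noteq> w j" if "i < j" "j < k" for i j
  proof (cases "j < k - 1")
    case True
    then show ?thesis using that s(1) c0[of "k - 1"] by (auto simp: w_def)
  next
    case False
    then have "poly (q i) s = w i - w j" using that poly_q[of i] by (simp add: w_def)
    then show ?thesis using s(2)[of i] that by auto
  qed
  \<comment> \<open>Entries with different \<open>y\<close> are at least \<open>M\<close> apart
    before \<open>w\<close> is added, more than \<open>w\<close> can undo; entries with equal
    \<open>y\<close> are separated by \<open>w\<close> itself.\<close>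
  define M where "M = 1 + 2 * (\<Sum>j<k. \<bar>w j\<bar>)"
  have wM: "2 * \<bar>w j\<bar> < M" if "j < k" for j
    using member_le_sum[of j "{..<k}" "\<lambda>j. \<bar>w j\<bar>"] that by (auto simp: M_def)
  define x where "x j = M * y j + w j" for j
  have x_pos: "x j > 0" if "j < k" for j
  proof -
    have "M * 1 \<le> M * y j" using y1 wM[OF that] by (intro mult_left_mono) auto
    then show ?thesis using wM[OF that] unfolding x_def by linarith
  qed
  have x_inj: "x i \<noteq> x j" if ij: "i < j" "j < k" for i j
  proof (cases "y i = y j")
    case True
    then show ?thesis using w_inj[OF ij] by (simp add: x_def)
  next
    case False
    have M: "2 * \<bar>w i\<bar> < M" "2 * \<bar>w j\<bar> < M" using wM ij by auto
    have "M * 1 \<le> M * \<bar>y i - y j\<bar>" using False M by (intro mult_left_mono) auto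
    also have "\<dots> = \<bar>M * y i - M * y j\<bar>" using M by (simp add: abs_mult right_diff_distrib[symmetric])
    finally show ?thesis using M unfolding x_def by linarith
  qed
  have nth: "map x [0..<k] ! j = x j" if "j < k" for j using that by simp
  have "(\<Sum>j<k. a (Suc j) * map x [0..<k] ! j) = (\<Sum>j<k. M * (c j * y j) + c j * w j)"
    by (intro sum.cong) (auto simp: c_def x_def algebra_simps)
  also have "\<dots> = 0" using y_sum w_sum by (simp add: sum.distrib sum_distrib_left[symmetric])
  finally have "map x [0..<k] \<in> solutions k a 0"
    using x_inj unfolding solutions_def
    by (auto simp: distinct_map inj_on_def) (metis linorder_neqE_nat)
  moreover have "\<forall>z\<in>set (map x [0..<k]). z > 0" using x_pos by auto
  ultimately show ?thesis unfolding irredundant_iff by blast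
qed

section \<open>Two variables\<close>

lemma solutions_2: "xs \<in> solutions 2 a b \<longleftrightarrow> (\<exists>x y. xs = [x, y] \<and> x \<noteq> y \<and> a 1 * x + a 2 * y = b)"
proof
  assume xs: "xs \<in> solutions 2 a b"
  then obtain x y where "xs = [x, y]" by (auto simp: solutions_def numeral_2_eq_2 length_Suc_conv)
  then show "\<exists>x y. xs = [x, y] \<and> x \<noteq> y \<and> a 1 * x + a 2 * y = b"
    using xs by (auto simp: solutions_def numeral_2_eq_2)
qed (auto simp: solutions_def numeral_2_eq_2)

lemma powr_third_cube:
  assumes "n \<ge> 1"
  shows "(p / real n powr (- 1 / 3)) ^ 3 = real n * p ^ 3"
proof -
  have "(real n powr (- 1 / 3)) ^ 3 = real n powr (- 1)"
    using assms by (subst powr_power) auto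
  then show ?thesis using assms by (simp add: powr_minus field_simps)
qed

text \<open>A two-edge path is determined by its middle vertex \<open>y\<close>, so there are at
  most n of them, and the expected number in the random set is at most n p^3. Without such a path
  distinct edges are disjoint, and Breaker claims the other end of any edge that Maker
  touches.\<close>

lemma breaker_wins_two_variables:
  assumes a: "a 1 \<noteq> 0" "a 2 \<noteq> 0"
    and p: "prob_function p" "p \<lless> (\<lambda>n. real n powr (- 1 / 3))"
  shows "whp p (breakers_win (row_matrix 2 a) (single_vec b))"
proof (rule whpI)
  have "(\<lambda>n. (p n / real n powr (- 1 / 3)) ^ 3) \<longlonglongrightarrow> 0 ^ 3"
    using p(2) unfolding much_less_def by (rule tendsto_power)
  then show "(\<lambda>n. (p n / real n powr (- 1 / 3)) ^ 3) \<longlonglongrightarrow> 0" by simp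
  show "\<forall>\<^sub>F n in sequentially. measure_pmf.prob (random_interval n (p n))
      {X. \<not> breakers_win (row_matrix 2 a) (single_vec b) X} \<le> (p n / real n powr (- 1 / 3)) ^ 3"
    using eventually_ge_at_top[of 1]
  proof eventually_elim
    case (elim n)
    have p01: "0 \<le> p n" "p n \<le> 1" using p(1) by (auto simp: prob_function_def)
    define I where "I = {(u, y, w). u \<in> interval n \<and> y \<in> interval n \<and> w \<in> interval n \<and>
      card {u, y, w} = 3 \<and> a 1 * u + a 2 * y = b \<and> a 1 * y + a 2 * w = b}"
    define f where "f = (\<lambda>(u :: int, y, w). {u, y, w})"
    have "I \<subseteq> interval n \<times> interval n \<times> interval n" by (auto simp: I_def)
    then have finI: "finite I" by (rule finite_subset) simp
    have "inj_on (\<lambda>(u, y, w). y) I"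
    proof (rule inj_onI)
      fix s t assume "s \<in> I" "t \<in> I" and eq: "(case s of (u, y, w) \<Rightarrow> y) = (case t of (u, y, w) \<Rightarrow> y)"
      moreover obtain u y w u' y' w' where st: "s = (u, y, w)" "t = (u', y', w')"
        by (cases s, cases t) blast
      ultimately have "a 1 * u + a 2 * y = b" "a 1 * y + a 2 * w = b"
        "a 1 * u' + a 2 * y = b" "a 1 * y + a 2 * w' = b" unfolding I_def by auto
      then have "a 1 * u = a 1 * u'" "a 2 * w = a 2 * w'" by linarith+
      then show "s = t" using a eq st by simp
    qed
    moreover have "(\<lambda>(u, y, w). y) ` I \<subseteq> interval n" by (auto simp: I_def)
    ultimately have cardI: "card I \<le> n" using card_inj_on_le[of _ I "interval n"] by simp
    have "measure_pmf.prob (random_interval n (p n))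
        {X. \<not> breakers_win (row_matrix 2 a) (single_vec b) X} \<le>
      measure_pmf.prob (random_interval n (p n)) {X. \<exists>s\<in>I. f s \<subseteq> X}"
    proof (rule prob_random_interval_mono, rule ccontr)
      fix X assume X: "X \<subseteq> interval n" "\<not> breakers_win (row_matrix 2 a) (single_vec b) X"
        "\<not> (\<exists>s\<in>I. f s \<subseteq> X)"
      define S where "S = {xs \<in> solutions 2 a b. set xs \<subseteq> X}"
      have finX: "finite X" using X(1) by (rule finite_subset) simp
      have nopath: "u = w" if "u \<in> X" "y \<in> X" "w \<in> X" "u \<noteq> y" "y \<noteq> w"
          "a 1 * u + a 2 * y = b" "a 1 * y + a 2 * w = b" for u y w
      proof (rule ccontr)
        assume "u \<noteq> w"
        then have "card {u, y, w} = 3" using that by simp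
        then have "(u, y, w) \<in> I" using that X(1) unfolding I_def by auto
        then show False using X(3) that by (force simp: f_def)
      qed
      have same: "set xs = set ys" if xs: "xs \<in> S" and ys: "ys \<in> S" and "set xs \<inter> set ys \<noteq> {}" for xs ys
      proof -
        obtain x1 x2 where x: "xs = [x1, x2]" "x1 \<noteq> x2" "a 1 * x1 + a 2 * x2 = b" "x1 \<in> X" "x2 \<in> X"
          using xs by (auto simp: S_def solutions_2)
        obtain y1 y2 where y: "ys = [y1, y2]" "y1 \<noteq> y2" "a 1 * y1 + a 2 * y2 = b" "y1 \<in> X" "y2 \<in> X"
          using ys by (auto simp: S_def solutions_2)
        have "x1 = y1 \<or> x2 = y2 \<or> x1 = y2 \<or> x2 = y1" using that(3) unfolding x(1) y(1) by auto
        \<comment> \<open>A common element in equal positions forces the same solution. In opposite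
          positions the two edges would form a path, so by \<open>nopath\<close> one is the reversal
          of the other.\<close>
        then consider "x1 = y1" | "x2 = y2" | "x1 = y2" | "x2 = y1" by blast
        then show ?thesis
        proof cases
          case 1
          then have "a 2 * x2 = a 2 * y2" using x(3) y(3) by (metis add_left_cancel)
          then show ?thesis using 1 a x(1) y(1) by simp
        next
          case 2
          then have "a 1 * x1 = a 1 * y1" using x(3) y(3) by (metis add_right_cancel)
          then show ?thesis using 2 a x(1) y(1) by simp
        next
          case 3
          then have "y1 = x2" using nopath[of y1 x1 x2] x y by simp
          then show ?thesis using 3 x(1) y(1) by auto
        next
          case 4
          then have "x1 = y2" using nopath[of x1 x2 y2] x y by simp
          then show ?thesis using 4 x(1) y(1) by auto
        qed
      qed
      have "\<exists>C D \<P>. reply_certificate S m C D \<P>" if m: "m \<in> X" for m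
      proof (cases "\<exists>xs\<in>S. m \<in> set xs")
        case True
        then obtain xs where xs: "xs \<in> S" "m \<in> set xs" by blast
        then obtain z where z: "set xs = {m, z}" "z \<noteq> m"
        proof -
          obtain x1 x2 where "set xs = {x1, x2}" "x1 \<noteq> x2" using xs(1) by (auto simp: S_def solutions_2)
          then show thesis using that[of x1] that[of x2] xs(2) by (auto simp: insert_commute)
        qed
        have "edge_closed S (set xs)"
          unfolding edge_closed_def using same[OF _ xs(1)] by auto
        then have "reply_certificate S m (set xs) {z} {}"
          unfolding reply_certificate_def
        proof (intro conjI allI impI ballI)
          show "set xs \<subseteq> R" if "edge_closed S R \<and> m \<in> R" for R
            using that xs unfolding edge_closed_def by auto
          fix ys assume ys: "ys \<in> S" "set ys \<subseteq> set xs"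
          have "set ys \<inter> set xs \<noteq> {}" using ys by (auto simp: S_def solutions_2)
          then show "set ys \<inter> {z} \<noteq> {} \<or> (\<exists>P\<in>{}. P \<subseteq> set ys)"
            using same[OF ys(1) xs(1)] z by auto
        qed (use xs z in \<open>auto simp: pairing_def\<close>)
        then show ?thesis by blast
      next
        case False
        have "reply_certificate S m {m} {} {}"
          unfolding reply_certificate_def
        proof (intro conjI allI impI ballI)
          fix ys assume ys: "ys \<in> S" "set ys \<subseteq> {m}"
          moreover have "set ys \<noteq> {}" using ys(1) by (auto simp: S_def solutions_2)
          ultimately have "set ys = {m}" by (metis subset_singletonD)
          then have "m \<in> set ys" by simp
          then show "set ys \<inter> {} \<noteq> {} \<or> (\<exists>P\<in>{}. P \<subseteq> set ys)" using False ys(1) by blast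
        qed (use False in \<open>auto simp: pairing_def edge_closed_def\<close>)
        then show ?thesis by blast
      qed
      then have "breakers_win (row_matrix 2 a) (single_vec b) X"
        by (intro breakers_win_if_certified[OF finX _ S_def]) auto
      then show False using X(2) by contradiction
    qed
    also have "\<dots> \<le> (\<Sum>s\<in>I. p n ^ card (f s))"
      using p01 by (intro prob_ex_subset_random_interval finI) (auto simp: I_def f_def)
    also have "\<dots> = (\<Sum>s\<in>I. p n ^ 3)" by (intro sum.cong) (auto simp: I_def f_def)
    also have "\<dots> = real (card I) * p n ^ 3" by simp
    also have "\<dots> \<le> real n * p n ^ 3" using cardI p01 by (intro mult_right_mono) auto
    finally show ?case using powr_third_cube[OF elim] by simp
  qed
qed

text \<open>The first entries of integer solutions form a class modulo \<beta>, the second entries a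
  class modulo \<alpha>, where \<alpha> and \<beta> are \<open>a1\<close> and \<open>a2\<close>
  divided by their gcd. Coprimality makes the two classes meet, and a common element is the middle
  vertex \<open>y\<close>.\<close>

lemma two_step_path:
  fixes a1 a2 b :: int
  assumes a: "a1 \<noteq> 0" "a2 \<noteq> 0" and sol: "a1 * x + a2 * z = b"
  obtains u y w where "a1 * u + a2 * y = b" "a1 * y + a2 * w = b"
proof -
  define g where "g = gcd a1 a2"
  have g: "g \<noteq> 0" using a by (simp add: g_def)
  define \<alpha> \<beta> where "\<alpha> = a1 div g" and "\<beta> = a2 div g"
  have ab: "a1 = g * \<alpha>" "a2 = g * \<beta>" by (simp_all add: \<alpha>_def \<beta>_def g_def)
  have "coprime \<alpha> \<beta>" unfolding \<alpha>_def \<beta>_def g_def using a by (intro div_gcd_coprime) auto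
  then obtain r0 s0 where "s0 * \<alpha> + r0 * \<beta> = 1" using bezout_int[of \<alpha> \<beta>] by (metis coprime_iff_gcd_eq_1)
  then have "(z - x) * (s0 * \<alpha> + r0 * \<beta>) = z - x" by simp
  then have eq: "x + \<beta> * ((z - x) * r0) = z - \<alpha> * ((z - x) * s0)" by (simp add: algebra_simps)
  define r where "r = (z - x) * r0"
  define s where "s = (z - x) * s0"
  have eq': "x + \<beta> * r = z - \<alpha> * s" using eq by (simp add: r_def s_def)
  show thesis
  proof (rule that[of "x + \<beta> * s" "x + \<beta> * r" "z - \<alpha> * r"])
    show "a1 * (x + \<beta> * r) + a2 * (z - \<alpha> * r) = b" using sol by (simp add: ab algebra_simps)
    show "a1 * (x + \<beta> * s) + a2 * (x + \<beta> * r) = b"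
      unfolding eq' using sol by (simp add: ab algebra_simps)
  qed
qed

text \<open>Two-edge paths are arranged in a progression indexed by \<open>t\<close>, with a number
  of members in the interval that is linear in n. The expected number of surviving paths is of order
  n p^3, and the second moment method makes one appear.\<close>

lemma maker_wins_two_variables:
  assumes opp: "a 1 * a 2 < 0" and irr: "irredundant_pair (row_matrix 2 a) (single_vec b)"
    and p: "prob_function p" "p \<ggreater> (\<lambda>n. real n powr (- 1 / 3))"
  shows "whp p (makers_win (row_matrix 2 a) (single_vec b))"
proof -
  have a: "a 1 \<noteq> 0" "a 2 \<noteq> 0" using opp by auto
  obtain x z where xz: "x \<noteq> z" "a 1 * x + a 2 * z = b"
  proof -
    obtain xs where "xs \<in> solutions 2 a b" using irr unfolding irredundant_pair_iff by auto
    then show thesis using that solutions_2[of xs a b] by auto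
  qed
  obtain u y w where uyw: "a 1 * u + a 2 * y = b" "a 1 * y + a 2 * w = b"
    by (rule two_step_path[OF a xz(2)])
  define c where "c i = (if i = 0 then u else if i = 1 then y else w)" for i :: nat
  \<comment> \<open>This direction solves the homogeneous versions of both path equations; since
    \<open>a 1 * a 2 < 0\<close>, its three entries are positive.\<close>
  define s where "s i = (if i = 0 then (a 2)\<^sup>2 else if i = 1 then - (a 1 * a 2) else (a 1)\<^sup>2)" for i :: nat
  define h where "h i t = c i + s i * int t" for i t
  have s_pos: "s i > 0" for i using a opp by (auto simp: s_def)
  have h_inj: "h i t = h i t' \<Longrightarrow> t = t'" for i t t' using s_pos[of i] by (simp add: h_def)
  have path: "a 1 * h 0 t + a 2 * h 1 t = b" "a 1 * h 1 t + a 2 * h 2 t = b" for t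
    using uyw by (auto simp: h_def c_def s_def algebra_simps power2_eq_square)
  \<comment> \<open>If \<open>a 1 = - a 2\<close>, all three vertices move at the same speed and
    must differ in their constants; this rests on \<open>b \<noteq> 0\<close>, which follows from
    \<open>x \<noteq> z\<close>. Otherwise the three speeds are distinct.\<close>
  have nonconst: "c i \<noteq> c j \<or> s i \<noteq> s j" if ij: "i < j" "j < 3" for i j
  proof (cases "a 1 = - a 2")
    case True
    have "b \<noteq> 0"
    proof
      assume "b = 0"
      then have "a 2 * (z - x) = 0" using xz(2) True by (simp add: algebra_simps)
      then show False using a xz(1) by simp
    qed
    moreover have "a 2 * (y - u) = b" "a 2 * (w - y) = b" using uyw True by (simp_all add: algebra_simps)
    moreover from this have "a 2 * (w - u) = 2 * b" by (simp add: algebra_simps)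
    ultimately have "u \<noteq> y" "y \<noteq> w" "u \<noteq> w" by auto
    moreover have "(i = 0 \<and> j = 1) \<or> (i = 0 \<and> j = 2) \<or> (i = 1 \<and> j = 2)" using ij by linarith
    ultimately show ?thesis by (auto simp: c_def)
  next
    case False
    then have ne: "a 1 + a 2 \<noteq> 0" by simp
    have "(a 2)\<^sup>2 - - (a 1 * a 2) = a 2 * (a 1 + a 2)" by (simp add: algebra_simps power2_eq_square)
    then have "(a 2)\<^sup>2 \<noteq> - (a 1 * a 2)" using a ne by (metis diff_self mult_eq_0_iff)
    moreover have "(a 1)\<^sup>2 - - (a 1 * a 2) = a 1 * (a 1 + a 2)" by (simp add: algebra_simps power2_eq_square)
    then have "(a 1)\<^sup>2 \<noteq> - (a 1 * a 2)" using a ne by (metis diff_self mult_eq_0_iff)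
    moreover have "(a 2)\<^sup>2 \<noteq> (a 1)\<^sup>2" using opp ne by (auto simp: power2_eq_iff)
    moreover have "(i = 0 \<and> j = 1) \<or> (i = 0 \<and> j = 2) \<or> (i = 1 \<and> j = 2)" using ij by linarith
    ultimately show ?thesis by (auto simp: s_def)
  qed
  define B where "B = \<bar>u\<bar> + \<bar>y\<bar> + \<bar>w\<bar>"
  define \<sigma> where "\<sigma> = (a 2)\<^sup>2 + (a 1)\<^sup>2 - a 1 * a 2"
  have cB: "\<bar>c i\<bar> \<le> B" for i by (auto simp: c_def B_def)
  have s\<sigma>: "s i \<le> \<sigma>" for i
  proof -
    have "0 \<le> (a 1)\<^sup>2" "0 \<le> (a 2)\<^sup>2" by simp_all
    moreover have "s i = (a 2)\<^sup>2 \<or> s i = - (a 1 * a 2) \<or> s i = (a 1)\<^sup>2" by (auto simp: s_def)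
    ultimately show ?thesis using opp unfolding \<sigma>_def by linarith
  qed
  have \<sigma>: "\<sigma> > 0" using s\<sigma>[of 0] s_pos[of 0] by simp
  \<comment> \<open>Speeds and their non-zero differences are at least 1 in absolute value,
    constants at most \<open>B\<close> and their differences at most \<open>2 * B\<close>; from
    \<open>T0\<close> on the three vertices are positive and distinct.\<close>
  define T0 where "T0 = nat (2 * B + 1)"
  have T0: "int T0 = 2 * B + 1" unfolding T0_def B_def by simp
  have h_pos: "h i t > 0" if "t \<ge> T0" for i t
  proof -
    have "1 * int t \<le> s i * int t" using s_pos[of i] by (intro mult_right_mono) auto
    then show ?thesis using that T0 cB[of i] unfolding h_def by linarith
  qed
  have h_ne: "h i t \<noteq> h j t" if "t \<ge> T0" "i < j" "j < 3" for i j t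
  proof
    assume "h i t = h j t"
    then have eq: "c i - c j = (s j - s i) * int t" by (simp add: h_def algebra_simps)
    then have "s i \<noteq> s j" using nonconst[OF that(2,3)] by auto
    then have "1 * int t \<le> \<bar>s j - s i\<bar> * int t" by (intro mult_right_mono) auto
    also have "\<dots> = \<bar>c i - c j\<bar>" unfolding eq by (simp add: abs_mult)
    finally show False using that(1) T0 cB[of i] cB[of j] by linarith
  qed
  have h_le: "h i t \<le> B + \<sigma> * int t" for i t
  proof -
    have "s i * int t \<le> \<sigma> * int t" using s\<sigma> by (intro mult_right_mono) auto
    then show ?thesis using cB[of i] unfolding h_def by linarith
  qed
  define f where "f t = (\<lambda>i. h i t) ` {..<3}" for t
  have card_f: "card (f t) = 3" if "t \<ge> T0" for t
  proof -
    have "inj_on (\<lambda>i. h i t) {..<3}"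
      using h_ne[OF that] by (intro inj_onI) (metis lessThan_iff linorder_neqE_nat)
    then show ?thesis unfolding f_def by (simp add: card_image)
  qed
  have win: "makers_win (row_matrix 2 a) (single_vec b) X"
    if X: "finite X" "f t \<subseteq> X" and t: "t \<ge> T0" for X t
  proof -
    have ne: "h 0 t \<noteq> h 1 t" "h 1 t \<noteq> h 2 t" "h 0 t \<noteq> h 2 t" using h_ne[OF t] by auto
    have inX: "h 0 t \<in> X" "h 1 t \<in> X" "h 2 t \<in> X" using X(2) unfolding f_def by auto
    let ?I = "{[h 0 t, h 1 t], [h 1 t, h 2 t]}"
    have int: "set [h 0 t, h 1 t] \<inter> set [h 1 t, h 2 t] = {h 1 t}"
      "set [h 1 t, h 2 t] \<inter> set [h 0 t, h 1 t] = {h 1 t}" using ne by auto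
    show ?thesis
    proof (rule makers_win_if_many_solutions[OF X(1), of ?I])
      show "xs \<in> solutions 2 a b \<and> set xs \<subseteq> X" if "xs \<in> ?I" for xs
        using that path[of t] ne inX by (auto simp: solutions_2)
      show "card (set xs \<inter> set ys) \<le> 1" if "xs \<in> ?I" "ys \<in> ?I" "xs \<noteq> ys" for xs ys
      proof -
        have "set xs \<inter> set ys = {h 1 t}" using that int by auto
        then show ?thesis by simp
      qed
      have "\<Union> (set ` ?I) = {h 0 t, h 1 t, h 2 t}" by auto
      then have "card (\<Union> (set ` ?I)) = 3" using ne by simp
      moreover have "card ?I = 2" using ne by simp
      \<comment> \<open>The bound reads 3/8 < 2/4: a path with two edges already meets the criterion
        for linear hypergraphs.\<close>
      ultimately show "real (card (\<Union> (set ` ?I))) / 8 < real (card ?I) / 2 ^ 2" by simp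
    qed simp
  qed
  define r where "r n = p n / real n powr (- 1 / 3)" for n
  show ?thesis
  proof (rule whpI)
    \<comment> \<open>The constant is 4 * 9 from the second moment, with at most
      \<open>9 * m\<close> intersecting pairs of paths, times \<open>2 * \<sigma>\<close> from
      \<open>n \<le> 2 * \<sigma> * m\<close>.\<close>
    show "(\<lambda>n. 72 * of_int \<sigma> / r n ^ 3) \<longlonglongrightarrow> 0"
    proof (rule tendsto_divide_0[OF tendsto_const])
      have "filterlim r at_top sequentially" using p(2) unfolding much_greater_def r_def .
      then have "filterlim (\<lambda>n. r n ^ 3) at_top sequentially" by (rule filterlim_pow_at_top[rotated]) simp
      then show "filterlim (\<lambda>n. r n ^ 3) at_infinity sequentially" by (rule filterlim_at_top_imp_at_infinity)
    qed
    have ev_r: "\<forall>\<^sub>F n in sequentially. r n > 0"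
      using p(2) unfolding much_greater_def r_def filterlim_at_top_dense by blast
    show "\<forall>\<^sub>F n in sequentially. measure_pmf.prob (random_interval n (p n))
        {X. \<not> makers_win (row_matrix 2 a) (single_vec b) X} \<le> 72 * of_int \<sigma> / r n ^ 3"
      using ev_r eventually_ge_at_top[of "nat (2 * (B + \<sigma> * int T0 + \<sigma>)) + 1"]
    proof eventually_elim
      case (elim n)
      have p01: "0 \<le> p n" "p n \<le> 1" using p(1) by (auto simp: prob_function_def)
      have n1: "n \<ge> 1" using elim(2) by simp
      have nbig: "2 * (B + \<sigma> * int T0 + \<sigma>) \<le> int n" using elim(2) by linarith
      have r3: "r n ^ 3 = real n * p n ^ 3" using powr_third_cube[OF n1] by (simp add: r_def)
      define m where "m = nat ((int n - B - \<sigma> * int T0) div \<sigma>)"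
      have quot: "0 \<le> (int n - B - \<sigma> * int T0) div \<sigma>"
        using \<sigma> nbig cB[of 0] T0 by (intro pos_imp_zdiv_nonneg_iff[THEN iffD2]) auto
      then have m: "int m = (int n - B - \<sigma> * int T0) div \<sigma>" by (simp add: m_def)
      have m_up: "\<sigma> * int m \<le> int n - B - \<sigma> * int T0"
        unfolding m using \<sigma> by (metis mult_div_mod_eq pos_mod_sign le_add_same_cancel1)
      have "int n - B - \<sigma> * int T0 < \<sigma> * int m + \<sigma>"
        unfolding m using \<sigma> pos_mod_bound[of \<sigma> "int n - B - \<sigma> * int T0"]
          mult_div_mod_eq[of \<sigma> "int n - B - \<sigma> * int T0"] by linarith
      then have "int n \<le> 2 * (\<sigma> * int m)" using nbig unfolding distrib_left by linarith
      then have "int n \<le> 2 * \<sigma> * int m" by (simp only: mult.assoc)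
      then have m_low: "real n \<le> 2 * of_int \<sigma> * real m"
        using of_int_le_iff[of "int n" "2 * \<sigma> * int m", where 'a = real] by simp
      have pn: "p n > 0" using elim(1) n1 p01 by (auto simp: r_def zero_less_divide_iff)
      have m0: "m > 0" using m_low n1 by (cases "m = 0") auto
      define I where "I = {T0..<T0 + m}"
      have fI: "f t \<subseteq> interval n" if "t \<in> I" for t
      proof -
        have "\<sigma> * int t \<le> \<sigma> * int (T0 + m)" using that \<sigma> by (intro mult_left_mono) (auto simp: I_def)
        then have "B + \<sigma> * int t \<le> int n" using m_up by (simp add: algebra_simps)
        then have "h i t \<le> int n" for i using h_le[of i t] by linarith
        moreover have "1 \<le> h i t" for i using h_pos[of t i] that by (simp add: I_def)
        ultimately show ?thesis unfolding f_def interval_def by auto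
      qed
      have cardfI: "card (f t) = 3" if "t \<in> I" for t using card_f that by (simp add: I_def)
      define \<mu> where "\<mu> = real m * p n ^ 3"
      have \<mu>: "\<mu> = (\<Sum>t\<in>I. p n ^ card (f t))" by (simp add: \<mu>_def cardfI) (simp add: I_def)
      have \<mu>0: "\<mu> > 0" using m0 pn by (simp add: \<mu>_def)
      define J where "J = {st \<in> I \<times> I. f (fst st) \<inter> f (snd st) \<noteq> {}}"
      \<comment> \<open>An intersection matches one of three positions with one of three, and the
        first index then determines the second because each vertex is injective in
        \<open>t\<close>.\<close>
      have cardJ: "card J \<le> 9 * m"
      proof -
        define Q where "Q ij = {st \<in> I \<times> I. h (fst ij) (fst st) = h (snd ij) (snd st)}" for ij
        have cardQ: "card (Q ij) \<le> m" for ij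
        proof -
          have "inj_on fst (Q ij)"
          proof (rule inj_onI)
            fix st st' assume "st \<in> Q ij" "st' \<in> Q ij" and eq: "fst st = fst st'"
            then have "h (snd ij) (snd st) = h (snd ij) (snd st')" by (simp add: Q_def)
            then show "st = st'" using h_inj eq by (simp add: prod_eq_iff)
          qed
          moreover have "fst ` Q ij \<subseteq> I" by (auto simp: Q_def)
          ultimately have "card (Q ij) \<le> card I" by (intro card_inj_on_le) (auto simp: I_def)
          then show ?thesis by (simp add: I_def)
        qed
        have "J \<subseteq> (\<Union>ij\<in>{..<3} \<times> {..<3}. Q ij)"
        proof
          fix st assume st: "st \<in> J"
          then obtain v where "v \<in> f (fst st)" "v \<in> f (snd st)" unfolding J_def by auto
          then obtain i j where "i < 3" "j < 3" "h i (fst st) = h j (snd st)"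
            unfolding f_def by force
          then show "st \<in> (\<Union>ij\<in>{..<3} \<times> {..<3}. Q ij)"
            using st by (intro UN_I[of "(i, j)"]) (auto simp: J_def Q_def)
        qed
        then have "card J \<le> card (\<Union>ij\<in>{..<3} \<times> {..<3}. Q ij)"
          by (intro card_mono) (auto simp: Q_def I_def)
        also have "\<dots> \<le> (\<Sum>ij\<in>{..<3::nat} \<times> {..<3::nat}. card (Q ij))" by (intro card_UN_le) auto
        also have "\<dots> \<le> (\<Sum>ij\<in>{..<3::nat} \<times> {..<3::nat}. m)" by (intro sum_mono cardQ)
        finally show ?thesis by simp
      qed
      have "(\<Sum>st\<in>J. p n ^ card (f (fst st) \<union> f (snd st))) \<le> (\<Sum>st\<in>J. p n ^ 3)"
      proof (rule sum_mono)
        fix st assume st: "st \<in> J"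
        have "card (f (fst st)) \<le> card (f (fst st) \<union> f (snd st))"
          unfolding f_def by (intro card_mono) auto
        moreover have "fst st \<in> I" using st by (simp add: J_def mem_Times_iff)
        ultimately have "3 \<le> card (f (fst st) \<union> f (snd st))" using cardfI by simp
        then show "p n ^ card (f (fst st) \<union> f (snd st)) \<le> p n ^ 3"
          using p01 by (intro power_decreasing) auto
      qed
      also have "\<dots> = real (card J) * p n ^ 3" by simp
      also have "\<dots> \<le> real (9 * m) * p n ^ 3"
        using cardJ p01 by (intro mult_right_mono of_nat_mono) auto
      also have "\<dots> = 9 * \<mu>" by (simp add: \<mu>_def)
      finally have D: "(\<Sum>st\<in>{st \<in> I \<times> I. f (fst st) \<inter> f (snd st) \<noteq> {}}.
          p n ^ card (f (fst st) \<union> f (snd st))) \<le> 9 * \<mu>" unfolding J_def .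
      have "measure_pmf.prob (random_interval n (p n))
          {X. \<not> makers_win (row_matrix 2 a) (single_vec b) X} \<le>
        measure_pmf.prob (random_interval n (p n)) {X. \<bar>real (card {t \<in> I. f t \<subseteq> X}) - \<mu>\<bar> \<ge> \<mu> / 2}"
      proof (rule prob_random_interval_mono, rule ccontr)
        fix X assume X: "X \<subseteq> interval n" "\<not> makers_win (row_matrix 2 a) (single_vec b) X"
          "\<not> \<mu> / 2 \<le> \<bar>real (card {t \<in> I. f t \<subseteq> X}) - \<mu>\<bar>"
        then have "real (card {t \<in> I. f t \<subseteq> X}) > 0" using \<mu>0 by linarith
        then have "{t \<in> I. f t \<subseteq> X} \<noteq> {}" by (metis card.empty of_nat_0 less_irrefl)
        then obtain t where "t \<in> I" "f t \<subseteq> X" by auto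
        moreover have "finite X" using X(1) by (rule finite_subset) simp
        ultimately show False using win[of X t] X(2) by (simp add: I_def)
      qed
      also have "\<dots> \<le> 4 * (9 * \<mu>) / \<mu>\<^sup>2"
        by (rule prob_count_deviation[OF _ fI p01 \<mu> \<mu>0 D]) (simp add: I_def)
      also have "\<dots> = 36 / \<mu>" using \<mu>0 by (simp add: power2_eq_square)
      also have "\<dots> \<le> 72 * of_int \<sigma> / r n ^ 3"
      proof -
        have "r n ^ 3 \<le> 2 * of_int \<sigma> * \<mu>"
          unfolding r3 \<mu>_def using m_low pn mult_right_mono[of "real n" "2 * of_int \<sigma> * real m" "p n ^ 3"]
          by (simp add: mult_ac)
        moreover have "r n ^ 3 > 0" using elim(1) by simp
        ultimately show ?thesis using \<mu>0 by (simp add: field_simps)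
      qed
      finally show ?case .
    qed
  qed
qed

section \<open>The Maker side above the threshold\<close>

text \<open>The family is \<open>x + t y + w z\<close>: a particular solution, a multiple of a
  positive kernel vector with distinct entries (here irredundance of \<open>A\<close> enters), and a
  kernel vector with \<open>k - 1\<close> free parameters below \<open>m\<close>. The multiple of
  \<open>y\<close> dominates, so every member is positive and its entries are ordered like those of
  \<open>y\<close>.\<close>

lemma many_solutions:
  assumes k: "k \<ge> 3" and a: "\<forall>i\<in>{1..k}. a i \<noteq> 0"
    and irr: "irredundant_pair (row_matrix k a) (single_vec b)" "irredundant (row_matrix k a)"
  shows "\<exists>\<theta>>0. \<forall>\<^sub>F n in sequentially. \<exists>I \<subseteq> solutions k a b.
    finite I \<and> (\<forall>xs\<in>I. set xs \<subseteq> interval n) \<and> inj_on set I \<and> real (card I) \<ge> \<theta> * real n ^ (k - 1)"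
proof -
  define c where "c j = a (Suc j)" for j
  have c0: "c j \<noteq> 0" if "j < k" for j using a that by (simp add: c_def)
  obtain xs where xs: "xs \<in> solutions k a b" using irr(1) unfolding irredundant_pair_iff by auto
  obtain ys where ys: "ys \<in> solutions k a 0" "\<forall>y\<in>set ys. y > 0" using irr(2) unfolding irredundant_iff by auto
  define x y where "x j = xs ! j" and "y j = ys ! j" for j
  have x_sum: "(\<Sum>j<k. c j * x j) = b" using xs by (simp add: solutions_def c_def x_def)
  have y_sum: "(\<Sum>j<k. c j * y j) = 0" using ys by (simp add: solutions_def c_def y_def)
  have y_pos: "1 \<le> y j" if "j < k" for j
  proof -
    have "y j \<in> set ys" using ys(1) that by (auto simp: solutions_def y_def)
    then have "0 < y j" using ys(2) by simp
    then show ?thesis by simp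
  qed
  have y_ne: "y i \<noteq> y j" if "i < k" "j < k" "i \<noteq> j" for i j
    using ys that by (auto simp: solutions_def y_def nth_eq_iff_index_eq)
  define G where "G = (\<Sum>j<k. \<bar>c j\<bar>)"
  define B where "B = (\<Sum>j<k. \<bar>x j\<bar>)"
  define Y where "Y = (\<Sum>j<k. y j)"
  have xB: "\<bar>x j\<bar> \<le> B" if "j < k" for j
    unfolding B_def using that by (intro member_le_sum) auto
  have yY: "y j \<le> Y" if "j < k" for j
    unfolding Y_def using that y_pos by (intro member_le_sum) (auto intro: order_trans[of _ 1])
  have B0: "0 \<le> B" by (simp add: B_def sum_nonneg)
  have Y1: "1 \<le> Y" using yY[of 0] y_pos[of 0] k by simp
  have "\<bar>c 0\<bar> \<le> G" unfolding G_def using k by (intro member_le_sum) auto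
  then have G1: "1 \<le> G" using c0[of 0] k by simp
  define w where "w z j = (if j < k - 1 then c (k - 1) * int (z j) else - (\<Sum>i<k - 1. c i * int (z i)))"
    for z :: "nat \<Rightarrow> nat" and j
  have kk: "{..<k} = insert (k - 1) {..<k - 1}" using k by auto
  have w_sum: "(\<Sum>j<k. c j * w z j) = 0" for z
    unfolding kk by (simp add: w_def sum_distrib_left mult_ac)
  have w_le: "\<bar>w z j\<bar> \<le> G * int m" if z: "\<And>i. i < k - 1 \<Longrightarrow> z i < m" and j: "j < k" for z m j
  proof (cases "j < k - 1")
    case True
    have "\<bar>c (k - 1)\<bar> \<le> G" unfolding G_def using k by (intro member_le_sum) auto
    then have "\<bar>c (k - 1)\<bar> * int (z j) \<le> G * int m"
      using z[OF True] G1 by (intro mult_mono) auto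
    then show ?thesis using True by (simp add: w_def abs_mult)
  next
    case False
    have "\<bar>\<Sum>i<k - 1. c i * int (z i)\<bar> \<le> (\<Sum>i<k - 1. \<bar>c i * int (z i)\<bar>)" by (rule sum_abs)
    also have "\<dots> \<le> (\<Sum>i<k - 1. \<bar>c i\<bar> * int m)"
    proof (rule sum_mono)
      fix i assume "i \<in> {..<k - 1}"
      then have "int (z i) \<le> int m" using z[of i] by simp
      then show "\<bar>c i * int (z i)\<bar> \<le> \<bar>c i\<bar> * int m" by (simp add: abs_mult mult_left_mono)
    qed
    also have "\<dots> = (\<Sum>i<k - 1. \<bar>c i\<bar>) * int m" by (simp add: sum_distrib_right)
    also have "\<dots> \<le> G * int m" unfolding G_def by (intro mult_right_mono sum_mono2) auto
    finally show ?thesis using False by (simp add: w_def)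
  qed
  \<comment> \<open>Twice the bound \<open>B + G * m\<close> on
    \<open>\<bar>x j\<bar> + \<bar>w z j\<bar>\<close>, plus one: larger than the difference of any
    two such perturbations, yet linear in \<open>m\<close>.\<close>
  define t where "t m = 2 * (B + G * int m) + 1" for m
  define v where "v m z j = x j + t m * y j + w z j" for m z j
  define Z where "Z m = PiE {..<k - 1} (\<lambda>_. {..<m :: nat})" for m
  define L where "L m z = map (v m z) [0..<k]" for m z
  have Zlt: "z i < m" if "z \<in> Z m" "i < k - 1" for z m i using that by (auto simp: Z_def)
  have t1: "1 \<le> t m" for m using B0 G1 by (simp add: t_def)
  \<comment> \<open>Two parameters \<open>z\<close> and \<open>z'\<close> are compared at once: a
    number never occurs in different positions of two members, so the set of entries determines the
    tuple.\<close>
  have v_ne: "v m z i \<noteq> v m z' j" if "z \<in> Z m" "z' \<in> Z m" "i < k" "j < k" "i \<noteq> j" for m z z' i j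
  proof
    assume eq: "v m z i = v m z' j"
    have "t m * 1 \<le> t m * \<bar>y i - y j\<bar>" using t1[of m] y_ne[of i j] that by (intro mult_left_mono) auto
    also have "\<dots> = \<bar>t m * y i - t m * y j\<bar>" using t1[of m] by (simp add: abs_mult right_diff_distrib[symmetric])
    also have "\<dots> \<le> \<bar>x i\<bar> + \<bar>x j\<bar> + \<bar>w z i\<bar> + \<bar>w z' j\<bar>" using eq unfolding v_def by linarith
    also have "\<dots> \<le> B + B + G * int m + G * int m"
      using xB that w_le[of z m i] w_le[of z' m j] Zlt by (intro add_mono) auto
    finally show False by (simp add: t_def)
  qed
  have v_pos: "1 \<le> v m z j" if "z \<in> Z m" "j < k" for m z j
  proof -
    have "t m * 1 \<le> t m * y j" using t1[of m] y_pos[OF that(2)] by (intro mult_left_mono) auto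
    moreover have "\<bar>w z j\<bar> \<le> G * int m" using w_le[of z m j] Zlt that by auto
    moreover have "t m = 2 * B + 2 * (G * int m) + 1" by (simp add: t_def)
    ultimately show ?thesis using xB[OF that(2)] B0 unfolding v_def by linarith
  qed
  define K1 where "K1 = (1 + 2 * Y) * B + Y"
  define K2 where "K2 = (1 + 2 * Y) * G"
  have K2: "K2 \<ge> 1" using Y1 G1 mult_mono[of 1 "1 + 2 * Y" 1 G] by (simp add: K2_def)
  have K1: "K1 \<ge> 0" using Y1 B0 by (simp add: K1_def)
  have v_le: "v m z j \<le> K1 + K2 * int m" if "z \<in> Z m" "j < k" for m z j
  proof -
    have "t m * y j \<le> t m * Y" using t1[of m] yY[OF that(2)] by (intro mult_left_mono) auto
    moreover have "\<bar>w z j\<bar> \<le> G * int m" using w_le[of z m j] Zlt that by auto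
    ultimately have "v m z j \<le> B + t m * Y + G * int m" using xB[OF that(2)] unfolding v_def by linarith
    also have "\<dots> = K1 + K2 * int m" by (simp add: t_def K1_def K2_def algebra_simps)
    finally show ?thesis .
  qed
  have L_sol: "L m z \<in> solutions k a b" if "z \<in> Z m" for m z
  proof -
    have "(\<Sum>j<k. a (Suc j) * L m z ! j) = (\<Sum>j<k. c j * x j + t m * (c j * y j) + c j * w z j)"
      by (intro sum.cong) (auto simp: L_def v_def c_def algebra_simps)
    also have "\<dots> = b" using x_sum y_sum w_sum by (simp add: sum.distrib sum_distrib_left[symmetric])
    finally have "(\<Sum>j<k. a (Suc j) * L m z ! j) = b" .
    moreover have "inj_on (v m z) {0..<k}"
      using v_ne[OF that that] by (intro inj_onI) (meson atLeastLessThan_iff)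
    ultimately show ?thesis unfolding solutions_def by (simp add: L_def distinct_map)
  qed
  have set_L: "set (L m z) = v m z ` {..<k}" for m z by (auto simp: L_def)
  have inj: "z = z'" if z: "z \<in> Z m" "z' \<in> Z m" and eq: "set (L m z) = set (L m z')" for m z z'
  proof -
    have "z i = z' i" if i: "i < k - 1" for i
    proof -
      have ik: "i < k" using i by simp
      then have "v m z i \<in> v m z' ` {..<k}" using eq unfolding set_L by auto
      then obtain j where "j < k" "v m z i = v m z' j" by auto
      then have "v m z i = v m z' i" using v_ne[OF z ik, of j] by auto
      then have "c (k - 1) * int (z i) = c (k - 1) * int (z' i)" using i by (simp add: v_def w_def)
      then show ?thesis using c0[of "k - 1"] k by simp
    qed
    then show ?thesis using z unfolding Z_def by (intro PiE_ext[of z "{..<k - 1}" _ z']) auto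
  qed
  \<comment> \<open>\<open>K2\<close> is the growth rate of the entries in \<open>m\<close>, so
    \<open>m\<close> can be taken at least \<open>n / (2 * K2)\<close>, and the family has
    \<open>m ^ (k - 1)\<close> members.\<close>
  define \<theta> where "\<theta> = (1 / (2 * real_of_int K2)) ^ (k - 1)"
  have "\<theta> > 0" using K2 by (simp add: \<theta>_def)
  moreover have "\<forall>\<^sub>F n in sequentially. \<exists>I \<subseteq> solutions k a b.
    finite I \<and> (\<forall>xs\<in>I. set xs \<subseteq> interval n) \<and> inj_on set I \<and> real (card I) \<ge> \<theta> * real n ^ (k - 1)"
    using eventually_ge_at_top[of "nat (2 * (K1 + K2))"]
  proof eventually_elim
    case (elim n)
    have nbig: "2 * (K1 + K2) \<le> int n" using elim by linarith
    define m where "m = nat ((int n - K1) div K2)"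
    have "0 \<le> (int n - K1) div K2"
      using K2 K1 nbig by (intro pos_imp_zdiv_nonneg_iff[THEN iffD2]) auto
    then have m: "int m = (int n - K1) div K2" by (simp add: m_def)
    have dm: "K2 * ((int n - K1) div K2) + (int n - K1) mod K2 = int n - K1" by (rule mult_div_mod_eq)
    have "0 \<le> (int n - K1) mod K2" "(int n - K1) mod K2 < K2" using K2 by auto
    then have m_up: "K1 + K2 * int m \<le> int n" and "int n - K1 < K2 * int m + K2"
      using dm unfolding m by linarith+
    then have "int n \<le> 2 * (K2 * int m)" using nbig unfolding distrib_left by linarith
    then have "real n \<le> 2 * real_of_int K2 * real m"
      using of_int_le_iff[of "int n" "2 * (K2 * int m)", where 'a = real] by (simp add: mult.assoc)
    then have m_low: "real n / (2 * real_of_int K2) \<le> real m" using K2 by (simp add: field_simps)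
    define I where "I = L m ` Z m"
    have "inj_on (L m) (Z m)" using inj by (intro inj_onI) auto
    then have "card I = card (Z m)" unfolding I_def by (rule card_image)
    also have "\<dots> = m ^ (k - 1)" unfolding Z_def by (subst card_PiE) auto
    finally have cardI: "card I = m ^ (k - 1)" .
    have "\<theta> * real n ^ (k - 1) = (real n / (2 * real_of_int K2)) ^ (k - 1)"
      by (simp add: \<theta>_def power_divide)
    also have "\<dots> \<le> real m ^ (k - 1)" using m_low K2 by (intro power_mono) auto
    finally have "\<theta> * real n ^ (k - 1) \<le> real (card I)" using cardI by simp
    moreover have "finite I" unfolding I_def Z_def by (intro finite_imageI finite_PiE) auto
    moreover have "I \<subseteq> solutions k a b" using L_sol by (auto simp: I_def)
    moreover have "inj_on set I" unfolding I_def using inj by (auto intro!: inj_onI)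
    moreover have "\<forall>xs\<in>I. set xs \<subseteq> interval n"
    proof
      fix xs assume "xs \<in> I"
      then obtain z where z: "z \<in> Z m" "xs = L m z" by (auto simp: I_def)
      have "1 \<le> v m z j \<and> v m z j \<le> int n" if "j < k" for j
        using v_pos[OF z(1) that] v_le[OF z(1) that] m_up by linarith
      then show "set xs \<subseteq> interval n" unfolding z(2) set_L interval_def by auto
    qed
    ultimately show ?case by blast
  qed
  ultimately show ?thesis by blast
qed

text \<open>Sufficient for Maker's win, and visibly upward closed, as the coupling requires.\<close>

definition rich :: "nat \<Rightarrow> int list set \<Rightarrow> int set \<Rightarrow> bool" where
  "rich k S X \<longleftrightarrow> (\<exists>I\<subseteq>S. (\<forall>xs\<in>I. set xs \<subseteq> X) \<and>
     (\<forall>xs\<in>I. \<forall>ys\<in>I. xs \<noteq> ys \<longrightarrow> card (set xs \<inter> set ys) \<le> 1) \<and>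
     real (card (\<Union>(set ` I))) / 8 < real (card I) / 2 ^ k)"

lemma rich_mono: "rich k S X \<Longrightarrow> X \<subseteq> Y \<Longrightarrow> rich k S Y"
  unfolding rich_def by (meson order_trans)

lemma makers_win_if_rich:
  assumes "rich k (solutions k a b) X" "finite X" "k \<ge> 2"
  shows "makers_win (row_matrix k a) (single_vec b) X"
proof -
  obtain I where I: "I \<subseteq> solutions k a b" "\<forall>xs\<in>I. set xs \<subseteq> X"
    "\<forall>xs\<in>I. \<forall>ys\<in>I. xs \<noteq> ys \<longrightarrow> card (set xs \<inter> set ys) \<le> 1"
    "real (card (\<Union>(set ` I))) / 8 < real (card I) / 2 ^ k"
    using assms(1) unfolding rich_def by auto
  show ?thesis
    by (rule makers_win_if_many_solutions[OF assms(2), of I]) (use I assms(3) in auto)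
qed

text \<open>Three failures are charged: a wrong number of surviving solutions from \<open>I\<close>
  (Chebyshev, \<open>4 * (H + 1)\<close>), too many surviving pairs with two common elements
  (Markov, \<open>8 * H\<close>) and a wrong number of elements (Chebyshev, 4). Otherwise deleting
  the overlapping solutions leaves a linear family that is large enough.\<close>

lemma prob_not_rich:
  fixes \<delta> C q H :: real
  assumes k: "k \<ge> 3" and a: "\<forall>i\<in>{1..k}. a i \<noteq> 0"
    and I: "I \<subseteq> solutions k a b" "finite I" "\<forall>xs\<in>I. set xs \<subseteq> interval n" "inj_on set I"
    and \<delta>: "0 < \<delta>" "\<delta> \<le> 1" and n\<delta>: "real n * \<delta> ^ (k - 1) = 1"
    and C: "1 \<le> C" and q: "q = C * \<delta> ^ (k - 2)" "q \<le> 1"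
    and big: "2 ^ k * (real n * q) \<le> real (card I) * q ^ k"
    and H: "H = 2 ^ k * real k ^ k * real k * C ^ k"
  shows "measure_pmf.prob (random_interval n q) {X. \<not> rich k (solutions k a b) X} \<le> (12 * H + 8) * \<delta>"
proof -
  let ?P = "measure_pmf.prob (random_interval n q)"
  have q0: "0 < q" using C \<delta> by (simp add: q(1))
  have nq: "1 / \<delta> \<le> real n * q"
  proof -
    have k1: "k - 1 = Suc (k - 2)" using k by simp
    have "real n * q * \<delta> = C * (real n * \<delta> ^ (k - 1))" unfolding k1 by (simp add: q(1) mult_ac)
    then have "real n * q * \<delta> = C" by (simp only: n\<delta> mult_1_right)
    then show ?thesis using C \<delta> by (simp add: divide_le_eq)
  qed
  have n0: "0 < real n * q" using nq \<delta> by (meson less_le_trans zero_less_divide_1_iff)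
  define \<mu> where "\<mu> = real (card I) * q ^ k"
  have "1 * (real n * q) \<le> 2 ^ k * (real n * q)" using n0 by (intro mult_right_mono) auto
  then have \<mu>nq: "real n * q \<le> \<mu>" using big by (simp add: \<mu>_def)
  have \<mu>0: "0 < \<mu>" using \<mu>nq n0 by simp
  have \<mu>\<delta>: "1 / \<mu> \<le> \<delta>"
    using order_trans[OF nq \<mu>nq] \<mu>0 \<delta> by (simp add: field_simps)
  have H0: "0 \<le> H" using C by (simp add: H)
  have card_set: "card (set xs) = k" if "xs \<in> I" for xs
    using I(1) that by (auto simp: solutions_def distinct_card)
  have card_int: "card (set xs \<inter> set ys) < k" if "xs \<in> I" "ys \<in> I" "xs \<noteq> ys" for xs ys
  proof -
    have ne: "set xs \<noteq> set ys" using that I(4) by (auto dest: inj_onD)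
    have "set xs \<inter> set ys \<noteq> set xs"
    proof
      assume "set xs \<inter> set ys = set xs"
      then have "set xs \<subseteq> set ys" by auto
      then show False using ne card_set that(1,2) by (metis List.finite_set card_subset_eq)
    qed
    then have "set xs \<inter> set ys \<subset> set xs" by auto
    then show ?thesis using card_set[OF that(1)] psubset_card_mono[of "set xs"] by simp
  qed
  \<comment> \<open>Overlaps in at least \<open>r\<close> elements weigh at most
    \<open>\<mu> * H * \<delta> ^ (r - 1)\<close>. The case \<open>r = 1\<close> feeds the variance;
    the gain of \<delta> at \<open>r = 2\<close> makes the deletion cheap.\<close>
  define J where "J r = {st \<in> I \<times> I. r \<le> card (set (fst st) \<inter> set (snd st)) \<and>
      card (set (fst st) \<inter> set (snd st)) < k}" for r
  have finJ: "finite (J r)" for r unfolding J_def using I(2) by simp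
  have weightJ: "(\<Sum>st\<in>J r. q ^ card (set (fst st) \<union> set (snd st))) \<le> \<mu> * H * \<delta> ^ (r - 1)" if r: "1 \<le> r" for r
  proof -
    define D where "D xs j = {ys \<in> I. card (set xs \<inter> set ys) = j}" for xs j
    have finD: "finite (D xs j)" for xs j unfolding D_def using I(2) by simp
    have inner: "(\<Sum>ys\<in>D xs j. q ^ card (set xs \<union> set ys)) \<le> 2 ^ k * real k ^ k * C ^ k * \<delta> ^ (r - 1) * q ^ k"
      if xs: "xs \<in> I" and j: "r \<le> j" "j < k" for xs j
    proof -
      have "card (set xs \<union> set ys) = (k - j) + k" if "ys \<in> D xs j" for ys
        using card_Un_Int[of "set xs" "set ys"] card_set[OF xs] card_set[of ys] that j by (simp add: D_def)
      then have "(\<Sum>ys\<in>D xs j. q ^ card (set xs \<union> set ys)) = real (card (D xs j)) * (q ^ (k - j) * q ^ k)"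
        by (simp add: power_add)
      also have "\<dots> \<le> (2 ^ k * (real k ^ j * real n ^ (k - 1 - j))) * (q ^ (k - j) * q ^ k)"
      proof (rule mult_right_mono)
        have "D xs j \<subseteq> {ys \<in> solutions k a b. set ys \<subseteq> interval n \<and> card (set ys \<inter> set xs) = j}"
          using I by (auto simp: D_def Int_commute)
        then have "card (D xs j) \<le> card {ys \<in> solutions k a b. set ys \<subseteq> interval n \<and> card (set ys \<inter> set xs) = j}"
          by (rule card_mono[rotated])
            (rule finite_subset[OF _ finite_solutions_in[of "interval n" k a b]], auto)
        also have "\<dots> \<le> 2 ^ k * (k ^ j * n ^ (k - 1 - j))"
          using j card_set[OF xs] by (intro card_solutions_meeting[OF a]) auto
        finally have "real (card (D xs j)) \<le> real (2 ^ k * (k ^ j * n ^ (k - 1 - j)))" by (rule of_nat_mono)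
        then show "real (card (D xs j)) \<le> 2 ^ k * (real k ^ j * real n ^ (k - 1 - j))" by simp
      qed (use q0 in auto)
      also have "\<dots> = (2 ^ k * real k ^ j * (real n ^ (k - 1 - j) * q ^ (k - j))) * q ^ k" by (simp add: mult_ac)
      also have "\<dots> \<le> (2 ^ k * real k ^ k * (C ^ k * \<delta> ^ (r - 1))) * q ^ k"
      proof (rule mult_right_mono, rule mult_mono)
        show "2 ^ k * real k ^ j \<le> 2 ^ k * real k ^ k"
          using k j by (intro mult_left_mono power_increasing) auto
        have "real n ^ (k - 1 - j) * q ^ (k - j) = C ^ (k - j) * (real n ^ (k - 1 - j) * (\<delta> ^ (k - 2)) ^ (k - j))"
          by (simp add: q(1) power_mult_distrib mult_ac)
        also have "\<dots> = C ^ (k - j) * \<delta> ^ (j - 1)"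
          using scaled_power_identity[OF n\<delta>, of j] r j by simp
        also have "\<dots> \<le> C ^ k * \<delta> ^ (r - 1)"
          using C \<delta> j by (intro mult_mono power_increasing power_decreasing) auto
        finally show "real n ^ (k - 1 - j) * q ^ (k - j) \<le> C ^ k * \<delta> ^ (r - 1)" .
      qed (use q0 C in auto)
      finally show ?thesis by (simp add: mult_ac)
    qed
    have "J r = Sigma I (\<lambda>xs. \<Union>j\<in>{r..<k}. D xs j)" by (auto simp: J_def D_def)
    then have "(\<Sum>st\<in>J r. q ^ card (set (fst st) \<union> set (snd st))) =
        (\<Sum>xs\<in>I. \<Sum>ys\<in>(\<Union>j\<in>{r..<k}. D xs j). q ^ card (set xs \<union> set ys))"
      using I(2) finD by (simp add: sum.Sigma case_prod_beta)
    also have "\<dots> = (\<Sum>xs\<in>I. \<Sum>j\<in>{r..<k}. \<Sum>ys\<in>D xs j. q ^ card (set xs \<union> set ys))"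
      using finD by (intro sum.cong sum.UNION_disjoint) (auto simp: D_def)
    also have "\<dots> \<le> (\<Sum>xs\<in>I. \<Sum>j\<in>{r..<k}. 2 ^ k * real k ^ k * C ^ k * \<delta> ^ (r - 1) * q ^ k)"
      using inner by (intro sum_mono) auto
    also have "\<dots> = real (card I) * (real (k - r) * (2 ^ k * real k ^ k * C ^ k * \<delta> ^ (r - 1) * q ^ k))" by simp
    also have "\<dots> \<le> real (card I) * (real k * (2 ^ k * real k ^ k * C ^ k * \<delta> ^ (r - 1) * q ^ k))"
      using C \<delta> q0 by (intro mult_left_mono mult_right_mono) auto
    also have "\<dots> = \<mu> * H * \<delta> ^ (r - 1)" by (simp add: \<mu>_def H mult_ac)
    finally show ?thesis .
  qed
  have count: "?P {X. \<bar>real (card {xs \<in> I. set xs \<subseteq> X}) - \<mu>\<bar> \<ge> \<mu> / 2} \<le> 4 * (\<mu> * (H + 1)) / \<mu>\<^sup>2"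
  proof (rule prob_count_deviation)
    show "\<mu> = (\<Sum>s\<in>I. q ^ card (set s))" by (simp add: \<mu>_def card_set)
    let ?g = "\<lambda>st. q ^ card (set (fst st) \<union> set (snd st))"
    \<comment> \<open>A solution paired with itself overlaps in \<open>k\<close> elements and is
      outside \<open>J 1\<close>; the diagonal accounts for the extra \<open>\<mu>\<close> in
      \<open>\<mu> * (H + 1)\<close>.\<close>
    define diag where "diag = (\<lambda>xs. (xs, xs)) ` I"
    have "{st \<in> I \<times> I. set (fst st) \<inter> set (snd st) \<noteq> {}} \<subseteq> J 1 \<union> diag"
    proof
      fix st assume "st \<in> {st \<in> I \<times> I. set (fst st) \<inter> set (snd st) \<noteq> {}}"
      then have st: "fst st \<in> I" "snd st \<in> I" "set (fst st) \<inter> set (snd st) \<noteq> {}" by auto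
      then have "1 \<le> card (set (fst st) \<inter> set (snd st))" by (simp add: Suc_leI card_gt_0_iff)
      then show "st \<in> J 1 \<union> diag"
        using st card_int[OF st(1,2)] by (cases "fst st = snd st") (auto simp: J_def diag_def mem_Times_iff image_iff prod_eq_iff)
    qed
    then have "(\<Sum>st\<in>{st \<in> I \<times> I. set (fst st) \<inter> set (snd st) \<noteq> {}}. ?g st) \<le> (\<Sum>st\<in>J 1 \<union> diag. ?g st)"
      using q0 finJ I(2) by (intro sum_mono2) (auto simp: diag_def)
    also have "\<dots> = (\<Sum>st\<in>J 1. ?g st) + (\<Sum>st\<in>diag. ?g st)"
      using finJ I(2) card_set by (intro sum.union_disjoint) (auto simp: diag_def J_def)
    also have "(\<Sum>st\<in>diag. ?g st) = \<mu>"
      unfolding diag_def by (subst sum.reindex) (auto simp: inj_on_def \<mu>_def card_set)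
    also have "(\<Sum>st\<in>J 1. ?g st) \<le> \<mu> * H" using weightJ[of 1] by simp
    finally show "(\<Sum>st\<in>{st \<in> I \<times> I. set (fst st) \<inter> set (snd st) \<noteq> {}}. ?g st) \<le> \<mu> * (H + 1)"
      by (simp add: algebra_simps)
  qed (use I q0 q \<mu>0 in auto)
  also have "4 * (\<mu> * (H + 1)) / \<mu>\<^sup>2 = 4 * (H + 1) * (1 / \<mu>)" using \<mu>0 by (simp add: power2_eq_square)
  also have "\<dots> \<le> 4 * (H + 1) * \<delta>" using \<mu>\<delta> H0 by (intro mult_left_mono) auto
  finally have A: "?P {X. \<bar>real (card {xs \<in> I. set xs \<subseteq> X}) - \<mu>\<bar> \<ge> \<mu> / 2} \<le> 4 * (H + 1) * \<delta>" .
  define Y where "Y X = real (card {st \<in> J 2. set (fst st) \<union> set (snd st) \<subseteq> X})" for X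
  have "?P {X \<in> space (measure_pmf (random_interval n q)). Y X \<ge> \<mu> / 8} \<le>
      measure_pmf.expectation (random_interval n q) Y / (\<mu> / 8)"
    by (rule integral_Markov_inequality_measure[where A = "{}"])
      (use \<mu>0 in \<open>auto simp: Y_def intro!: integrable_measure_pmf_finite\<close>)
  also have "measure_pmf.expectation (random_interval n q) Y =
      (\<Sum>st\<in>J 2. q ^ card (set (fst st) \<union> set (snd st)))"
    unfolding Y_def using I q0 q(2) by (intro expectation_count_subsets finJ) (auto simp: J_def)
  also have "\<dots> / (\<mu> / 8) \<le> (\<mu> * H * \<delta>) / (\<mu> / 8)"
    using weightJ[of 2] \<mu>0 by (intro divide_right_mono) auto
  also have "\<dots> = 8 * H * \<delta>" using \<mu>0 by simp
  finally have B: "?P {X. Y X \<ge> \<mu> / 8} \<le> 8 * H * \<delta>" by simp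
  have "?P {X. \<bar>real (card {x \<in> interval n. {x} \<subseteq> X}) - real n * q\<bar> \<ge> real n * q / 2}
      \<le> 4 * (real n * q) / (real n * q)\<^sup>2"
  proof (rule prob_count_deviation)
    show "real n * q = (\<Sum>s\<in>interval n. q ^ card {s})" by simp
    have "{st \<in> interval n \<times> interval n. {fst st} \<inter> {snd st} \<noteq> {}} = (\<lambda>x. (x, x)) ` interval n"
      by (auto simp: image_iff)
    then show "(\<Sum>st\<in>{st \<in> interval n \<times> interval n. {fst st} \<inter> {snd st} \<noteq> {}}.
        q ^ card ({fst st} \<union> {snd st})) \<le> real n * q"
      by (simp add: sum.reindex inj_on_def)
  qed (use q0 q n0 in auto)
  also have "\<dots> = 4 / (real n * q)" using n0 by (simp add: power2_eq_square)
  also have "\<dots> \<le> 4 * \<delta>" using nq n0 \<delta> by (simp add: field_simps)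
  finally have E: "?P {X. \<bar>real (card {x \<in> interval n. {x} \<subseteq> X}) - real n * q\<bar> \<ge> real n * q / 2} \<le> 4 * \<delta>" .
  have good: "rich k (solutions k a b) X"
    if X: "X \<subseteq> interval n"
      and N: "\<not> \<bar>real (card {xs \<in> I. set xs \<subseteq> X}) - \<mu>\<bar> \<ge> \<mu> / 2" and YX: "\<not> Y X \<ge> \<mu> / 8"
      and cX: "\<not> \<bar>real (card {x \<in> interval n. {x} \<subseteq> X}) - real n * q\<bar> \<ge> real n * q / 2" for X
  proof -
    define IX where "IX = {xs \<in> I. set xs \<subseteq> X}"
    \<comment> \<open>Both members of an overlapping pair are dropped; they are no more numerous
      than the ordered pairs counted by \<open>Y\<close>.\<close>
    define bad where "bad = {xs \<in> IX. \<exists>ys\<in>IX. xs \<noteq> ys \<and> card (set xs \<inter> set ys) \<ge> 2}"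
    define JX where "JX = {st \<in> J 2. set (fst st) \<union> set (snd st) \<subseteq> X}"
    have finIX: "finite IX" and finX: "finite X"
      using I(2) X finite_subset[OF X] by (auto simp: IX_def)
    have "bad \<subseteq> fst ` JX"
    proof
      fix xs assume "xs \<in> bad"
      then obtain ys where ys: "xs \<in> IX" "ys \<in> IX" "xs \<noteq> ys" "card (set xs \<inter> set ys) \<ge> 2"
        by (auto simp: bad_def)
      then have "(xs, ys) \<in> JX" using card_int[of xs ys] by (auto simp: JX_def J_def IX_def)
      then show "xs \<in> fst ` JX" by force
    qed
    then have "card bad \<le> card JX"
      using finJ[of 2] surj_card_le[of JX bad fst] by (simp add: JX_def)
    then have bad: "real (card bad) < \<mu> / 8" using YX by (simp add: Y_def JX_def)
    have "real (card IX) > \<mu> / 2" using N unfolding IX_def by linarith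
    moreover have "card (IX - bad) = card IX - card bad" "card bad \<le> card IX"
      using finIX by (auto simp: bad_def intro!: card_Diff_subset card_mono)
    ultimately have "real (card (IX - bad)) > 3 / 8 * \<mu>" using bad by simp
    moreover have "2 ^ k * (real n * q) \<le> \<mu>" using big by (simp add: \<mu>_def)
    ultimately have lower: "3 / 8 * (2 ^ k * (real n * q)) < real (card (IX - bad))" by linarith
    \<comment> \<open>More than \<open>\<mu> / 2 - \<mu> / 8\<close> solutions survive, on fewer
      than \<open>3 / 2 * (n * q)\<close> elements; as \<open>\<mu> \<ge> 2 ^ k * (n * q)\<close>,
      the criterion holds with a factor two to spare.\<close>
    have "real n * q * 3 / 8 < real (card (IX - bad)) / 2 ^ k"
      using lower by (simp add: field_simps)
    moreover have eq: "{x \<in> interval n. {x} \<subseteq> X} = X" using X by auto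
    have "real (card X) < 3 / 2 * (real n * q)" using cX unfolding eq by linarith
    moreover have "card (\<Union>(set ` (IX - bad))) \<le> card X"
      using finX by (intro card_mono) (auto simp: IX_def)
    ultimately have "real (card (\<Union>(set ` (IX - bad)))) / 8 < real (card (IX - bad)) / 2 ^ k"
      using n0 by linarith
    moreover have "IX - bad \<subseteq> solutions k a b" using I(1) by (auto simp: IX_def)
    moreover have "card (set xs \<inter> set ys) \<le> 1" if "xs \<in> IX - bad" "ys \<in> IX - bad" "xs \<noteq> ys" for xs ys
      using that by (force simp: bad_def)
    moreover have "\<forall>xs\<in>IX - bad. set xs \<subseteq> X" by (auto simp: IX_def)
    ultimately show ?thesis unfolding rich_def by (intro exI[of _ "IX - bad"]) auto
  qed
  have "?P {X. \<not> rich k (solutions k a b) X} \<le>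
      ?P {X. \<bar>real (card {xs \<in> I. set xs \<subseteq> X}) - \<mu>\<bar> \<ge> \<mu> / 2 \<or> (Y X \<ge> \<mu> / 8 \<or>
        \<bar>real (card {x \<in> interval n. {x} \<subseteq> X}) - real n * q\<bar> \<ge> real n * q / 2)}"
    by (rule prob_random_interval_mono) (use good in blast)
  also have "\<dots> \<le> 4 * (H + 1) * \<delta> + (8 * H * \<delta> + 4 * \<delta>)"
    using A B E
    by (intro order_trans[OF prob_random_interval_disj] add_mono) auto
  finally show ?thesis by (simp add: algebra_simps)
qed

lemma maker_wins_dense:
  assumes k: "k \<ge> 3" and a: "\<forall>i\<in>{1..k}. a i \<noteq> 0"
    and irr: "irredundant_pair (row_matrix k a) (single_vec b)" "irredundant (row_matrix k a)"
  shows "\<exists>C>0. \<forall>p. prob_function p \<longrightarrow>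
    (\<forall>\<^sub>F n in sequentially. p n > C * real n powr (- ((real k - 2) / (real k - 1)))) \<longrightarrow>
    whp p (makers_win (row_matrix k a) (single_vec b))"
proof -
  obtain \<theta> where \<theta>: "\<theta> > 0" and ev: "\<forall>\<^sub>F n in sequentially. \<exists>I \<subseteq> solutions k a b.
      finite I \<and> (\<forall>xs\<in>I. set xs \<subseteq> interval n) \<and> inj_on set I \<and> real (card I) \<ge> \<theta> * real n ^ (k - 1)"
    using many_solutions[OF k a irr] by auto
  \<comment> \<open>\<open>2 ^ k \<le> \<theta> * C\<close> makes the expected number of solutions
    at density \<open>q\<close>, at least \<open>\<theta> * C ^ (k - 1) * (n * q)\<close>, no
    smaller than \<open>2 ^ k * (n * q)\<close>; the maximum with 1 makes the powers of
    \<open>C\<close> increasing.\<close>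
  define C where "C = max 1 (2 ^ k / \<theta>)"
  have C: "1 \<le> C" "2 ^ k \<le> \<theta> * C" using \<theta> by (auto simp: C_def max_def field_simps)
  define H where "H = 2 ^ k * real k ^ k * real k * C ^ k"
  have "whp p (makers_win (row_matrix k a) (single_vec b))"
    if p: "prob_function p"
      and large: "\<forall>\<^sub>F n in sequentially. p n > C * real n powr (- ((real k - 2) / (real k - 1)))" for p
  proof (rule whpI)
    define \<delta> where "\<delta> n = real n powr (- (1 / (real k - 1)))" for n
    show "(\<lambda>n. (12 * H + 8) * \<delta> n) \<longlonglongrightarrow> 0"
    proof -
      have "\<delta> \<longlonglongrightarrow> 0" unfolding \<delta>_def
        using k by (intro tendsto_neg_powr filterlim_real_sequentially) auto
      then show ?thesis by (rule tendsto_mult_right_zero)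
    qed
    show "\<forall>\<^sub>F n in sequentially. measure_pmf.prob (random_interval n (p n))
        {X. \<not> makers_win (row_matrix k a) (single_vec b) X} \<le> (12 * H + 8) * \<delta> n"
      using large ev eventually_ge_at_top[of 1]
    proof eventually_elim
      case (elim n)
      have p01: "0 \<le> p n" "p n \<le> 1" using p by (auto simp: prob_function_def)
      note scale = threshold_scale[OF elim(3) k, folded \<delta>_def]
      define q where "q = C * \<delta> n ^ (k - 2)"
      have qp: "q \<le> p n" using elim(1) scale(4) by (simp add: q_def)
      have q0: "0 \<le> q" using C scale(1) by (simp add: q_def)
      obtain I where I: "I \<subseteq> solutions k a b" "finite I" "\<forall>xs\<in>I. set xs \<subseteq> interval n"
        "inj_on set I" "real (card I) \<ge> \<theta> * real n ^ (k - 1)" using elim(2) by blast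
      have nq: "real n ^ (k - 2) * q ^ (k - 1) = C ^ (k - 1)"
      proof -
        have "real n ^ (k - 2) * q ^ (k - 1) = C ^ (k - 1) * (real n ^ (k - 1 - 1) * (\<delta> n ^ (k - 2)) ^ (k - 1))"
          by (simp add: q_def power_mult_distrib mult_ac numeral_2_eq_2)
        also have "\<dots> = C ^ (k - 1)" using scaled_power_identity[OF scale(3), of 1] k by simp
        finally show ?thesis .
      qed
      have "2 ^ k * (real n * q) \<le> real (card I) * q ^ k"
      proof -
        have "2 ^ k \<le> \<theta> * C ^ 1" using C by simp
        also have "\<dots> \<le> \<theta> * C ^ (k - 1)" using C \<theta> k by (intro mult_left_mono power_increasing) auto
        finally have "2 ^ k * (real n * q) \<le> \<theta> * C ^ (k - 1) * (real n * q)"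
          using q0 by (intro mult_right_mono) auto
        also have "\<dots> = \<theta> * ((real n * real n ^ (k - 2)) * (q * q ^ (k - 1)))"
          unfolding nq[symmetric] by (simp add: mult_ac)
        also have "\<dots> = \<theta> * (real n ^ (k - 1) * q ^ k)"
        proof -
          have "k - 1 = Suc (k - 2)" "k = Suc (k - 1)" using k by auto
          then have "real n * real n ^ (k - 2) = real n ^ (k - 1)" "q * q ^ (k - 1) = q ^ k"
            by (metis power_Suc)+
          then show ?thesis by simp
        qed
        also have "\<dots> = (\<theta> * real n ^ (k - 1)) * q ^ k" by simp
        also have "\<dots> \<le> real (card I) * q ^ k" using I(5) q0 by (intro mult_right_mono) auto
        finally show ?thesis .
      qed
      then have sparse: "measure_pmf.prob (random_interval n q) {X. \<not> rich k (solutions k a b) X} \<le> (12 * H + 8) * \<delta> n"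
        using qp p01 by (intro prob_not_rich[OF k a I(1-4) scale(1-3) C(1) q_def _ _ H_def]) auto
      have compl: "measure_pmf.prob (random_interval n r) {X. \<not> rich k (solutions k a b) X} =
          1 - measure_pmf.prob (random_interval n r) {X. rich k (solutions k a b) X}" for r
        using measure_pmf.prob_compl[of "{X. rich k (solutions k a b) X}" "random_interval n r"]
        by (simp add: Compl_eq_Diff_UNIV[symmetric] Collect_neg_eq[symmetric])
      have "measure_pmf.prob (random_interval n (p n)) {X. \<not> makers_win (row_matrix k a) (single_vec b) X}
          \<le> measure_pmf.prob (random_interval n (p n)) {X. \<not> rich k (solutions k a b) X}"
      proof (rule prob_random_interval_mono, rule notI)
        fix X assume "X \<subseteq> interval n" "\<not> makers_win (row_matrix k a) (single_vec b) X" "rich k (solutions k a b) X"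
        then show False using makers_win_if_rich[of k a b X] k finite_subset[of X "interval n"] by simp
      qed
      also have "\<dots> \<le> measure_pmf.prob (random_interval n q) {X. \<not> rich k (solutions k a b) X}"
        unfolding compl using prob_random_interval_le[OF q0 qp p01(2), of n "rich k (solutions k a b)"] rich_mono
        by force
      finally show ?case using sparse by linarith
    qed
  qed
  then show ?thesis using C(1) by (intro exI[of _ C]) auto
qed

theorem theorem1p2:
  fixes k :: nat and a :: "nat \<Rightarrow> int" and b :: int
  assumes "k \<ge> 2"
    and "\<forall>i\<in>{1..k}. a i \<noteq> 0"
    and "A = row_matrix k a"
    and "bv = single_vec b"
  shows
    "(irredundant_pair A bv \<and> irredundant A \<and> satisfies_star A \<longrightarrow>
        (\<exists>C>0. \<exists>c>0. \<forall>p. prob_function p \<longrightarrow>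
           ((\<forall>\<^sub>F n in sequentially. p n > C * real n powr (- ((real k - 2) / (real k - 1))))
              \<longrightarrow> whp p (makers_win A bv)) \<and>
           ((\<forall>\<^sub>F n in sequentially. p n < c * real n powr (- ((real k - 2) / (real k - 1))))
              \<longrightarrow> whp p (breakers_win A bv))))
     \<and>
     (irredundant_pair A bv \<and> irredundant A \<and> \<not> satisfies_star A \<longrightarrow>
        (\<forall>p. prob_function p \<longrightarrow>
           (p \<ggreater> (\<lambda>n. real n powr (- 1 / 3)) \<longrightarrow> whp p (makers_win A bv)) \<and>
           (p \<lless> (\<lambda>n. real n powr (- 1 / 3)) \<longrightarrow> whp p (breakers_win A bv))))
     \<and>
     (irredundant_pair A bv \<and> \<not> irredundant A \<longrightarrow>
        (if (\<forall>i\<in>{1..k}. a i > 0) \<or> (\<forall>i\<in>{1..k}. a i < 0)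
         then (\<forall>p. prob_function p \<and> p \<longlonglongrightarrow> 0 \<longrightarrow> whp p (breakers_win A bv))
         else (\<forall>p. prob_function p \<longrightarrow>
           (p \<ggreater> (\<lambda>n. real n powr (- 1 / 3)) \<longrightarrow> whp p (makers_win A bv)) \<and>
           (p \<lless> (\<lambda>n. real n powr (- 1 / 3)) \<longrightarrow> whp p (breakers_win A bv)))))
     \<and>
     (\<not> irredundant_pair A bv \<longrightarrow> (\<forall>n. breakers_win A bv (interval n)))"
proof (intro conjI impI)
  have star: "satisfies_star A \<longleftrightarrow> k \<noteq> 2"
    using satisfies_star_row_matrix[OF assms(2)] by (simp add: assms(3))
  have two: "a 1 \<noteq> 0" "a 2 \<noteq> 0" using assms(1,2) by auto
  have two_variables:
    "(p \<ggreater> (\<lambda>n. real n powr (- 1 / 3)) \<longrightarrow> whp p (makers_win A bv)) \<and>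
     (p \<lless> (\<lambda>n. real n powr (- 1 / 3)) \<longrightarrow> whp p (breakers_win A bv))"
    if "k = 2" "a 1 * a 2 < 0" "irredundant_pair A bv" "prob_function p" for p
    using maker_wins_two_variables[of a b p] breaker_wins_two_variables[of a p b] two that
    by (simp add: assms(3,4))
  {
    assume h: "irredundant_pair A bv \<and> irredundant A \<and> satisfies_star A"
    then have k: "k \<ge> 3" using star assms(1) by simp
    obtain C where C: "C > 0" "\<And>p. prob_function p \<Longrightarrow>
        \<forall>\<^sub>F n in sequentially. p n > C * real n powr (- ((real k - 2) / (real k - 1))) \<Longrightarrow>
        whp p (makers_win A bv)"
      using maker_wins_dense[OF k assms(2), of b] h unfolding assms(3,4) by auto
    obtain c where c: "c > 0" "\<And>p. prob_function p \<Longrightarrow>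
        \<forall>\<^sub>F n in sequentially. p n < c * real n powr (- ((real k - 2) / (real k - 1))) \<Longrightarrow>
        whp p (breakers_win A bv)"
      using breaker_wins_sparse[OF k assms(2), of b] unfolding assms(3,4) by auto
    show "\<exists>C>0. \<exists>c>0. \<forall>p. prob_function p \<longrightarrow>
           ((\<forall>\<^sub>F n in sequentially. p n > C * real n powr (- ((real k - 2) / (real k - 1))))
              \<longrightarrow> whp p (makers_win A bv)) \<and>
           ((\<forall>\<^sub>F n in sequentially. p n < c * real n powr (- ((real k - 2) / (real k - 1))))
              \<longrightarrow> whp p (breakers_win A bv))"
      using C c by (intro exI[of _ C] exI[of _ c] conjI allI impI) auto
  next
    assume h: "irredundant_pair A bv \<and> irredundant A \<and> \<not> satisfies_star A"
    then have k: "k = 2" using star by simp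
    obtain xs where xs: "xs \<in> solutions 2 a 0" "\<forall>z\<in>set xs. z > 0"
      using h k irredundant_iff[of 2 a] by (auto simp: assms(3))
    obtain x y where "xs = [x, y]" "a 1 * x + a 2 * y = 0" using xs(1) solutions_2 by blast
    then have xy: "x > 0" "y > 0" "a 1 * x = - (a 2 * y)" using xs(2) by auto
    \<comment> \<open>A positive solution of the homogeneous equation forces opposite signs.\<close>
    have "a 1 * a 2 < 0"
    proof (rule ccontr)
      assume "\<not> a 1 * a 2 < 0"
      then have "0 < a 1 * a 2" using two by (simp add: not_less le_less)
      then have "0 < a 1 \<and> 0 < a 2 \<or> a 1 < 0 \<and> a 2 < 0" by (simp add: zero_less_mult_iff)
      then have "0 < a 1 * x \<and> 0 < a 2 * y \<or> a 1 * x < 0 \<and> a 2 * y < 0"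
        using xy(1,2) by (auto simp: mult_neg_pos)
      then show False using xy(3) by linarith
    qed
    then show "\<forall>p. prob_function p \<longrightarrow>
           (p \<ggreater> (\<lambda>n. real n powr (- 1 / 3)) \<longrightarrow> whp p (makers_win A bv)) \<and>
           (p \<lless> (\<lambda>n. real n powr (- 1 / 3)) \<longrightarrow> whp p (breakers_win A bv))"
      using two_variables[OF k] h by blast
  next
    assume h: "irredundant_pair A bv \<and> \<not> irredundant A"
    show "if (\<forall>i\<in>{1..k}. a i > 0) \<or> (\<forall>i\<in>{1..k}. a i < 0)
         then (\<forall>p. prob_function p \<and> p \<longlonglongrightarrow> 0 \<longrightarrow> whp p (breakers_win A bv))
         else (\<forall>p. prob_function p \<longrightarrow>
           (p \<ggreater> (\<lambda>n. real n powr (- 1 / 3)) \<longrightarrow> whp p (makers_win A bv)) \<and>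
           (p \<lless> (\<lambda>n. real n powr (- 1 / 3)) \<longrightarrow> whp p (breakers_win A bv)))"
    proof (cases "(\<forall>i\<in>{1..k}. a i > 0) \<or> (\<forall>i\<in>{1..k}. a i < 0)")
      case True
      have "whp p (breakers_win A bv)" if "prob_function p" "p \<longlonglongrightarrow> 0" for p
        using breaker_wins_one_sign[OF _ True that, of b] assms(1) by (simp add: assms(3,4))
      then show ?thesis unfolding if_P[OF True] by blast
    next
      case False
      then have mixed: "\<exists>i\<in>{1..k}. a i > 0" "\<exists>i\<in>{1..k}. a i < 0"
        using assms(2) by (metis linorder_neqE_linordered_idom)+
      have k: "k = 2"
      proof (rule ccontr)
        assume "k \<noteq> 2"
        then have "irredundant A"
          using assms(1) irredundant_if_mixed_signs[OF _ assms(2) mixed] by (simp add: assms(3))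
        then show False using h by simp
      qed
      obtain i j where "i \<in> {1..2}" "a i > 0" "j \<in> {1..2}" "a j < 0" using mixed k by blast
      then have "i = 1 \<and> j = 2 \<or> i = 2 \<and> j = 1" by (cases "i = j") auto
      then have "a 1 * a 2 < 0"
        using \<open>a i > 0\<close> \<open>a j < 0\<close> by (auto simp: mult_pos_neg mult_neg_pos)
      then show ?thesis unfolding if_not_P[OF False] using two_variables[OF k] h by blast
    qed
  next
    assume h: "\<not> irredundant_pair A bv"
    show "\<forall>n. breakers_win A bv (interval n)"
      unfolding assms(3,4)
    proof (intro allI breakers_win_if_no_solution)
      fix n xs assume "xs \<in> solutions k a b"
      then have "\<not> (\<forall>z\<in>set xs. z > 0)" using h irredundant_pair_iff[of k a b] by (auto simp: assms(3,4))
      then show "\<not> set xs \<subseteq> interval n" by (auto simp: interval_def)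
    qed simp
  }
qed

end
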